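(* Fix $h>0$ and let $p,q:\mathbb{R}\to\mathbb{C}$ be $1$-periodic functions with $p,q\in AC_{\rm loc}(\mathbb{R})$ and $p',q'\in L^\infty(\mathbb{R})$. Moreover, assume $\overline{p}\,\overline{q}=pq$. Let $\sigma(\mathfrak{D})\subset\mathbb{C}$ be the $L^2(\mathbb{R})^2$-spectrum of the Dirac operator $\mathfrak{D}$ with potentials $p,q$ and semiclassical parameter $h$. If $z\in\sigma(\mathfrak{D})$, then $$|\operatorname{Re} z|\,|\operatorname{Im} z|\le\frac{h}{2}\left(\|p'\|_\infty\|q'\|_\infty\right)^{1/2}.$$
   Context: The Dirac operator is the differential expression $\mathfrak{D}:= ih\sigma_3\partial_x + Q(x)$, $x\in\mathbb{R}$, where $i$ is the imaginary unit, $h>0$ is the semiclassical parameter, $\sigma_3=\begin{pmatrix}1&0\\0&-1\end{pmatrix}$ and $Q(x)=\begin{pmatrix}0&-iq(x)\\ ip(x)&0\end{pmatrix}$. It is realized as the densely and maximally defined closed operator $H\Psi=\mathfrak{D}\Psi$ in $L^2(\mathbb{R})^2=L^2(\mathbb{R};\mathbb{C}^2)$ with domain $\{\Psi\in L^2(\mathbb{R})^2:\Psi\in AC_{\rm loc}(\mathbb{R})^2,\ \mathfrak{D}\Psi\in L^2(\mathbb{R})^2\}$, where $AC_{\rm loc}(\mathbb{R})$ denotes the locally absolutely continuous complex-valued functions. $\sigma(\mathfrak{D})$ denotes the spectrum of this operator. $\|\cdot\|_\infty$ is the $L^\infty(\mathbb{R})$ (essential supremum) norm, and overbar denotes complex conjugation.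 *)

theory Defs
  imports "HOL-Analysis.Analysis" "HOL-Probability.Essential_Supremum"
begin

section \<open>Locally absolutely continuous functions\<close>

text \<open>
  A finite family of subintervals is given by the finite set of its pairs of endpoints;
  the intervals may share endpoints, so disjointness refers to the open intervals.
\<close>

definition AC_on :: "real \<Rightarrow> real \<Rightarrow> (real \<Rightarrow> complex) \<Rightarrow> bool" where
  "AC_on a b f \<longleftrightarrow>
    (\<forall>\<epsilon>>0. \<exists>\<delta>>0. \<forall>I :: (real \<times> real) set.
        finite I \<and> (\<forall>(s, t)\<in>I. a \<le> s \<and> s \<le> t \<and> t \<le> b)
          \<and> disjoint_family_on (\<lambda>(s, t). {s<..<t}) I
          \<and> (\<Sum>(s, t)\<in>I. t - s) < \<delta>
        \<longrightarrow> (\<Sum>(s, t)\<in>I. norm (f t - f s)) < \<epsilon>)"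

definition AC_loc :: "(real \<Rightarrow> complex) \<Rightarrow> bool" where
  "AC_loc f \<longleftrightarrow> (\<forall>a b. a < b \<longrightarrow> AC_on a b f)"


section \<open>Lebesgue spaces on the real line\<close>

text \<open>
  Elements of the Lebesgue spaces are represented by measurable functions; equality of
  elements is equality almost everywhere.
\<close>

definition Linf_seminorm :: "(real \<Rightarrow> complex) \<Rightarrow> ennreal" where
  "Linf_seminorm f = esssup lebesgue (\<lambda>x. ennreal (norm (f x)))"

definition Linf :: "(real \<Rightarrow> complex) set" where
  "Linf = {f \<in> borel_measurable lebesgue. Linf_seminorm f < \<infinity>}"

definition Linf_norm :: "(real \<Rightarrow> complex) \<Rightarrow> real" where
  "Linf_norm f = enn2real (Linf_seminorm f)"

text \<open>The norm of \<^typ>\<open>complex^2\<close> is the Hermitian one, so this is the Hilbert space norm.\<close>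

definition L2 :: "(real \<Rightarrow> complex^2) set" where
  "L2 = {f \<in> borel_measurable lebesgue. integrable lebesgue (\<lambda>x. (norm (f x))\<^sup>2)}"

definition L2_norm :: "(real \<Rightarrow> complex^2) \<Rightarrow> real" where
  "L2_norm f = sqrt (integral\<^sup>L lebesgue (\<lambda>x. (norm (f x))\<^sup>2))"

text \<open>
  The almost everywhere derivative. Where the function is not differentiable (a null set,
  for a locally absolutely continuous function) the value is unspecified.
\<close>

abbreviation ae_deriv :: "(real \<Rightarrow> 'a::real_normed_vector) \<Rightarrow> real \<Rightarrow> 'a" where
  "ae_deriv f \<equiv> (\<lambda>x. vector_derivative f (at x))"


section \<open>Spectrum of an unbounded operator\<close>

text \<open>
  For an operator \<open>T\<close> with domain \<open>Dom\<close> in the space above: \<open>z\<close> is in the resolvent set iff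
  \<open>T - z\<close> maps \<open>Dom\<close> bijectively onto the whole space (everything up to null sets) and the
  inverse is bounded.
\<close>

definition resolvent_set ::
    "(real \<Rightarrow> complex^2) set \<Rightarrow> ((real \<Rightarrow> complex^2) \<Rightarrow> (real \<Rightarrow> complex^2)) \<Rightarrow> complex set" where
  "resolvent_set Dom T =
    {z. (\<forall>f\<in>L2. \<exists>\<psi>\<in>Dom. (AE x in lebesgue. T \<psi> x - z *s \<psi> x = f x)) \<and>
        (\<forall>\<psi>\<in>Dom. \<forall>\<phi>\<in>Dom.
           (AE x in lebesgue. T \<psi> x - z *s \<psi> x = T \<phi> x - z *s \<phi> x) \<longrightarrow>
           (AE x in lebesgue. \<psi> x = \<phi> x)) \<and>
        (\<exists>C. \<forall>\<psi>\<in>Dom. L2_norm \<psi> \<le> C * L2_norm (\<lambda>x. T \<psi> x - z *s \<psi> x))}"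

definition spectrum ::
    "(real \<Rightarrow> complex^2) set \<Rightarrow> ((real \<Rightarrow> complex^2) \<Rightarrow> (real \<Rightarrow> complex^2)) \<Rightarrow> complex set" where
  "spectrum Dom T = - resolvent_set Dom T"


section \<open>The Dirac operator\<close>

definition sigma3 :: "complex^2^2" where
  "sigma3 = vector [vector [1, 0],
                    vector [0, -1]]"

definition potential :: "(real \<Rightarrow> complex) \<Rightarrow> (real \<Rightarrow> complex) \<Rightarrow> real \<Rightarrow> complex^2^2" where
  "potential p q x = vector [vector [0, - \<i> * q x],
                             vector [\<i> * p x, 0]]"

definition dirac ::
    "real \<Rightarrow> (real \<Rightarrow> complex) \<Rightarrow> (real \<Rightarrow> complex) \<Rightarrow> (real \<Rightarrow> complex^2) \<Rightarrow> (real \<Rightarrow> complex^2)" where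
  "dirac h p q \<psi> x =
    (\<i> * complex_of_real h) *s (sigma3 *v ae_deriv \<psi> x) + potential p q x *v \<psi> x"

definition dirac_domain ::
    "real \<Rightarrow> (real \<Rightarrow> complex) \<Rightarrow> (real \<Rightarrow> complex) \<Rightarrow> (real \<Rightarrow> complex^2) set" where
  "dirac_domain h p q = {\<psi> \<in> L2. (\<forall>j. AC_loc (\<lambda>x. \<psi> x $ j)) \<and> dirac h p q \<psi> \<in> L2}"

definition dirac_spectrum ::
    "real \<Rightarrow> (real \<Rightarrow> complex) \<Rightarrow> (real \<Rightarrow> complex) \<Rightarrow> complex set" where
  "dirac_spectrum h p q = spectrum (dirac_domain h p q) (dirac h p q)"

end

theory Submission
  imports Defs
begin

text \<open>
  Write \<open>D\<close> for the Dirac operator and \<open>P\<close>, \<open>R\<close> for the sup norms of \<open>p'\<close>, \<open>q'\<close>. Because the potential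
  matrix anticommutes with \<open>\<sigma>\<^sub>3\<close>, the square of \<open>D\<close> is \<open>- h\<^sup>2 \<partial>\<^sup>2 + p q\<close> plus a term of order zero
  that contains only \<open>h p'\<close> and \<open>h q'\<close> off the diagonal. As \<open>p q\<close> is real, the imaginary part of
  the numerical range of the square comes from that term alone. In the inner product that weights
  the second component by \<open>r\<^sup>2\<close> it is at most \<open>h (r\<^sup>2 P + R) / (2 r)\<close>, and the best \<open>r\<close> turns this
  into \<open>h\<close> times the square root of \<open>P R\<close> (lemma \<open>balancing_weight\<close>). Since
  \<open>Im (z\<^sup>2) = 2 Re z Im z\<close>, a point \<open>z\<close> that violates the claimed inequality lies at a positive
  distance from that range, and it has to be shown that \<open>z\<close> belongs to the resolvent set.

  No second derivatives are taken. The square enters in the weak form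
  \<open>\<langle>(D - z) \<psi>, (D\<^sup>* + cnj z) \<psi>\<rangle>\<close>, which makes sense on the domain of \<open>D\<close>. Its pointwise version is
  an algebraic identity up to the derivative of a quadratic expression in \<open>\<psi>\<close>, the flux
  (\<open>flux_identity\<close>). As \<open>(D\<^sup>* + cnj z) \<psi>\<close> differs from \<open>(D - z) \<psi>\<close> by a bounded multiple of \<open>\<psi>\<close>,
  the gap yields \<open>\<parallel>\<psi>\<parallel> \<le> C \<parallel>(D - z) \<psi>\<parallel>\<close> (\<open>energy_estimate\<close>): this is injectivity and boundedness
  of the inverse.

  Surjectivity is obtained by continuity, without Floquet theory. The constant in the estimate
  is the same for all potentials \<open>t p\<close>, \<open>t q\<close> with \<open>0 \<le> t \<le> 1\<close>. At \<open>t = 0\<close> the system decouples into two scalar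
  equations with constant coefficients, which are solved by tail integrals
  (\<open>free_dirac_solvable\<close>), and solvability propagates from \<open>t\<close> to all nearby parameters by a
  contraction (\<open>perturbation_solvable\<close>), hence reaches \<open>t = 1\<close> in finitely many equal steps
  (\<open>dirac_solvable\<close>). The bound on \<open>p\<close> and \<open>q\<close> that all constants depend on comes from periodicity.

  All integrations by parts take place in the class of locally absolutely continuous functions
  given by the epsilon-delta definition. That such functions are differentiable almost everywhere and
  are the integrals of their derivatives is the theorem of Lebesgue
  (\<open>AC_loc_primitive_vector_derivative\<close>). It is proved here without the variation function: the
  slopes of the dyadic polygons inscribed in the graph form a Cauchy sequence in the mean, because
  the lengths of these polygons increase to a finite limit.
\<close>

section \<open>Completeness of the space of integrable functions\<close>

lemma L1_complete:
  fixes s :: "nat \<Rightarrow> 'a \<Rightarrow> 'b::{banach, second_countable_topology}"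
  assumes int[measurable]: "\<And>n. integrable M (s n)"
    and cauchy: "\<And>e. e > 0 \<Longrightarrow> \<exists>N. \<forall>i\<ge>N. \<forall>j\<ge>N. (\<integral>x. norm (s i x - s j x) \<partial>M) < e"
  obtains g where "integrable M g" "(\<lambda>n. \<integral>x. norm (s n x - g x) \<partial>M) \<longlonglongrightarrow> 0"
proof -
  obtain r where r: "strict_mono r" and ae: "AE x in M. Cauchy (\<lambda>i. s (r i) x)"
    using cauchy_L1_AE_cauchy_subseq[OF assms] by metis
  define g where "g x = lim (\<lambda>i. s (r i) x)" for x
  have lim: "AE x in M. (\<lambda>i. s (r i) x) \<longlonglongrightarrow> g x"
    using ae by eventually_elim (simp add: g_def Cauchy_convergent_iff convergent_LIMSEQ_iff)
  have [measurable]: "g \<in> borel_measurable M"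
    unfolding g_def by (intro borel_measurable_lim_metric) (use int in measurable)
  have bound: "\<exists>N. \<forall>i\<ge>N. (\<integral>\<^sup>+x. ennreal (norm (s i x - g x)) \<partial>M) \<le> ennreal e" if e: "e > 0" for e :: real
  proof -
    obtain N where N: "\<And>i j. i \<ge> N \<Longrightarrow> j \<ge> N \<Longrightarrow> (\<integral>x. norm (s i x - s j x) \<partial>M) < e"
      using cauchy[OF e] by blast
    have "(\<integral>\<^sup>+x. ennreal (norm (s i x - g x)) \<partial>M) \<le> ennreal e" if i: "i \<ge> N" for i
    proof -
      have "(\<integral>\<^sup>+x. ennreal (norm (s i x - g x)) \<partial>M)
          = (\<integral>\<^sup>+x. liminf (\<lambda>j. ennreal (norm (s i x - s (r j) x))) \<partial>M)"
      proof (rule nn_integral_cong_AE)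
        show "AE x in M. ennreal (norm (s i x - g x)) = liminf (\<lambda>j. ennreal (norm (s i x - s (r j) x)))"
          using lim
        proof eventually_elim
          case (elim x)
          then have "(\<lambda>j. ennreal (norm (s i x - s (r j) x))) \<longlonglongrightarrow> ennreal (norm (s i x - g x))"
            by (intro tendsto_ennrealI tendsto_intros)
          from lim_imp_Liminf[OF _ this] show ?case by simp
        qed
      qed
      also have "\<dots> \<le> liminf (\<lambda>j. \<integral>\<^sup>+x. ennreal (norm (s i x - s (r j) x)) \<partial>M)"
        by (rule nn_integral_liminf) measurable
      also have "\<dots> \<le> liminf (\<lambda>j. ennreal e)"
      proof (rule Liminf_mono)
        show "\<forall>\<^sub>F j in sequentially. (\<integral>\<^sup>+x. ennreal (norm (s i x - s (r j) x)) \<partial>M) \<le> ennreal e"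
          using eventually_ge_at_top[of N]
        proof eventually_elim
          case (elim j)
          then have "r j \<ge> N" using r seq_suble order_trans by blast
          then have "(\<integral>x. norm (s i x - s (r j) x) \<partial>M) \<le> e" using N[OF i, of "r j"] by simp
          moreover have "integrable M (\<lambda>x. norm (s i x - s (r j) x))" using int by auto
          ultimately show ?case
            by (subst nn_integral_eq_integral) (auto simp: ennreal_leI)
        qed
      qed
      finally show ?thesis by (simp add: Liminf_const)
    qed
    then show ?thesis by blast
  qed
  obtain N where "(\<integral>\<^sup>+x. ennreal (norm (s N x - g x)) \<partial>M) \<le> ennreal 1" using bound[of 1] by auto
  then have "integrable M (\<lambda>x. s N x - g x)"
    by (intro integrableI_bounded) (auto simp: less_le_trans intro: le_less_trans)
  from Bochner_Integration.integrable_diff[OF int[of N] this] have g: "integrable M g" by simp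
  moreover have "(\<lambda>n. \<integral>x. norm (s n x - g x) \<partial>M) \<longlonglongrightarrow> 0"
  proof (rule LIMSEQ_I)
    fix e :: real assume e: "e > 0"
    obtain N where N: "\<And>i. i \<ge> N \<Longrightarrow> (\<integral>\<^sup>+x. ennreal (norm (s i x - g x)) \<partial>M) \<le> ennreal (e/2)"
      using bound[of "e/2"] e by auto
    have "norm ((\<integral>x. norm (s i x - g x) \<partial>M) - 0) < e" if "i \<ge> N" for i
    proof -
      have "integrable M (\<lambda>x. norm (s i x - g x))" using int g by auto
      then have "ennreal (\<integral>x. norm (s i x - g x) \<partial>M) \<le> ennreal (e/2)"
        using N[OF that] by (subst (asm) nn_integral_eq_integral) auto
      then have "(\<integral>x. norm (s i x - g x) \<partial>M) \<le> e/2" using e by (simp add: ennreal_le_iff)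
      moreover have "(\<integral>x. norm (s i x - g x) \<partial>M) \<ge> 0" by simp
      ultimately show ?thesis using e by simp
    qed
    then show "\<exists>no. \<forall>n\<ge>no. norm ((\<integral>x. norm (s n x - g x) \<partial>M) - 0) < e" by blast
  qed
  ultimately show ?thesis by (rule that)
qed

section \<open>Absolutely continuous functions are indefinite integrals\<close>

text \<open>The integrand of arc length: a strictly convex function of linear growth.\<close>

definition arclen :: "complex \<Rightarrow> real" where "arclen c = sqrt (1 + (norm c)\<^sup>2)"

lemma arclen_ge_1: "arclen c \<ge> 1"
  and arclen_le: "arclen c \<le> 1 + norm c"
  and arclen_sq: "(arclen c)\<^sup>2 = 1 + (norm c)\<^sup>2"
proof -
  show "arclen c \<ge> 1" "(arclen c)\<^sup>2 = 1 + (norm c)\<^sup>2"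
    unfolding arclen_def by (auto intro!: real_le_rsqrt simp: add_nonneg_nonneg)
  show "arclen c \<le> 1 + norm c" unfolding arclen_def by (rule real_le_lsqrt) (auto simp: power2_eq_square algebra_simps)
qed

text \<open>
  The factor \<open>arclen t - (1 + inner s t) / arclen s\<close> is the excess of \<open>arclen\<close> at \<open>t\<close> over its tangent
  at \<open>s\<close>. By the Lagrange identity this excess is at least
  \<open>(norm (t - s))\<^sup>2 / (2 (arclen s)\<^sup>2 arclen t)\<close>; the inequality of the arithmetic and geometric
  means then splits off a small multiple of \<open>arclen t\<close>.
\<close>

lemma arclen_bregman:
  assumes "\<eta> > 0"
  shows "norm (t - s) \<le> \<eta> * arclen t + (arclen s)\<^sup>2 / (2 * \<eta>) * (arclen t - (1 + inner s t) / arclen s)"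
proof -
  define X where "X = arclen t * arclen s"
  define Y where "Y = 1 + inner s t"
  have pos: "arclen s > 0" "arclen t > 0" using arclen_ge_1[of s] arclen_ge_1[of t] by linarith+
  have XY: "X\<^sup>2 - Y\<^sup>2 \<ge> (norm (t - s))\<^sup>2"
  proof -
    have "X\<^sup>2 = (1 + (norm t)\<^sup>2) * (1 + (norm s)\<^sup>2)" unfolding X_def power_mult_distrib arclen_sq ..
    moreover have "(norm (t - s))\<^sup>2 = (norm t)\<^sup>2 - 2 * inner s t + (norm s)\<^sup>2"
      by (simp add: power2_norm_eq_inner inner_diff_left inner_diff_right inner_commute)
    moreover have "(inner s t)\<^sup>2 \<le> (norm s)\<^sup>2 * (norm t)\<^sup>2"
      using Cauchy_Schwarz_ineq[of s t] by (simp add: power2_norm_eq_inner)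
    ultimately show ?thesis unfolding Y_def by (simp add: algebra_simps power2_eq_square)
  qed
  have "X > 0" using pos by (simp add: X_def)
  have "\<bar>Y\<bar> \<le> \<bar>X\<bar>" using XY by (subst abs_le_square_iff) (smt (verit) zero_le_power2)
  then have "Y \<le> X" using \<open>X > 0\<close> by simp
  then have "X\<^sup>2 - Y\<^sup>2 \<le> 2 * X * (X - Y)" using zero_le_power2[of "X - Y"]
    by (simp add: power2_eq_square algebra_simps)
  then have 1: "(norm (t - s))\<^sup>2 \<le> 2 * X * (X - Y)" using XY by linarith
  define D where "D = arclen t - (1 + inner s t) / arclen s"
  have "X - Y = arclen s * D" using pos by (simp add: X_def Y_def D_def field_simps)
  then have 2: "(norm (t - s))\<^sup>2 \<le> 2 * (arclen t * (arclen s)\<^sup>2 * D)"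
    using 1 by (simp add: X_def power2_eq_square algebra_simps)
  have "0 \<le> (norm (t - s) / (2 * sqrt (\<eta> * arclen t)) - sqrt (\<eta> * arclen t))\<^sup>2" by simp
  also have "\<dots> = (norm (t - s))\<^sup>2 / (4 * (\<eta> * arclen t)) - norm (t - s) + \<eta> * arclen t"
    using assms pos by (simp add: power2_diff power_divide power_mult_distrib real_sqrt_mult)
  finally have "norm (t - s) \<le> \<eta> * arclen t + (norm (t - s))\<^sup>2 / (4 * (\<eta> * arclen t))" by simp
  also have "(norm (t - s))\<^sup>2 / (4 * (\<eta> * arclen t)) \<le> 2 * (arclen t * (arclen s)\<^sup>2 * D) / (4 * (\<eta> * arclen t))"
    using 2 assms pos by (intro divide_right_mono) auto
  also have "\<dots> = (arclen s)\<^sup>2 / (2 * \<eta>) * D" using assms pos by (simp add: field_simps)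
  finally show ?thesis unfolding D_def by simp
qed

text \<open>
  Here \<open>s\<close> is the slope of a chord over a cell and \<open>t i\<close> are the slopes over its equal parts. The
  linear part of the tangent averages out, so the excesses sum up to the gain in arc length.
\<close>

lemma arclen_cell:
  assumes \<eta>: "\<eta> > 0" and M: "M > 0" and mean: "(\<Sum>i<M. t i) = of_nat M * s"
  shows "real M * arclen s \<le> (\<Sum>i<M. arclen (t i))"
    and "(\<Sum>i<M. norm (t i - s)) \<le> \<eta> * (\<Sum>i<M. arclen (t i))
           + (arclen s)\<^sup>2 / (2 * \<eta>) * ((\<Sum>i<M. arclen (t i)) - real M * arclen s)"
proof -
  have pos: "arclen s > 0" using arclen_ge_1[of s] by linarith
  have "(\<Sum>i<M. inner s (t i)) = inner s (of_nat M * s)"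
    unfolding mean[symmetric] by (rule inner_sum_right[symmetric])
  also have "\<dots> = real M * (norm s)\<^sup>2"
    by (metis inner_scaleR_right power2_norm_eq_inner scaleR_conv_of_real of_real_of_nat_eq)
  finally have "(\<Sum>i<M. (1 + inner s (t i)) / arclen s) = real M * (arclen s)\<^sup>2 / arclen s"
    by (simp add: sum_divide_distrib[symmetric] sum.distrib arclen_sq algebra_simps)
  then have D: "(\<Sum>i<M. arclen (t i) - (1 + inner s (t i)) / arclen s) = (\<Sum>i<M. arclen (t i)) - real M * arclen s"
    using pos by (simp add: sum_subtractf power2_eq_square)
  have "(\<Sum>i<M. norm (t i - s)) \<le> (\<Sum>i<M. \<eta> * arclen (t i) + (arclen s)\<^sup>2 / (2 * \<eta>) * (arclen (t i) - (1 + inner s (t i)) / arclen s))"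
    by (intro sum_mono arclen_bregman \<eta>)
  also have "\<dots> = \<eta> * (\<Sum>i<M. arclen (t i)) + (arclen s)\<^sup>2 / (2 * \<eta>) * ((\<Sum>i<M. arclen (t i)) - real M * arclen s)"
    unfolding D[symmetric] by (simp add: sum.distrib sum_distrib_left)
  finally show "(\<Sum>i<M. norm (t i - s)) \<le> \<eta> * (\<Sum>i<M. arclen (t i))
           + (arclen s)\<^sup>2 / (2 * \<eta>) * ((\<Sum>i<M. arclen (t i)) - real M * arclen s)" .
  have "0 \<le> arclen (t i) - (1 + inner s (t i)) / arclen s" for i
  proof -
    have "1 + inner s (t i) \<le> arclen s * arclen (t i)"
    proof -
      have "1 + inner s (t i) \<le> 1 + norm s * norm (t i)" using norm_cauchy_schwarz[of s "t i"] by simp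
      also have "\<dots> \<le> arclen s * arclen (t i)"
      proof (rule power2_le_imp_le)
        have "0 \<le> (norm s - norm (t i))\<^sup>2" by simp
        then show "(1 + norm s * norm (t i))\<^sup>2 \<le> (arclen s * arclen (t i))\<^sup>2"
          unfolding power_mult_distrib arclen_sq by (simp add: power2_eq_square algebra_simps)
        show "0 \<le> arclen s * arclen (t i)" using pos arclen_ge_1[of "t i"] by simp
      qed
      finally show ?thesis .
    qed
    then show ?thesis using pos by (simp add: field_simps)
  qed
  then have "0 \<le> (\<Sum>i<M. arclen (t i) - (1 + inner s (t i)) / arclen s)" by (intro sum_nonneg)
  then show "real M * arclen s \<le> (\<Sum>i<M. arclen (t i))" unfolding D by simp
qed

definition dyad :: "real \<Rightarrow> real \<Rightarrow> nat \<Rightarrow> nat \<Rightarrow> real" where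
  "dyad a b n k = a + (b - a) * real k / 2 ^ n"

definition slope :: "(real \<Rightarrow> complex) \<Rightarrow> real \<Rightarrow> real \<Rightarrow> nat \<Rightarrow> nat \<Rightarrow> complex" where
  "slope f a b n k = (2 ^ n / (b - a)) *\<^sub>R (f (dyad a b n (Suc k)) - f (dyad a b n k))"

definition dyad_index :: "real \<Rightarrow> real \<Rightarrow> nat \<Rightarrow> real \<Rightarrow> nat" where
  "dyad_index a b n x = nat \<lfloor>2 ^ n * (x - a) / (b - a)\<rfloor>"

text \<open>The length of the polygon inscribed in the graph of \<open>f\<close> over the dyadic points of level \<open>n\<close>.\<close>

definition arc_length :: "(real \<Rightarrow> complex) \<Rightarrow> real \<Rightarrow> real \<Rightarrow> nat \<Rightarrow> real" where
  "arc_length f a b n = (b - a) / 2 ^ n * (\<Sum>k<2 ^ n. arclen (slope f a b n k))"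

lemma dyad_mono: "a \<le> b \<Longrightarrow> k \<le> l \<Longrightarrow> dyad a b n k \<le> dyad a b n l"
  by (simp add: dyad_def divide_right_mono mult_left_mono)

lemma dyad_0 [simp]: "dyad a b n 0 = a" and dyad_end [simp]: "dyad a b n (2 ^ n) = b"
  by (simp_all add: dyad_def)

lemma dyad_refine: "dyad a b (n + j) (k * 2 ^ j) = dyad a b n k"
  by (simp add: dyad_def power_add field_simps)

lemma dyad_index_eq:
  assumes "a < b" "a \<le> x"
  shows "dyad_index a b n x = k \<longleftrightarrow> dyad a b n k \<le> x \<and> x < dyad a b n (Suc k)"
proof -
  have nn: "0 \<le> 2 ^ n * (x - a) / (b - a)" using assms by simp
  then have "dyad_index a b n x = k \<longleftrightarrow> \<lfloor>2 ^ n * (x - a) / (b - a)\<rfloor> = int k"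
    unfolding dyad_index_def by (metis int_nat_eq nat_int zero_le_floor)
  also have "\<dots> \<longleftrightarrow> real k \<le> 2 ^ n * (x - a) / (b - a) \<and> 2 ^ n * (x - a) / (b - a) < real k + 1"
    by (simp add: floor_eq_iff)
  also have "\<dots> \<longleftrightarrow> dyad a b n k \<le> x \<and> x < dyad a b n (Suc k)"
    using assms by (simp add: dyad_def field_simps)
  finally show ?thesis .
qed

lemma dyad_index_refine:
  assumes "a < b" "a \<le> x"
  shows "dyad_index a b n x = dyad_index a b (n + j) x div 2 ^ j"
proof -
  let ?y = "2 ^ (n + j) * (x - a) / (b - a)"
  have nn: "0 \<le> ?y" using assms by simp
  have "2 ^ n * (x - a) / (b - a) = ?y / real_of_int (2 ^ j)" using assms by (simp add: power_add)
  then have "\<lfloor>2 ^ n * (x - a) / (b - a)\<rfloor> = \<lfloor>?y\<rfloor> div 2 ^ j"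
    by (metis floor_divide_real_eq_div zero_le_numeral zero_le_power)
  then show ?thesis using nn unfolding dyad_index_def
    by (simp add: nat_div_distrib nat_power_eq)
qed

text \<open>
  Integrals of functions that are constant on the cells become finite sums; the half-open cells
  partition the half-open interval. The index \<open>K\<close> also covers integrals up to an inner dyadic point.
\<close>

lemma has_bochner_integral_dyadic_step:
  fixes H :: "nat \<Rightarrow> 'b::euclidean_space"
  assumes "a < b"
  shows "has_bochner_integral lebesgue (\<lambda>x. indicator {a..<dyad a b n K} x *\<^sub>R H (dyad_index a b n x))
           (((b - a) / 2 ^ n) *\<^sub>R (\<Sum>k<K. H k))"
proof -
  have "indicator {a..<dyad a b n K} x *\<^sub>R H (dyad_index a b n x)
      = (\<Sum>k<K. indicator {dyad a b n k..<dyad a b n (Suc k)} x *\<^sub>R H k)" for x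
  proof (cases "a \<le> x")
    case False
    then have "x \<notin> {dyad a b n k..<dyad a b n (Suc k)}" for k
      using dyad_mono[of a b 0 k n] assms by auto
    then show ?thesis using False by simp
  next
    case True
    let ?k = "dyad_index a b n x"
    have "(\<Sum>k<K. indicator {dyad a b n k..<dyad a b n (Suc k)} x *\<^sub>R H k) = (\<Sum>k<K. if k = ?k then H k else 0)"
    proof (intro sum.cong refl)
      fix k show "indicator {dyad a b n k..<dyad a b n (Suc k)} x *\<^sub>R H k = (if k = ?k then H k else 0)"
        using dyad_index_eq[OF assms True, of n k] by (auto simp: indicator_def)
    qed
    also have "\<dots> = (if ?k < K then H ?k else 0)" by simp
    also have "\<dots> = indicator {a..<dyad a b n K} x *\<^sub>R H ?k"
    proof -
      have k: "dyad a b n ?k \<le> x" "x < dyad a b n (Suc ?k)"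
        using dyad_index_eq[OF assms True, of n ?k] by auto
      have "?k < K \<longleftrightarrow> x < dyad a b n K"
      proof
        assume "?k < K" then show "x < dyad a b n K"
          using k(2) dyad_mono[of a b "Suc ?k" K n] assms by auto
      next
        assume "x < dyad a b n K" then show "?k < K"
          using k(1) dyad_mono[of a b K ?k n] assms by (meson leD leI less_imp_le order_trans)
      qed
      then show ?thesis using True by (simp add: indicator_def)
    qed
    finally show ?thesis by simp
  qed
  moreover have "has_bochner_integral lebesgue (\<lambda>x. \<Sum>k<K. indicator {dyad a b n k..<dyad a b n (Suc k)} x *\<^sub>R H k)
      (\<Sum>k<K. ((b - a) / 2 ^ n) *\<^sub>R H k)"
  proof (intro has_bochner_integral_sum has_bochner_integral_scaleR_left)
    fix k
    have "dyad a b n (Suc k) - dyad a b n k = (b - a) / 2 ^ n" by (simp add: dyad_def field_simps)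
    moreover have "dyad a b n k \<le> dyad a b n (Suc k)" using dyad_mono assms by simp
    moreover have "has_bochner_integral lebesgue (indicator {dyad a b n k..<dyad a b n (Suc k)} :: real \<Rightarrow> real)
        (measure lebesgue {dyad a b n k..<dyad a b n (Suc k)})"
      using \<open>dyad a b n k \<le> dyad a b n (Suc k)\<close> by (intro has_bochner_integral_real_indicator) (auto simp: emeasure_lborel_Ico)
    ultimately show "has_bochner_integral lebesgue (indicat_real {dyad a b n k..<dyad a b n (Suc k)}) ((b - a) / 2 ^ n)"
      by simp
  qed
  ultimately show ?thesis by (simp add: scaleR_sum_right)
qed

lemma sum_blocks: "(\<Sum>k<A * M. F k) = (\<Sum>k<A. \<Sum>i<M. F (k * M + i))" for F :: "nat \<Rightarrow> 'a::comm_monoid_add"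
proof -
  have "sum F {k * M..<k * M + M} = (\<Sum>i<M. F (k * M + i))" for k
    using sum.shift_bounds_nat_ivl[of F 0 "k * M" M] by (simp add: add.commute lessThan_atLeast0)
  then show ?thesis using sum.nat_group[of F M A] by simp
qed

lemma slope_mean:
  assumes "a < b"
  shows "(\<Sum>i<2 ^ j. slope f a b (n + j) (k * 2 ^ j + i)) = of_nat (2 ^ j) * slope f a b n k"
proof -
  have "(\<Sum>i<2 ^ j. f (dyad a b (n + j) (k * 2 ^ j + Suc i)) - f (dyad a b (n + j) (k * 2 ^ j + i)))
     = f (dyad a b (n + j) (k * 2 ^ j + 2 ^ j)) - f (dyad a b (n + j) (k * 2 ^ j + 0))"
    by (rule sum_lessThan_telescope)
  also have "k * 2 ^ j + 2 ^ j = Suc k * 2 ^ j" by simp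
  finally have "(\<Sum>i<2 ^ j. f (dyad a b (n + j) (Suc (k * 2 ^ j + i))) - f (dyad a b (n + j) (k * 2 ^ j + i)))
     = f (dyad a b n (Suc k)) - f (dyad a b n k)"
    by (simp only: dyad_refine add_Suc_right add_0_right)
  then show ?thesis
    unfolding slope_def scaleR_sum_right[symmetric] by (simp add: power_add scaleR_conv_of_real)
qed

lemma arc_length_blocks:
  "arc_length f a b (n + j) = (b - a) / 2 ^ (n + j) * (\<Sum>k<2 ^ n. \<Sum>i<2 ^ j. arclen (slope f a b (n + j) (k * 2 ^ j + i)))"
  unfolding arc_length_def power_add sum_blocks[of _ "2 ^ n" "2 ^ j"] ..

lemma arc_length_mono:
  assumes "a < b"
  shows "arc_length f a b n \<le> arc_length f a b (n + j)"
proof -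
  have "arc_length f a b n = (b - a) / 2 ^ (n + j) * (\<Sum>k<2 ^ n. real (2 ^ j) * arclen (slope f a b n k))"
    unfolding arc_length_def sum_distrib_left[symmetric] by (simp add: power_add)
  also have "\<dots> \<le> arc_length f a b (n + j)"
    unfolding arc_length_blocks using assms slope_mean[OF assms, of f]
    by (intro mult_left_mono sum_mono arclen_cell(1)[of 1]) auto
  finally show ?thesis .
qed

text \<open>
  The distance in the mean between the slope functions of two levels. On the cells with a moderate
  slope it is controlled by the gain in arc length through \<open>arclen_cell\<close>. On the others the difference is
  crudely bounded by the variation of \<open>f\<close> over the finer cells, which has to be small.
\<close>

lemma slope_L1_distance:
  assumes ab: "a < b" and \<eta>: "\<eta> > 0"
    and bad: "(\<Sum>k | k < 2 ^ n \<and> norm (slope f a b n k) > K. \<Sum>i<2 ^ j.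
        norm (f (dyad a b (n + j) (Suc (k * 2 ^ j + i))) - f (dyad a b (n + j) (k * 2 ^ j + i)))) \<le> e"
  shows "(b - a) / 2 ^ (n + j) * (\<Sum>k<2 ^ n. \<Sum>i<2 ^ j. norm (slope f a b (n + j) (k * 2 ^ j + i) - slope f a b n k))
     \<le> \<eta> * arc_length f a b (n + j) + (1 + K\<^sup>2) / (2 * \<eta>) * (arc_length f a b (n + j) - arc_length f a b n) + 2 * e"
proof -
  let ?L = "(b - a) / 2 ^ (n + j)"
  let ?t = "\<lambda>k i. slope f a b (n + j) (k * 2 ^ j + i)"
  let ?s = "slope f a b n"
  define B where "B = {k. k < 2 ^ n \<and> norm (?s k) > K}"
  have L: "?L > 0" using ab by simp
  have mean: "(\<Sum>i<2 ^ j. ?t k i) = of_nat (2 ^ j) * ?s k" for k by (rule slope_mean[OF ab])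
  define T where "T k = (\<Sum>i<2 ^ j. arclen (?t k i))" for k
  define D where "D k = T k - real (2 ^ j) * arclen (?s k)" for k
  have D0: "D k \<ge> 0" for k unfolding D_def T_def using arclen_cell(1)[OF \<eta> _ mean, of k] by simp
  have T0: "T k \<ge> 0" for k unfolding T_def using arclen_ge_1 by (intro sum_nonneg) (meson order_trans zero_le_one)
  define R where "R k = (if k \<in> B then \<Sum>i<2 ^ j. norm (?t k i) else 0)" for k
  have cell: "(\<Sum>i<2 ^ j. norm (?t k i - ?s k)) \<le> \<eta> * T k + (1 + K\<^sup>2) / (2 * \<eta>) * D k + 2 * R k" if k: "k < 2 ^ n" for k
  proof (cases "k \<in> B")
    case False
    then have "norm (?s k) \<le> K" using k by (simp add: B_def)
    then have "(arclen (?s k))\<^sup>2 \<le> 1 + K\<^sup>2" unfolding arclen_sq by (simp add: power_mono)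
    then have "(arclen (?s k))\<^sup>2 / (2 * \<eta>) * D k \<le> (1 + K\<^sup>2) / (2 * \<eta>) * D k"
      using D0 \<eta> by (intro mult_right_mono divide_right_mono) auto
    moreover have "(\<Sum>i<2 ^ j. norm (?t k i - ?s k)) \<le> \<eta> * T k + (arclen (?s k))\<^sup>2 / (2 * \<eta>) * D k"
      unfolding T_def D_def by (rule arclen_cell(2)[OF \<eta> _ mean]) simp
    ultimately show ?thesis using False by (simp add: R_def)
  next
    case True
    have "(\<Sum>i<2 ^ j. norm (?t k i - ?s k)) \<le> (\<Sum>i<2 ^ j. norm (?t k i) + norm (?s k))"
      by (intro sum_mono norm_triangle_ineq4)
    also have "\<dots> = (\<Sum>i<2 ^ j. norm (?t k i)) + norm (of_nat (2 ^ j) * ?s k)"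
      by (simp add: sum.distrib norm_mult norm_power)
    also have "\<dots> \<le> 2 * (\<Sum>i<2 ^ j. norm (?t k i))"
      unfolding mean[symmetric] using norm_sum[of "?t k" "{..<2 ^ j}"] by simp
    also have "\<dots> \<le> \<eta> * T k + (1 + K\<^sup>2) / (2 * \<eta>) * D k + \<dots>" using \<eta> T0[of k] D0[of k] by simp
    finally show ?thesis using True by (simp add: R_def)
  qed
  have lin: "l * (\<Sum>k<2 ^ n. \<eta> * T k + c * D k + 2 * R k)
      = \<eta> * (l * (\<Sum>k<2 ^ n. T k)) + c * (l * (\<Sum>k<2 ^ n. D k)) + 2 * (l * (\<Sum>k<2 ^ n. R k))" for l c
    unfolding sum.distrib sum_distrib_left[symmetric] by (simp only: algebra_simps)
  have "?L * (\<Sum>k<2 ^ n. \<Sum>i<2 ^ j. norm (?t k i - ?s k)) \<le> ?L * (\<Sum>k<2 ^ n. \<eta> * T k + (1 + K\<^sup>2) / (2 * \<eta>) * D k + 2 * R k)"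
    using L cell by (intro mult_left_mono sum_mono) auto
  also note lin
  also have "?L * (\<Sum>k<2 ^ n. T k) = arc_length f a b (n + j)" unfolding T_def arc_length_blocks ..
  also have "?L * (\<Sum>k<2 ^ n. D k) = arc_length f a b (n + j) - arc_length f a b n"
  proof -
    have "?L * (\<Sum>k<2 ^ n. real (2 ^ j) * arclen (?s k)) = arc_length f a b n"
      unfolding arc_length_def sum_distrib_left[symmetric] by (simp add: power_add)
    then show ?thesis unfolding D_def sum_subtractf right_diff_distrib
      by (simp add: arc_length_blocks T_def)
  qed
  also have "?L * (\<Sum>k<2 ^ n. R k) \<le> e"
  proof -
    have eq: "?L * norm (?t k i) = norm (f (dyad a b (n + j) (Suc (k * 2 ^ j + i))) - f (dyad a b (n + j) (k * 2 ^ j + i)))" for k i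
      unfolding slope_def using ab by simp
    have "(\<Sum>k<2 ^ n. R k) = (\<Sum>k\<in>B. \<Sum>i<2 ^ j. norm (?t k i))"
    proof -
      have "{..<2 ^ n} \<inter> B = B" by (auto simp: B_def)
      then show ?thesis by (simp add: R_def sum.inter_restrict[symmetric])
    qed
    then show ?thesis using bad unfolding B_def[symmetric]
      by (simp only: sum_distrib_left eq)
  qed
  finally show ?thesis by simp
qed

lemma AC_on_cells:
  assumes "a < b" "AC_on a b f" "e > 0"
  obtains d where "d > 0" "\<And>n S. S \<subseteq> {..<2 ^ n} \<Longrightarrow> real (card S) * ((b - a) / 2 ^ n) < d
     \<Longrightarrow> (\<Sum>k\<in>S. norm (f (dyad a b n (Suc k)) - f (dyad a b n k))) < e"
proof -
  obtain d where d: "d > 0" and I: "\<And>I. finite I \<Longrightarrow> (\<forall>(s, t)\<in>I. a \<le> s \<and> s \<le> t \<and> t \<le> b)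
          \<Longrightarrow> disjoint_family_on (\<lambda>(s, t). {s<..<t}) I \<Longrightarrow> (\<Sum>(s, t)\<in>I. t - s) < d
        \<Longrightarrow> (\<Sum>(s, t)\<in>I. norm (f t - f s)) < e"
    using assms unfolding AC_on_def by meson
  have "(\<Sum>k\<in>S. norm (f (dyad a b n (Suc k)) - f (dyad a b n k))) < e"
    if S: "S \<subseteq> {..<2 ^ n}" and c: "real (card S) * ((b - a) / 2 ^ n) < d" for n S
  proof -
    let ?P = "\<lambda>k. (dyad a b n k, dyad a b n (Suc k))"
    have inj: "inj_on ?P S" using assms(1) by (auto simp: inj_on_def dyad_def)
    have fin: "finite S" using S finite_subset by blast
    have 1: "a \<le> dyad a b n k" "dyad a b n k \<le> dyad a b n (Suc k)" "dyad a b n (Suc k) \<le> b" if "k \<in> S" for k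
    proof -
      have "Suc k \<le> 2 ^ n" using S that by auto
      then show "a \<le> dyad a b n k" "dyad a b n k \<le> dyad a b n (Suc k)" "dyad a b n (Suc k) \<le> b"
        using dyad_mono[of a b 0 k n] dyad_mono[of a b k "Suc k" n] dyad_mono[of a b "Suc k" "2 ^ n" n] assms(1) by auto
    qed
    have "(\<Sum>(s, t)\<in>?P ` S. norm (f t - f s)) < e"
    proof (rule I)
      show "finite (?P ` S)" using fin by simp
      show "\<forall>(s, t)\<in>?P ` S. a \<le> s \<and> s \<le> t \<and> t \<le> b" using 1 by auto
      show "disjoint_family_on (\<lambda>(s, t). {s<..<t}) (?P ` S)"
        unfolding disjoint_family_on_def
      proof (intro ballI impI)
        fix x y assume "x \<in> ?P ` S" "y \<in> ?P ` S" "x \<noteq> y"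
        then obtain k l where xy: "x = ?P k" "y = ?P l" and "k \<noteq> l" by blast
        then have "Suc k \<le> l \<or> Suc l \<le> k" by auto
        then have "dyad a b n (Suc k) \<le> dyad a b n l \<or> dyad a b n (Suc l) \<le> dyad a b n k"
          using dyad_mono assms(1) by (meson less_imp_le)
        then show "(case x of (s, t) \<Rightarrow> {s<..<t}) \<inter> (case y of (s, t) \<Rightarrow> {s<..<t}) = {}"
          unfolding xy by auto
      qed
      have "(\<Sum>(s, t)\<in>?P ` S. t - s) = (\<Sum>k\<in>S. (b - a) / 2 ^ n)"
        by (subst sum.reindex[OF inj]) (auto simp: dyad_def field_simps intro!: sum.cong)
      then show "(\<Sum>(s, t)\<in>?P ` S. t - s) < d" using c by simp
    qed
    then show ?thesis by (simp add: sum.reindex[OF inj] o_def)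
  qed
  then show ?thesis using that[OF d] by blast
qed

lemma AC_on_dyadic_variation_bounded:
  assumes ab: "a < b" and AC: "AC_on a b f"
  obtains V n0 where "V > 0" "\<And>n. n \<ge> n0 \<Longrightarrow> (\<Sum>k<2 ^ n. norm (f (dyad a b n (Suc k)) - f (dyad a b n k))) \<le> V"
proof -
  obtain d where d: "d > 0" and small: "\<And>n S. S \<subseteq> {..<2 ^ n} \<Longrightarrow> real (card S) * ((b - a) / 2 ^ n) < d
     \<Longrightarrow> (\<Sum>k\<in>S. norm (f (dyad a b n (Suc k)) - f (dyad a b n k))) < 1"
    using AC_on_cells[OF ab AC zero_less_one] by blast
  obtain n0 where n0: "(b - a) / d < 2 ^ n0" using real_arch_pow[of 2 "(b - a) / d"] by auto
  have "(\<Sum>k<2 ^ n. norm (f (dyad a b n (Suc k)) - f (dyad a b n k))) \<le> 2 ^ n0" if n: "n \<ge> n0" for n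
  proof -
    obtain j where j: "n = n0 + j" using n le_Suc_ex by blast
    let ?F = "\<lambda>k. norm (f (dyad a b n (Suc k)) - f (dyad a b n k))"
    have "(\<Sum>k<2 ^ n. ?F k) = (\<Sum>k<2 ^ n0. \<Sum>i<2 ^ j. ?F (k * 2 ^ j + i))"
      unfolding j power_add by (rule sum_blocks)
    also have "\<dots> \<le> (\<Sum>k<(2::nat) ^ n0. 1)"
    proof (intro sum_mono)
      fix k :: nat assume k: "k \<in> {..<2 ^ n0}"
      let ?g = "\<lambda>i. k * 2 ^ j + i"
      have inj: "inj_on ?g {..<2 ^ j}" by (simp add: inj_on_def)
      have "(\<Sum>l\<in>?g ` {..<2 ^ j}. ?F l) < 1"
      proof (rule small)
        show "?g ` {..<2 ^ j} \<subseteq> {..<2 ^ n}"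
        proof clarsimp
          fix i :: nat assume "i < 2 ^ j"
          then have "k * 2 ^ j + i < Suc k * 2 ^ j" by simp
          also have "\<dots> \<le> 2 ^ n0 * 2 ^ j" using k by (intro mult_right_mono) auto
          finally show "k * 2 ^ j + i < 2 ^ n" by (simp add: j power_add)
        qed
        have "real (card (?g ` {..<2 ^ j})) * ((b - a) / 2 ^ n) = (b - a) / 2 ^ n0"
          unfolding card_image[OF inj] by (simp add: j power_add)
        also have "\<dots> < d" using n0 d by (simp add: field_simps)
        finally show "real (card (?g ` {..<2 ^ j})) * ((b - a) / 2 ^ n) < d" .
      qed
      then show "(\<Sum>i<2 ^ j. ?F (k * 2 ^ j + i)) \<le> 1" by (simp add: sum.reindex[OF inj] o_def)
    qed
    finally show ?thesis by simp
  qed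
  then show ?thesis using that[of "2 ^ n0" n0] by auto
qed

lemma norm_slope:
  assumes "a < b"
  shows "(b - a) / 2 ^ n * norm (slope f a b n k) = norm (f (dyad a b n (Suc k)) - f (dyad a b n k))"
  using assms by (simp add: slope_def)

text \<open>
  The cells with slope larger than \<open>K\<close> have total length at most \<open>V / K\<close>, where \<open>V\<close> bounds the dyadic
  variation. For large \<open>K\<close> absolute continuity therefore makes their contribution small, and with \<open>K\<close>
  fixed the gain in arc length tends to zero.
\<close>

lemma AC_on_slope_Cauchy:
  assumes ab: "a < b" and AC: "AC_on a b f" and e: "e > 0"
  obtains N where "\<And>n j. n \<ge> N \<Longrightarrow>
     (b - a) / 2 ^ (n + j) * (\<Sum>k<2 ^ n. \<Sum>i<2 ^ j. norm (slope f a b (n + j) (k * 2 ^ j + i) - slope f a b n k)) < e"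
proof -
  obtain V n0 where V: "V > 0" and var: "\<And>n. n \<ge> n0 \<Longrightarrow> (\<Sum>k<2 ^ n. norm (f (dyad a b n (Suc k)) - f (dyad a b n k))) \<le> V"
    using AC_on_dyadic_variation_bounded[OF ab AC] by blast
  have slopes: "(b - a) / 2 ^ n * (\<Sum>k<2 ^ n. norm (slope f a b n k)) \<le> V" if "n \<ge> n0" for n
    using var[OF that] unfolding sum_distrib_left norm_slope[OF ab] .
  have bound: "arc_length f a b n \<le> (b - a) + V" if "n \<ge> n0" for n
  proof -
    have "arc_length f a b n \<le> (b - a) / 2 ^ n * (\<Sum>k<2 ^ n. 1 + norm (slope f a b n k))"
      unfolding arc_length_def using ab by (intro mult_left_mono sum_mono arclen_le) auto
    also have "\<dots> = (b - a) + (b - a) / 2 ^ n * (\<Sum>k<2 ^ n. norm (slope f a b n k))"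
      by (simp add: sum.distrib distrib_left)
    finally show ?thesis using slopes[OF that] by simp
  qed
  have inc: "arc_length f a b n \<le> arc_length f a b m" if "n \<le> m" for n m
    using arc_length_mono[OF ab, of f n "m - n"] that by simp
  have "convergent (arc_length f a b)"
  proof (rule Bseq_mono_convergent)
    show "\<forall>m n. m \<le> n \<longrightarrow> arc_length f a b m \<le> arc_length f a b n" using inc by blast
    show "Bseq (arc_length f a b)"
    proof (rule BseqI')
      show "norm (arc_length f a b n) \<le> max \<bar>arc_length f a b 0\<bar> ((b - a) + V)" for n
        using bound[of "max n n0"] inc[of 0 n] inc[of n "max n n0"] by auto
    qed
  qed
  then have Cau: "Cauchy (arc_length f a b)" by (rule convergent_Cauchy)
  have e8: "e / 8 > 0" using e by simp
  obtain d where d: "d > 0" and small: "\<And>n S. S \<subseteq> {..<2 ^ n} \<Longrightarrow> real (card S) * ((b - a) / 2 ^ n) < d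
     \<Longrightarrow> (\<Sum>k\<in>S. norm (f (dyad a b n (Suc k)) - f (dyad a b n k))) < e / 8"
    using AC_on_cells[OF ab AC e8] by blast
  \<comment> \<open>chosen so that the cells with slope above \<open>K\<close> have total length below \<open>d\<close>\<close>
  define K where "K = V / d + 1"
  have K: "K > 0" using V d by (simp add: K_def add_pos_pos)
  have KV: "V / K < d" using V d K by (simp add: K_def field_simps)
  define \<eta> where "\<eta> = e / (4 * ((b - a) + V))"
  have \<eta>: "\<eta> > 0" using e ab V by (simp add: \<eta>_def)
  define c where "c = (1 + K\<^sup>2) / (2 * \<eta>)"
  have c: "c > 0" using \<eta> by (simp add: c_def add_pos_nonneg)
  obtain N where N: "\<And>n m. n \<ge> N \<Longrightarrow> m \<ge> N \<Longrightarrow> norm (arc_length f a b m - arc_length f a b n) < e / (4 * c)"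
    using CauchyD[OF Cau, of "e / (4 * c)"] e c by auto
  show ?thesis
  proof (rule that[of "max N n0"])
    fix n j assume n: "n \<ge> max N n0"
    define B where "B = {k. k < 2 ^ n \<and> norm (slope f a b n k) > K}"
    have finB: "finite B" by (simp add: B_def)
    have "(\<Sum>k\<in>B. \<Sum>i<2 ^ j. norm (f (dyad a b (n + j) (Suc (k * 2 ^ j + i))) - f (dyad a b (n + j) (k * 2 ^ j + i)))) < e / 8"
    proof -
      let ?g = "\<lambda>(k, i). k * 2 ^ j + i :: nat"
      have inj: "inj_on ?g (B \<times> {..<2 ^ j})"
      proof (rule inj_onI, clarsimp)
        fix k i k' i' :: nat assume h: "i < 2 ^ j" "i' < 2 ^ j" "k * 2 ^ j + i = k' * 2 ^ j + i'"
        have "k = (k * 2 ^ j + i) div 2 ^ j" "k' = (k' * 2 ^ j + i') div 2 ^ j" using h(1,2) by simp_all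
        then have "k = k'" using h(3) by metis
        then show "k = k' \<and> i = i'" using h(3) by simp
      qed
      have "(\<Sum>l\<in>?g ` (B \<times> {..<2 ^ j}). norm (f (dyad a b (n + j) (Suc l)) - f (dyad a b (n + j) l))) < e / 8"
      proof (rule small)
        show "?g ` (B \<times> {..<2 ^ j}) \<subseteq> {..<2 ^ (n + j)}"
        proof (clarsimp simp: B_def)
          fix k i :: nat assume "i < 2 ^ j" and k: "k < 2 ^ n"
          then have "k * 2 ^ j + i < Suc k * 2 ^ j" by simp
          also have "\<dots> \<le> 2 ^ n * 2 ^ j" using k by (intro mult_right_mono) auto
          finally show "k * 2 ^ j + i < 2 ^ (n + j)" by (simp add: power_add)
        qed
        have "K * (real (card B) * ((b - a) / 2 ^ n)) = (b - a) / 2 ^ n * (\<Sum>k\<in>B. K)" by simp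
        also have "\<dots> \<le> (b - a) / 2 ^ n * (\<Sum>k\<in>B. norm (slope f a b n k))"
          using ab by (intro mult_left_mono sum_mono) (auto simp: B_def)
        also have "\<dots> \<le> (b - a) / 2 ^ n * (\<Sum>k<2 ^ n. norm (slope f a b n k))"
          using ab by (intro mult_left_mono sum_mono2) (auto simp: B_def)
        also have "\<dots> \<le> V" using slopes n by simp
        finally have "real (card B) * ((b - a) / 2 ^ n) \<le> V / K" using K by (simp add: field_simps)
        then have "real (card B) * ((b - a) / 2 ^ n) < d" using KV by simp
        then show "real (card (?g ` (B \<times> {..<2 ^ j}))) * ((b - a) / 2 ^ (n + j)) < d"
          unfolding card_image[OF inj] by (simp add: power_add card_cartesian_product)
      qed
      then show ?thesis
        unfolding sum.reindex[OF inj] sum.cartesian_product by (simp add: case_prod_unfold)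
    qed
    then have "(b - a) / 2 ^ (n + j) * (\<Sum>k<2 ^ n. \<Sum>i<2 ^ j. norm (slope f a b (n + j) (k * 2 ^ j + i) - slope f a b n k))
      \<le> \<eta> * arc_length f a b (n + j) + c * (arc_length f a b (n + j) - arc_length f a b n) + 2 * (e / 8)"
      unfolding c_def B_def by (intro slope_L1_distance ab \<eta>) simp
    also have "\<dots> \<le> e / 4 + c * (arc_length f a b (n + j) - arc_length f a b n) + e / 4"
    proof -
      have "\<eta> * arc_length f a b (n + j) \<le> \<eta> * ((b - a) + V)"
        using bound[of "n + j"] n \<eta> by (intro mult_left_mono) auto
      also have "\<dots> = e / 4" using ab V by (simp add: \<eta>_def field_simps)
      finally show ?thesis by simp
    qed
    also have "\<dots> < e"
    proof -
      have "c * (arc_length f a b (n + j) - arc_length f a b n) \<le> c * (e / (4 * c))"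
        using N[of n "n + j"] n c by (intro mult_left_mono) auto
      then show ?thesis using c e by simp
    qed
    finally show "(b - a) / 2 ^ (n + j) * (\<Sum>k<2 ^ n. \<Sum>i<2 ^ j. norm (slope f a b (n + j) (k * 2 ^ j + i) - slope f a b n k)) < e" .
  qed
qed

lemma AC_on_imp_continuous_on:
  assumes "a < b" "AC_on a b f"
  shows "continuous_on {a..b} f"
  unfolding continuous_on_iff
proof (intro ballI allI impI)
  fix x e :: real assume x: "x \<in> {a..b}" and e: "e > 0"
  obtain d where d: "d > 0" and I: "\<And>I. finite I \<Longrightarrow> (\<forall>(s, t)\<in>I. a \<le> s \<and> s \<le> t \<and> t \<le> b)
          \<Longrightarrow> disjoint_family_on (\<lambda>(s, t). {s<..<t}) I \<Longrightarrow> (\<Sum>(s, t)\<in>I. t - s) < d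
        \<Longrightarrow> (\<Sum>(s, t)\<in>I. norm (f t - f s)) < e"
    using assms e unfolding AC_on_def by meson
  have "dist (f y) (f x) < e" if y: "y \<in> {a..b}" "dist y x < d" for y
    using I[of "{(x, y)}"] I[of "{(y, x)}"] x y
    by (cases "x \<le> y") (auto simp: disjoint_family_on_def dist_norm norm_minus_commute)
  then show "\<exists>d>0. \<forall>x'\<in>{a..b}. dist x' x < d \<longrightarrow> dist (f x') (f x) < e" using d by blast
qed

text \<open>
  The integral of a slope function between dyadic points is the increment of \<open>f\<close> as soon as the level is
  fine enough, and the identity passes to the limit in the mean. Continuity of both sides extends it
  from the dyadic points to the whole interval.
\<close>

theorem AC_on_imp_indefinite_integral:
  assumes ab: "a < b" and AC: "AC_on a b f"
  obtains g where "g absolutely_integrable_on {a..b}"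
    "\<And>x. x \<in> {a..b} \<Longrightarrow> (g has_integral (f x - f a)) {a..x}"
proof -
  define G where "G n x = indicator {a..<b} x *\<^sub>R slope f a b n (dyad_index a b n x)" for n x
  have Gint: "integrable lebesgue (G n)" for n
    using has_bochner_integral_dyadic_step[OF ab, of n "2 ^ n" "slope f a b n"]
    unfolding G_def dyad_end by (rule integrable.intros)
  have dist: "(\<integral>x. norm (G (n + j) x - G n x) \<partial>lebesgue) = (b - a) / 2 ^ (n + j) *
      (\<Sum>k<2 ^ n. \<Sum>i<2 ^ j. norm (slope f a b (n + j) (k * 2 ^ j + i) - slope f a b n k))" for n j
  proof -
    let ?H = "\<lambda>k. norm (slope f a b (n + j) k - slope f a b n (k div 2 ^ j))"
    have "norm (G (n + j) x - G n x) = indicator {a..<b} x *\<^sub>R ?H (dyad_index a b (n + j) x)" for x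
      using dyad_index_refine[OF ab, of x n j] by (auto simp: G_def indicator_def)
    then have "(\<integral>x. norm (G (n + j) x - G n x) \<partial>lebesgue) = (b - a) / 2 ^ (n + j) * (\<Sum>k<2 ^ (n + j). ?H k)"
      using has_bochner_integral_dyadic_step[OF ab, of "n + j" "2 ^ (n + j)" ?H]
      by (simp add: has_bochner_integral_integral_eq)
    also have "(\<Sum>k<2 ^ (n + j). ?H k) = (\<Sum>k<2 ^ n. \<Sum>i<2 ^ j. ?H (k * 2 ^ j + i))"
      unfolding power_add by (rule sum_blocks)
    also have "\<dots> = (\<Sum>k<2 ^ n. \<Sum>i<2 ^ j. norm (slope f a b (n + j) (k * 2 ^ j + i) - slope f a b n k))"
      by (intro sum.cong refl) (simp add: div_mult_self3)
    finally show ?thesis .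
  qed
  have cauchy: "\<exists>N. \<forall>i\<ge>N. \<forall>j\<ge>N. (\<integral>x. norm (G i x - G j x) \<partial>lebesgue) < e" if e: "e > 0" for e
  proof -
    obtain N where N: "\<And>n j. n \<ge> N \<Longrightarrow> (b - a) / 2 ^ (n + j) *
      (\<Sum>k<2 ^ n. \<Sum>i<2 ^ j. norm (slope f a b (n + j) (k * 2 ^ j + i) - slope f a b n k)) < e"
      using AC_on_slope_Cauchy[OF ab AC e] by blast
    have le: "(\<integral>x. norm (G m x - G n x) \<partial>lebesgue) < e" if "n \<ge> N" "m \<ge> n" for n m
      using N[OF that(1), of "m - n"] dist[of n "m - n"] that(2) by simp
    have "(\<integral>x. norm (G i x - G j x) \<partial>lebesgue) < e" if "i \<ge> N" "j \<ge> N" for i j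
      using le[of i j] le[of j i] that by (cases "i \<le> j") (auto simp: norm_minus_commute)
    then show ?thesis by blast
  qed
  obtain g where g: "integrable lebesgue g" and lim: "(\<lambda>n. \<integral>x. norm (G n x - g x) \<partial>lebesgue) \<longlonglongrightarrow> 0"
    using L1_complete[OF Gint cauchy] by blast
  have g_abs: "g absolutely_integrable_on S" if "S \<in> sets lebesgue" for S
    using g that by (simp add: set_integrable_def integrable_mult_indicator)
  have cont_g: "continuous_on {a..b} (\<lambda>x. integral {a..x} g)"
    using g_abs by (intro indefinite_integral_continuous_1 set_lebesgue_integral_eq_integral(1)) auto
  have dyadic: "integral {a..dyad a b n K} g = f (dyad a b n K) - f a" if K: "K \<le> 2 ^ n" for n K
  proof -
    let ?y = "dyad a b n K"
    have yb: "?y \<le> b" using dyad_mono[of a b K "2 ^ n" n] ab K by simp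
    have G_int: "(\<integral>x. indicator {a..<?y} x *\<^sub>R G (n + j) x \<partial>lebesgue) = f ?y - f a" for j
    proof -
      have "indicator {a..<?y} x *\<^sub>R G (n + j) x
          = indicator {a..<dyad a b (n + j) (K * 2 ^ j)} x *\<^sub>R slope f a b (n + j) (dyad_index a b (n + j) x)" for x
        using yb by (auto simp: G_def indicator_def dyad_refine)
      then have "(\<integral>x. indicator {a..<?y} x *\<^sub>R G (n + j) x \<partial>lebesgue)
          = ((b - a) / 2 ^ (n + j)) *\<^sub>R (\<Sum>k<K * 2 ^ j. slope f a b (n + j) k)"
        using has_bochner_integral_dyadic_step[OF ab, of "n + j" "K * 2 ^ j" "slope f a b (n + j)"]
        by (simp add: has_bochner_integral_integral_eq)
      also have "\<dots> = (\<Sum>k<K * 2 ^ j. f (dyad a b (n + j) (Suc k)) - f (dyad a b (n + j) k))"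
        unfolding slope_def scaleR_sum_right[symmetric] using ab by simp
      also have "\<dots> = f ?y - f a"
        using sum_lessThan_telescope[of "\<lambda>k. f (dyad a b (n + j) k)" "K * 2 ^ j"] by (simp add: dyad_refine)
      finally show ?thesis .
    qed
    have "(\<lambda>j. \<integral>x. indicator {a..<?y} x *\<^sub>R G (n + j) x \<partial>lebesgue) \<longlonglongrightarrow> (\<integral>x. indicator {a..<?y} x *\<^sub>R g x \<partial>lebesgue)"
    proof (subst Lim_null, rule Lim_null_comparison)
      show "\<forall>\<^sub>F j in sequentially. norm ((\<integral>x. indicator {a..<?y} x *\<^sub>R G (n + j) x \<partial>lebesgue)
          - (\<integral>x. indicator {a..<?y} x *\<^sub>R g x \<partial>lebesgue)) \<le> (\<integral>x. norm (G (j + n) x - g x) \<partial>lebesgue)"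
      proof (intro always_eventually allI)
        fix j
        have int: "integrable lebesgue (\<lambda>x. indicator {a..<?y} x *\<^sub>R G (n + j) x)"
          "integrable lebesgue (\<lambda>x. indicator {a..<?y} x *\<^sub>R g x)"
          using Gint g by (auto intro: integrable_mult_indicator)
        then have "norm ((\<integral>x. indicator {a..<?y} x *\<^sub>R G (n + j) x \<partial>lebesgue)
          - (\<integral>x. indicator {a..<?y} x *\<^sub>R g x \<partial>lebesgue))
          = norm (\<integral>x. indicator {a..<?y} x *\<^sub>R G (n + j) x - indicator {a..<?y} x *\<^sub>R g x \<partial>lebesgue)"
          by simp
        also have "\<dots> \<le> (\<integral>x. norm (G (j + n) x - g x) \<partial>lebesgue)"
          using int Gint[of "j + n"] g
          by (intro Bochner_Integration.integral_norm_bound_integral Bochner_Integration.integrable_diff integrable_norm)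
             (auto simp: indicator_def add.commute)
        finally show "norm ((\<integral>x. indicator {a..<?y} x *\<^sub>R G (n + j) x \<partial>lebesgue)
          - (\<integral>x. indicator {a..<?y} x *\<^sub>R g x \<partial>lebesgue)) \<le> (\<integral>x. norm (G (j + n) x - g x) \<partial>lebesgue)" .
      qed
      show "(\<lambda>j. \<integral>x. norm (G (j + n) x - g x) \<partial>lebesgue) \<longlonglongrightarrow> 0"
        using lim by (rule LIMSEQ_ignore_initial_segment)
    qed
    then have "(\<integral>x. indicator {a..<?y} x *\<^sub>R g x \<partial>lebesgue) = f ?y - f a"
      unfolding G_int by (simp add: LIMSEQ_const_iff)
    then have "integral {a..<?y} g = f ?y - f a"
      using set_lebesgue_integral_eq_integral(2)[OF g_abs[of "{a..<?y}"]] by (simp add: set_lebesgue_integral_def)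
    moreover have "integral {a..?y} g = integral {a..<?y} g"
      by (rule integral_subset_negligible[symmetric]) (auto intro: negligible_subset[of "{?y}"])
    ultimately show ?thesis by simp
  qed
  have all: "integral {a..x} g = f x - f a" if x: "x \<in> {a..b}" for x
  proof -
    define y where "y n = dyad a b n (dyad_index a b n x)" for n
    have suc: "dyad a b n (Suc k) = dyad a b n k + (b - a) / 2 ^ n" for n k
      by (simp add: dyad_def field_simps)
    have y: "y n \<le> x" "x < y n + (b - a) / 2 ^ n" "a \<le> y n" for n
      using dyad_index_eq[OF ab, of x n "dyad_index a b n x"] x dyad_mono[of a b 0 "dyad_index a b n x" n] ab
      unfolding y_def suc by simp_all
    have "y \<longlonglongrightarrow> x"
    proof (rule tendsto_sandwich)
      show "\<forall>\<^sub>F n in sequentially. x - (b - a) / 2 ^ n \<le> y n" "\<forall>\<^sub>F n in sequentially. y n \<le> x"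
        using y by (auto intro!: always_eventually simp: algebra_simps less_imp_le)
      have "(\<lambda>n. x - (b - a) * (1/2) ^ n) \<longlonglongrightarrow> x - (b - a) * 0"
        by (intro tendsto_intros LIMSEQ_realpow_zero) auto
      then show "(\<lambda>n. x - (b - a) / 2 ^ n) \<longlonglongrightarrow> x" by (simp add: power_divide)
    qed simp
    moreover have yin: "y n \<in> {a..b}" for n using y[of n] x by auto
    ultimately have "(\<lambda>n. f (y n)) \<longlonglongrightarrow> f x" "(\<lambda>n. integral {a..y n} g) \<longlonglongrightarrow> integral {a..x} g"
      using continuous_on_tendsto_compose[OF AC_on_imp_continuous_on[OF ab AC], of y x sequentially]
        continuous_on_tendsto_compose[OF cont_g, of y x sequentially] x by auto
    moreover have "integral {a..y n} g = f (y n) - f a" for n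
      unfolding y_def
    proof (rule dyadic, rule ccontr)
      assume "\<not> dyad_index a b n x \<le> 2 ^ n"
      then have "Suc (2 ^ n) \<le> dyad_index a b n x" by simp
      then have "dyad a b n (Suc (2 ^ n)) \<le> x"
        using y(1)[of n] dyad_mono[of a b "Suc (2 ^ n)" "dyad_index a b n x" n] ab unfolding y_def by linarith
      moreover have "dyad a b n (Suc (2 ^ n)) > b" using ab by (simp add: dyad_def field_simps)
      ultimately show False using x by simp
    qed
    ultimately have "(\<lambda>n. f (y n) - f a) \<longlonglongrightarrow> integral {a..x} g" "(\<lambda>n. f (y n) - f a) \<longlonglongrightarrow> f x - f a"
      by (auto intro: tendsto_intros)
    then show ?thesis by (rule LIMSEQ_unique)
  qed
  show ?thesis
  proof (rule that)
    show "g absolutely_integrable_on {a..b}" by (rule g_abs) simp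
    show "(g has_integral (f x - f a)) {a..x}" if x: "x \<in> {a..b}" for x
      using all[OF x] set_lebesgue_integral_eq_integral(1)[OF g_abs[of "{a..x}"]] by (simp add: has_integral_iff)
  qed
qed

section \<open>Primitives and almost everywhere differentiation\<close>

text \<open>
  The theorem \<open>integrable_ccontinuous_explicit\<close> gives the derivative from the right at almost every
  point. Applied to the reflected function it gives the derivative from the left.
\<close>

lemma Lebesgue_differentiation_interval:
  fixes f g :: "real \<Rightarrow> complex"
  assumes ab: "a < b" and g: "g integrable_on {a..b}"
    and f: "\<And>x. x \<in> {a..b} \<Longrightarrow> (g has_integral (f x - f a)) {a..x}"
  shows "AE x in lebesgue. x \<in> {a<..<b} \<longrightarrow> (f has_vector_derivative g x) (at x)"
proof -
  define g0 where "g0 x = (if x \<in> {a..b} then g x else 0)" for x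
  have g0: "g0 integrable_on cbox c d" for c d
  proof -
    have "g0 integrable_on UNIV" using g unfolding g0_def by (simp only: integrable_restrict_UNIV)
    then show ?thesis by (rule integrable_on_subcbox) simp
  qed
  have g0r: "(\<lambda>x. g0 (- x)) integrable_on cbox c d" for c d
    using g0[of "-d" "-c"] Henstock_Kurzweil_Integration.integrable_reflect_real[where f=g0 and a="-d" and b="-c"] by simp
  have int: "integral {c..d} g0 = f d - f c" if cd: "a \<le> c" "c \<le> d" "d \<le> b" for c d
  proof -
    have "integral {c..d} g0 = integral {c..d} g"
      using cd by (intro integral_cong) (auto simp: g0_def)
    moreover have "integral {a..c} g + integral {c..d} g = integral {a..d} g"
      using cd integrable_on_subinterval[OF g, of a d] by (intro Henstock_Kurzweil_Integration.integral_combine) auto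
    moreover have "integral {a..c} g = f c - f a" "integral {a..d} g = f d - f a"
      using f[of c] f[of d] cd by (auto simp: has_integral_iff)
    ultimately show ?thesis by (simp add: algebra_simps)
  qed
  obtain N where N: "negligible N" and right: "\<And>x e. x \<notin> N \<Longrightarrow> 0 < e \<Longrightarrow>
       \<exists>d>0. \<forall>h. 0 < h \<and> h < d \<longrightarrow> norm (integral (cbox x (x + h *\<^sub>R One)) g0 /\<^sub>R h ^ DIM(real) - g0 x) < e"
    using integrable_ccontinuous_explicit[of g0] g0 by blast
  obtain N' where N': "negligible N'" and left: "\<And>x e. x \<notin> N' \<Longrightarrow> 0 < e \<Longrightarrow>
       \<exists>d>0. \<forall>h. 0 < h \<and> h < d \<longrightarrow> norm (integral (cbox x (x + h *\<^sub>R One)) (\<lambda>x. g0 (- x)) /\<^sub>R h ^ DIM(real) - g0 (- x)) < e"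
    using integrable_ccontinuous_explicit[of "\<lambda>x. g0 (- x)"] g0r by blast
  have negl: "negligible (N \<union> uminus ` N')"
    using N N' by (intro negligible_Un negligible_differentiable_image_negligible) (auto intro!: derivative_intros)
  have "(f has_vector_derivative g x) (at x)" if x: "x \<notin> N \<union> uminus ` N'" "x \<in> {a<..<b}" for x
    unfolding has_vector_derivative_def has_derivative_at_alt
  proof (intro conjI allI impI bounded_linear_scaleR_left)
    fix e :: real assume e: "e > 0"
    have "- x \<notin> N'" using x(1) by (auto simp: image_iff)
    then obtain d1 where d1: "d1 > 0" "\<And>h. 0 < h \<Longrightarrow> h < d1 \<Longrightarrow> norm (integral {- x..- x + h} (\<lambda>x. g0 (- x)) /\<^sub>R h - g0 x) < e"
      using left[of "- x" e] e by auto
    obtain d2 where d2: "d2 > 0" "\<And>h. 0 < h \<Longrightarrow> h < d2 \<Longrightarrow> norm (integral {x..x + h} g0 /\<^sub>R h - g0 x) < e"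
      using right[of x e] e x(1) by auto
    define d where "d = Min {d1, d2, x - a, b - x}"
    have d: "d > 0" "d \<le> d1" "d \<le> d2" "d \<le> x - a" "d \<le> b - x"
      using d1(1) d2(1) x(2) by (auto simp: d_def)
    have "norm (f y - f x - (y - x) *\<^sub>R g x) \<le> e * norm (y - x)" if y: "norm (y - x) < d" for y
    proof -
      have gx: "g0 x = g x" using x by (simp add: g0_def)
      consider "y = x" | "y > x" | "y < x" by linarith
      then show ?thesis
      proof cases
        case 2
        define h where "h = y - x"
        have h: "h > 0" "h < d" "y = x + h" using 2 y by (auto simp: h_def)
        have "norm ((f y - f x) /\<^sub>R h - g x) < e"
          using d2(2)[of h] h d int[of x y] x(2) gx by auto
        moreover have "f y - f x - h *\<^sub>R g x = h *\<^sub>R ((f y - f x) /\<^sub>R h - g x)"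
          using h by (simp add: algebra_simps)
        ultimately have "norm (f y - f x - h *\<^sub>R g x) \<le> h * e" using h by simp
        then show ?thesis using h by (simp add: mult.commute)
      next
        case 3
        define h where "h = x - y"
        have h: "h > 0" "h < d" "y = x - h" using 3 y by (auto simp: h_def)
        have "integral {- x..- y} (\<lambda>x. g0 (- x)) = f x - f y"
          using int[of y x] h d x(2) Henstock_Kurzweil_Integration.integral_reflect_real[where f=g0 and a=y and b=x] by simp
        then have "norm ((f x - f y) /\<^sub>R h - g x) < e"
          using d1(2)[of h] h d gx by auto
        moreover have "f y - f x - (y - x) *\<^sub>R g x = (- h) *\<^sub>R ((f x - f y) /\<^sub>R h - g x)"
        proof -
          have "h *\<^sub>R ((f x - f y) /\<^sub>R h) = f x - f y" "y - x = - h" using h(1) by (auto simp: h_def)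
          moreover have "(- h) *\<^sub>R ((f x - f y) /\<^sub>R h - g x) = h *\<^sub>R g x - h *\<^sub>R ((f x - f y) /\<^sub>R h)"
            by (simp only: scaleR_diff_right scaleR_minus_left) simp
          ultimately show ?thesis by simp
        qed
        ultimately have "norm (f y - f x - (y - x) *\<^sub>R g x) \<le> h * e" using h by simp
        then show ?thesis using h by (simp add: mult.commute)
      qed simp
    qed
    then show "\<exists>d>0. \<forall>y. norm (y - x) < d \<longrightarrow> norm (f y - f x - (y - x) *\<^sub>R g x) \<le> e * norm (y - x)"
      using d(1) by blast
  qed
  then show ?thesis
    using negl by (intro AE_I'[of "N \<union> uminus ` N'"]) (auto simp: negligible_iff_null_sets)
qed

text \<open>
  Statements about absolutely continuous functions are phrased with this relation, since it leaves the
  choice of the derivative on null sets open.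
\<close>

definition primitive :: "(real \<Rightarrow> complex) \<Rightarrow> (real \<Rightarrow> complex) \<Rightarrow> bool" where
  "primitive F g \<longleftrightarrow> (\<forall>a b. a \<le> b \<longrightarrow> g absolutely_integrable_on {a..b} \<and> (g has_integral (F b - F a)) {a..b})"

lemma AE_on_all_intervals:
  assumes "\<And>n::nat. AE x in lebesgue. x \<in> {- real n - 1<..<real n + 1} \<longrightarrow> P x"
  shows "AE x in lebesgue. P x"
proof -
  have "AE x in lebesgue. \<forall>n::nat. x \<in> {- real n - 1<..<real n + 1} \<longrightarrow> P x"
    unfolding AE_all_countable using assms by blast
  then show ?thesis
  proof eventually_elim
    case (elim x)
    obtain n :: nat where "\<bar>x\<bar> < real n" using reals_Archimedean2 by blast
    then have "x \<in> {- real n - 1<..<real n + 1}" by auto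
    then show ?case using elim by blast
  qed
qed

lemma primitive_AE_has_vector_derivative:
  assumes "primitive F g"
  shows "AE x in lebesgue. (F has_vector_derivative g x) (at x)"
proof (rule AE_on_all_intervals)
  fix n :: nat
  show "AE x in lebesgue. x \<in> {- real n - 1<..<real n + 1} \<longrightarrow> (F has_vector_derivative g x) (at x)"
  proof (rule Lebesgue_differentiation_interval)
    have "(g has_integral (F (real n + 1) - F (- real n - 1))) {- real n - 1..real n + 1}"
      using assms by (simp add: primitive_def)
    then show "g integrable_on {- real n - 1..real n + 1}" by (rule has_integral_integrable)
  qed (use assms in \<open>auto simp: primitive_def\<close>)
qed

lemma AE_lebesgue_negligible:
  assumes "AE x in lebesgue. P x"
  obtains N where "negligible N" "\<And>x. x \<notin> N \<Longrightarrow> P x"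
proof -
  obtain N where "\<And>x. x \<in> space lebesgue - N \<Longrightarrow> P x" "N \<in> null_sets lebesgue"
    using AE_E3[OF assms] by blast
  then show ?thesis using that[of N] by (simp add: negligible_iff_null_sets)
qed

lemma primitive_cong_AE:
  assumes F: "primitive F g" and ae: "AE x in lebesgue. g x = k x"
  shows "primitive F k"
proof -
  obtain N where N: "negligible N" "\<And>x. x \<notin> N \<Longrightarrow> g x = k x"
    using AE_lebesgue_negligible[OF ae] by blast
  show ?thesis unfolding primitive_def
  proof (intro allI impI conjI)
    fix a b :: real assume ab: "a \<le> b"
    have "g absolutely_integrable_on {a..b}" using F ab by (simp add: primitive_def)
    then show "k absolutely_integrable_on {a..b}"
      by (rule absolutely_integrable_spike[OF _ N(1)]) (simp add: N(2))
    show "(k has_integral (F b - F a)) {a..b}"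
      by (rule has_integral_spike[OF N(1), of _ k g]) (use F ab N(2) in \<open>auto simp: primitive_def\<close>)
  qed
qed

theorem AC_loc_primitive_vector_derivative:
  assumes AC: "AC_loc f"
  shows "AE x in lebesgue. (f has_vector_derivative ae_deriv f x) (at x)"
    and "primitive f (ae_deriv f)"
proof -
  have loc: "\<exists>g. g absolutely_integrable_on {a..b} \<and> (\<forall>x\<in>{a..b}. (g has_integral (f x - f a)) {a..x})
      \<and> (AE x in lebesgue. x \<in> {a<..<b} \<longrightarrow> (f has_vector_derivative g x) (at x))" if ab: "a < b" for a b
  proof -
    have AC': "AC_on a b f" using AC ab by (simp add: AC_loc_def)
    obtain g where g: "g absolutely_integrable_on {a..b}" "\<And>x. x \<in> {a..b} \<Longrightarrow> (g has_integral (f x - f a)) {a..x}"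
      using AC_on_imp_indefinite_integral[OF ab AC'] by blast
    moreover have "AE x in lebesgue. x \<in> {a<..<b} \<longrightarrow> (f has_vector_derivative g x) (at x)"
      using g set_lebesgue_integral_eq_integral(1)[OF g(1)] by (intro Lebesgue_differentiation_interval ab)
    ultimately show ?thesis by blast
  qed
  show "AE x in lebesgue. (f has_vector_derivative ae_deriv f x) (at x)"
  proof (rule AE_on_all_intervals)
    fix n :: nat
    obtain g where "AE x in lebesgue. x \<in> {- real n - 1<..<real n + 1} \<longrightarrow> (f has_vector_derivative g x) (at x)"
      using loc[of "- real n - 1" "real n + 1"] by (simp, blast)
    then show "AE x in lebesgue. x \<in> {- real n - 1<..<real n + 1} \<longrightarrow> (f has_vector_derivative ae_deriv f x) (at x)"
      by eventually_elim (auto simp: vector_derivative_at)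
  qed
  show "primitive f (ae_deriv f)" unfolding primitive_def
  proof (intro allI impI)
    fix a b :: real assume ab: "a \<le> b"
    have "a - 1 < b + 1" using ab by simp
    then obtain g where g: "g absolutely_integrable_on {a - 1..b + 1}"
      and gf: "\<And>x. x \<in> {a - 1..b + 1} \<Longrightarrow> (g has_integral (f x - f (a - 1))) {a - 1..x}"
      and ae: "AE x in lebesgue. x \<in> {a - 1<..<b + 1} \<longrightarrow> (f has_vector_derivative g x) (at x)"
      using loc[of "a - 1" "b + 1"] by blast
    obtain N where N: "negligible N" "\<And>x. x \<notin> N \<Longrightarrow> x \<in> {a - 1<..<b + 1} \<Longrightarrow> (f has_vector_derivative g x) (at x)"
      using AE_lebesgue_negligible[OF ae] by blast
    then have eq: "ae_deriv f x = g x" if "x \<in> {a..b} - N" for x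
      using that by (auto simp: vector_derivative_at)
    have gab: "g absolutely_integrable_on {a..b}"
      using ab by (intro absolutely_integrable_on_subinterval[OF g]) auto
    have "integral {a - 1..a} g + integral {a..b} g = integral {a - 1..b} g"
      using ab gf[of b] by (intro Henstock_Kurzweil_Integration.integral_combine) (auto simp: has_integral_iff)
    moreover have "integral {a - 1..a} g = f a - f (a - 1)" "integral {a - 1..b} g = f b - f (a - 1)"
      using gf[of a] gf[of b] ab by (auto simp: has_integral_iff)
    ultimately have "integral {a..b} g = f b - f a" by (simp add: algebra_simps)
    then have int: "(g has_integral (f b - f a)) {a..b}"
      using set_lebesgue_integral_eq_integral(1)[OF gab] by (simp add: has_integral_iff)
    show "ae_deriv f absolutely_integrable_on {a..b} \<and> (ae_deriv f has_integral (f b - f a)) {a..b}"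
    proof
      show "ae_deriv f absolutely_integrable_on {a..b}"
        by (rule absolutely_integrable_spike[OF gab N(1)]) (rule eq)
      show "(ae_deriv f has_integral (f b - f a)) {a..b}"
        by (rule has_integral_spike[OF N(1) _ int]) (rule eq)
    qed
  qed
qed

lemma primitive_of_AE_derivative:
  assumes "AC_loc f" "AE x in lebesgue. (f has_vector_derivative g x) (at x)"
  shows "primitive f g"
proof (rule primitive_cong_AE[OF AC_loc_primitive_vector_derivative(2)[OF assms(1)]])
  show "AE x in lebesgue. ae_deriv f x = g x"
    using assms(2) by eventually_elim (simp add: vector_derivative_at)
qed

text \<open>
  Absolute continuity of the integral: outside the set where \<open>norm (g x)\<close> exceeds a large \<open>K\<close> the increments are
  bounded by \<open>K\<close> times the lengths, and the integral over that set is small by dominated convergence.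
\<close>

lemma primitive_imp_AC_loc:
  assumes F: "primitive F g"
  shows "AC_loc F"
  unfolding AC_loc_def AC_on_def
proof (intro allI impI)
  fix a b e :: real assume ab: "a < b" and e: "e > 0"
  define G where "G x = indicator {a..b} x *\<^sub>R g x" for x
  have G: "integrable lebesgue G"
    using F ab unfolding primitive_def G_def set_integrable_def[symmetric] by simp
  then have Gm[measurable]: "G \<in> borel_measurable lebesgue" by auto
  define m where "m n x = (if norm (G x) > real n then norm (G x) else 0)" for n x
  have "(\<lambda>n. \<integral>x. m n x \<partial>lebesgue) \<longlonglongrightarrow> (\<integral>x. 0 \<partial>(lebesgue::real measure))"
  proof (rule integral_dominated_convergence[where w="\<lambda>x. norm (G x)"])
    show "AE x in lebesgue. (\<lambda>n. m n x) \<longlonglongrightarrow> 0"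
    proof (intro AE_I2)
      fix x
      obtain N where N: "norm (G x) < real N" using reals_Archimedean2 by blast
      show "(\<lambda>n. m n x) \<longlonglongrightarrow> 0"
        by (intro tendsto_eventually eventually_mono[OF eventually_ge_at_top[of N]]) (use N in \<open>auto simp: m_def\<close>)
    qed
  qed (use G in \<open>auto simp: m_def\<close>)
  then have "(\<lambda>n. \<integral>x. m n x \<partial>lebesgue) \<longlonglongrightarrow> 0" by simp
  then have "\<forall>\<^sub>F n in sequentially. (\<integral>x. m n x \<partial>lebesgue) < e / 2"
    using e by (intro order_tendstoD) auto
  then obtain K where K: "(\<integral>x. m K x \<partial>lebesgue) < e / 2" by (auto simp: eventually_sequentially)
  have mint: "integrable lebesgue (m K)"
    by (rule Bochner_Integration.integrable_bound[OF integrable_norm[OF G]]) (auto simp: m_def[abs_def])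
  \<comment> \<open>the summand 1 only prevents division by zero\<close>
  define d where "d = e / (2 * (real K + 1))"
  have d: "d > 0" using e by (simp add: d_def)
  show "\<exists>d>0. \<forall>I. finite I \<and> (\<forall>(s, t)\<in>I. a \<le> s \<and> s \<le> t \<and> t \<le> b) \<and>
            disjoint_family_on (\<lambda>(s, t). {s<..<t}) I \<and> (\<Sum>(s, t)\<in>I. t - s) < d \<longrightarrow>
            (\<Sum>(s, t)\<in>I. norm (F t - F s)) < e"
  proof (intro exI conjI allI impI)
    show "d > 0" by (rule d)
    fix I :: "(real \<times> real) set"
    assume I: "finite I \<and> (\<forall>(s, t)\<in>I. a \<le> s \<and> s \<le> t \<and> t \<le> b) \<and>
            disjoint_family_on (\<lambda>(s, t). {s<..<t}) I \<and> (\<Sum>(s, t)\<in>I. t - s) < d"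
    let ?J = "\<lambda>i. {fst i<..<snd i}"
    have st: "a \<le> fst i" "fst i \<le> snd i" "snd i \<le> b" if "i \<in> I" for i using I that by auto
    have mi: "integrable lebesgue (\<lambda>x. indicator (?J i) x * m K x)" for i
      using integrable_mult_indicator[OF _ mint, of "?J i"] by simp
    have single: "norm (F (snd i) - F (fst i)) \<le> real K * (snd i - fst i) + (\<integral>x. indicator (?J i) x * m K x \<partial>lebesgue)"
      if i: "i \<in> I" for i
    proof -
      have gi: "g absolutely_integrable_on {fst i..snd i}" "(g has_integral (F (snd i) - F (fst i))) {fst i..snd i}"
        using F st[OF i] by (auto simp: primitive_def)
      have go: "g absolutely_integrable_on ?J i"
        by (rule set_integrable_subset[OF gi(1)]) auto
      have "(g has_integral (F (snd i) - F (fst i))) (?J i)"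
        using gi(2) has_integral_open_interval[of g _ "fst i" "snd i"] by simp
      then have "F (snd i) - F (fst i) = (\<integral>x. indicator (?J i) x *\<^sub>R g x \<partial>lebesgue)"
        using set_lebesgue_integral_eq_integral(2)[OF go] by (auto simp: has_integral_iff set_lebesgue_integral_def)
      then have "norm (F (snd i) - F (fst i)) = norm (\<integral>x. indicator (?J i) x *\<^sub>R g x \<partial>lebesgue)" by simp
      also have "\<dots> \<le> (\<integral>x. real K * indicator (?J i) x + indicator (?J i) x * m K x \<partial>lebesgue)"
      proof (rule Bochner_Integration.integral_norm_bound_integral)
        show "integrable lebesgue (\<lambda>x. indicator (?J i) x *\<^sub>R g x)" using go by (simp add: set_integrable_def)
        show "integrable lebesgue (\<lambda>x. real K * indicator (?J i) x + indicator (?J i) x * m K x)"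
          using mi st[OF i] by (intro Bochner_Integration.integrable_add integrable_mult_right integrable_real_indicator) auto
        fix x show "norm (indicator (?J i) x *\<^sub>R g x) \<le> real K * indicator (?J i) x + indicator (?J i) x * m K x"
          using st[OF i] by (auto simp: indicator_def m_def G_def)
      qed
      also have "\<dots> = (\<integral>x. real K * indicator (?J i) x \<partial>lebesgue) + (\<integral>x. indicator (?J i) x * m K x \<partial>lebesgue)"
        using mi st[OF i] by (intro Bochner_Integration.integral_add integrable_mult_right integrable_real_indicator) auto
      finally show ?thesis using st[OF i] by simp
    qed
    have "(\<Sum>(s, t)\<in>I. norm (F t - F s)) = (\<Sum>i\<in>I. norm (F (snd i) - F (fst i)))" by (simp add: case_prod_unfold)
    also have "\<dots> \<le> (\<Sum>i\<in>I. real K * (snd i - fst i) + (\<integral>x. indicator (?J i) x * m K x \<partial>lebesgue))"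
      by (intro sum_mono single)
    also have "\<dots> = real K * (\<Sum>(s, t)\<in>I. t - s) + (\<integral>x. (\<Sum>i\<in>I. indicator (?J i) x * m K x) \<partial>lebesgue)"
      using mi by (simp add: sum.distrib sum_distrib_left case_prod_unfold)
    also have "(\<integral>x. (\<Sum>i\<in>I. indicator (?J i) x * m K x) \<partial>lebesgue) \<le> (\<integral>x. m K x \<partial>lebesgue)"
    proof (rule integral_mono)
      fix x
      have dis: "disjoint_family_on ?J I" using I by (simp add: case_prod_unfold)
      have "(\<Sum>i\<in>I. indicator (?J i) x :: real) = indicator (\<Union>i\<in>I. ?J i) x"
        using I dis by (intro indicator_UN_disjoint[symmetric]) auto
      then have "(\<Sum>i\<in>I. indicator (?J i) x * m K x) = indicator (\<Union>i\<in>I. ?J i) x * m K x"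
        by (simp add: sum_distrib_right[symmetric])
      also have "\<dots> \<le> m K x" by (auto simp: indicator_def m_def)
      finally show "(\<Sum>i\<in>I. indicator (?J i) x * m K x) \<le> m K x" .
    qed (use mi mint in auto)
    also have "real K * (\<Sum>(s, t)\<in>I. t - s) \<le> real K * d" using I by (intro mult_left_mono) auto
    also have "real K * d \<le> e / 2" using e by (simp add: d_def field_simps)
    finally show "(\<Sum>(s, t)\<in>I. norm (F t - F s)) < e" using K by simp
  qed
qed

lemma AC_on_lipschitz_combination:
  assumes f: "AC_on a b f" and g: "AC_on a b g" and M: "M > 0"
    and h: "\<And>s t. s \<in> {a..b} \<Longrightarrow> t \<in> {a..b} \<Longrightarrow> norm (h t - h s) \<le> M * (norm (f t - f s) + norm (g t - g s))"
  shows "AC_on a b h"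
  unfolding AC_on_def
proof (intro allI impI)
  fix e :: real assume e: "e > 0"
  then have e2: "e / (2 * M) > 0" using M by simp
  obtain d1 where d1: "d1 > 0" "\<And>I. finite I \<and> (\<forall>(s, t)\<in>I. a \<le> s \<and> s \<le> t \<and> t \<le> b)
          \<and> disjoint_family_on (\<lambda>(s, t). {s<..<t}) I \<and> (\<Sum>(s, t)\<in>I. t - s) < d1
        \<Longrightarrow> (\<Sum>(s, t)\<in>I. norm (f t - f s)) < e / (2 * M)"
    using f e2 unfolding AC_on_def by blast
  obtain d2 where d2: "d2 > 0" "\<And>I. finite I \<and> (\<forall>(s, t)\<in>I. a \<le> s \<and> s \<le> t \<and> t \<le> b)
          \<and> disjoint_family_on (\<lambda>(s, t). {s<..<t}) I \<and> (\<Sum>(s, t)\<in>I. t - s) < d2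
        \<Longrightarrow> (\<Sum>(s, t)\<in>I. norm (g t - g s)) < e / (2 * M)"
    using g e2 unfolding AC_on_def by blast
  show "\<exists>d>0. \<forall>I. finite I \<and> (\<forall>(s, t)\<in>I. a \<le> s \<and> s \<le> t \<and> t \<le> b)
          \<and> disjoint_family_on (\<lambda>(s, t). {s<..<t}) I \<and> (\<Sum>(s, t)\<in>I. t - s) < d
        \<longrightarrow> (\<Sum>(s, t)\<in>I. norm (h t - h s)) < e"
  proof (intro exI conjI allI impI)
    show "min d1 d2 > 0" using d1(1) d2(1) by simp
    fix I :: "(real \<times> real) set"
    assume I: "finite I \<and> (\<forall>(s, t)\<in>I. a \<le> s \<and> s \<le> t \<and> t \<le> b)
          \<and> disjoint_family_on (\<lambda>(s, t). {s<..<t}) I \<and> (\<Sum>(s, t)\<in>I. t - s) < min d1 d2"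
    have "(\<Sum>(s, t)\<in>I. norm (h t - h s)) \<le> (\<Sum>(s, t)\<in>I. M * (norm (f t - f s) + norm (g t - g s)))"
      using I by (intro sum_mono) (auto intro!: h)
    also have "\<dots> = M * ((\<Sum>(s, t)\<in>I. norm (f t - f s)) + (\<Sum>(s, t)\<in>I. norm (g t - g s)))"
      by (simp add: sum_distrib_left[symmetric] sum.distrib case_prod_unfold)
    also have "\<dots> < M * (e / (2 * M) + e / (2 * M))"
      using d1(2)[of I] d2(2)[of I] I M by (intro mult_strict_left_mono add_strict_mono) auto
    finally show "(\<Sum>(s, t)\<in>I. norm (h t - h s)) < e" using M by simp
  qed
qed

lemma AC_loc_continuous: "AC_loc f \<Longrightarrow> continuous_on S f"
proof -
  assume f: "AC_loc f"
  have "continuous (at x) f" for x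
  proof -
    have "continuous_on {x - 1..x + 1} f" using f by (intro AC_on_imp_continuous_on) (auto simp: AC_loc_def)
    then show ?thesis by (rule continuous_on_interior) auto
  qed
  then show ?thesis by (simp add: continuous_at_imp_continuous_on)
qed

lemma AC_loc_const [intro]: "AC_loc (\<lambda>x. c)"
  by (auto simp: AC_loc_def AC_on_def case_prod_unfold intro!: exI[of _ 1])

lemma AC_loc_add [intro]: "AC_loc f \<Longrightarrow> AC_loc g \<Longrightarrow> AC_loc (\<lambda>x. f x + g x)"
  unfolding AC_loc_def
proof (intro allI impI)
  fix a b :: real assume "\<forall>a b. a < b \<longrightarrow> AC_on a b f" "\<forall>a b. a < b \<longrightarrow> AC_on a b g" "a < b"
  then have "AC_on a b f" "AC_on a b g" by blast+
  then show "AC_on a b (\<lambda>x. f x + g x)"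
    by (rule AC_on_lipschitz_combination[where M = 1]) (simp_all add: norm_diff_triangle_ineq)
qed

lemma AC_loc_cnj [intro]: "AC_loc f \<Longrightarrow> AC_loc (\<lambda>x. cnj (f x))"
  unfolding AC_loc_def AC_on_def complex_cnj_diff[symmetric] complex_mod_cnj .

lemma AC_loc_mult [intro]:
  assumes f: "AC_loc f" and g: "AC_loc g"
  shows "AC_loc (\<lambda>x. f x * g x)"
  unfolding AC_loc_def
proof (intro allI impI)
  fix a b :: real assume ab: "a < b"
  have "bounded (f ` {a..b})" "bounded (g ` {a..b})"
    using AC_loc_continuous[OF f] AC_loc_continuous[OF g]
    by (auto intro!: compact_imp_bounded compact_continuous_image)
  then obtain M1 M2 where M1: "M1 > 0" "\<And>x. x \<in> {a..b} \<Longrightarrow> norm (f x) \<le> M1"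
    and M2: "M2 > 0" "\<And>x. x \<in> {a..b} \<Longrightarrow> norm (g x) \<le> M2"
    unfolding bounded_pos by (metis imageI)
  show "AC_on a b (\<lambda>x. f x * g x)"
  proof (rule AC_on_lipschitz_combination[of a b f g "M1 + M2"])
    fix s t assume s: "s \<in> {a..b}" and t: "t \<in> {a..b}"
    have "f t * g t - f s * g s = f t * (g t - g s) + (f t - f s) * g s" by (simp add: algebra_simps)
    then have "norm (f t * g t - f s * g s) \<le> norm (f t) * norm (g t - g s) + norm (f t - f s) * norm (g s)"
      by (metis norm_mult norm_triangle_ineq)
    also have "\<dots> \<le> M1 * norm (g t - g s) + norm (f t - f s) * M2"
      using M1(2)[OF t] M2(2)[OF s] by (intro add_mono mult_right_mono mult_left_mono) auto
    also have "\<dots> \<le> (M1 + M2) * (norm (f t - f s) + norm (g t - g s))"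
      using M1 M2 by (simp add: algebra_simps)
    finally show "norm (f t * g t - f s * g s) \<le> (M1 + M2) * (norm (f t - f s) + norm (g t - g s))" .
  qed (use f g ab M1 M2 in \<open>auto simp: AC_loc_def\<close>)
qed

section \<open>Square integrable functions\<close>

definition sqint :: "(real \<Rightarrow> complex) \<Rightarrow> bool" where
  "sqint f \<longleftrightarrow> f \<in> borel_measurable lebesgue \<and> integrable lebesgue (\<lambda>x. (norm (f x))\<^sup>2)"

lemma sqintD: "sqint f \<Longrightarrow> f \<in> borel_measurable lebesgue" "sqint f \<Longrightarrow> integrable lebesgue (\<lambda>x. (norm (f x))\<^sup>2)"
  by (auto simp: sqint_def)

lemma norm_add_sq_le: "(norm (a + b))\<^sup>2 \<le> 2 * (norm a)\<^sup>2 + 2 * (norm b)\<^sup>2" for a b :: "'a::real_normed_vector"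
proof -
  have "(norm (a + b))\<^sup>2 \<le> (norm a + norm b)\<^sup>2" by (intro power_mono norm_triangle_ineq) simp
  also have "\<dots> \<le> 2 * (norm a)\<^sup>2 + 2 * (norm b)\<^sup>2"
    using zero_le_power2[of "norm a - norm b"] by (simp add: power2_eq_square algebra_simps)
  finally show ?thesis .
qed

lemma sqint_add:
  assumes f: "sqint f" and g: "sqint g"
  shows "sqint (\<lambda>x. f x + g x)"
  unfolding sqint_def
proof
  show m: "(\<lambda>x. f x + g x) \<in> borel_measurable lebesgue" using f g by (auto simp: sqint_def)
  show "integrable lebesgue (\<lambda>x. (norm (f x + g x))\<^sup>2)"
  proof (rule Bochner_Integration.integrable_bound)
    show "integrable lebesgue (\<lambda>x. 2 * (norm (f x))\<^sup>2 + 2 * (norm (g x))\<^sup>2)" using f g by (auto simp: sqint_def)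
    show "(\<lambda>x. (norm (f x + g x))\<^sup>2) \<in> borel_measurable lebesgue" using m by auto
    show "AE x in lebesgue. norm ((norm (f x + g x))\<^sup>2) \<le> norm (2 * (norm (f x))\<^sup>2 + 2 * (norm (g x))\<^sup>2)"
      using norm_add_sq_le by (intro AE_I2) auto
  qed
qed

lemma sqint_mult_bounded:
  assumes f: "sqint f" and b: "b \<in> borel_measurable lebesgue" and K: "\<And>x. norm (b x) \<le> K"
  shows "sqint (\<lambda>x. b x * f x)"
  unfolding sqint_def
proof
  show m: "(\<lambda>x. b x * f x) \<in> borel_measurable lebesgue" using f b by (auto simp: sqint_def)
  show "integrable lebesgue (\<lambda>x. (norm (b x * f x))\<^sup>2)"
  proof (rule Bochner_Integration.integrable_bound[of lebesgue "\<lambda>x. K\<^sup>2 * (norm (f x))\<^sup>2"])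
    show "integrable lebesgue (\<lambda>x. K\<^sup>2 * (norm (f x))\<^sup>2)" using f by (auto simp: sqint_def)
    show "(\<lambda>x. (norm (b x * f x))\<^sup>2) \<in> borel_measurable lebesgue" using m by auto
    show "AE x in lebesgue. norm ((norm (b x * f x))\<^sup>2) \<le> norm (K\<^sup>2 * (norm (f x))\<^sup>2)"
      using K by (intro AE_I2) (auto simp: norm_mult power_mult_distrib intro!: mult_right_mono power_mono)
  qed
qed

lemma sqint_cmult: "sqint f \<Longrightarrow> sqint (\<lambda>x. c * f x)"
  by (rule sqint_mult_bounded[where K="norm c"]) auto

lemma sqint_diff: "sqint f \<Longrightarrow> sqint g \<Longrightarrow> sqint (\<lambda>x. f x - g x)"
  using sqint_add[of f "\<lambda>x. (-1) * g x"] sqint_cmult[of g "-1"] by simp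

text \<open>
  An integrable function need not tend to zero at infinity, but it is small at some points far out.
  This is enough to discard boundary terms.
\<close>

lemma integrable_small_right:
  fixes N :: "real \<Rightarrow> real"
  assumes N: "integrable lebesgue N" and nn: "\<And>x. N x \<ge> 0" and e: "e > 0"
  shows "\<exists>x\<ge>a. N x < e"
proof (rule ccontr)
  assume "\<not> (\<exists>x\<ge>a. N x < e)"
  then have ge: "N x \<ge> e" if "x \<ge> a" for x using that by (meson not_le)
  obtain k :: nat where k: "(\<integral>x. N x \<partial>lebesgue) / e < real k" using reals_Archimedean2 by blast
  have "e * real k = (\<integral>x. e * indicator {a..a + real k} x \<partial>lebesgue)" by simp
  also have "\<dots> \<le> (\<integral>x. N x \<partial>lebesgue)"
    by (intro integral_mono integrable_mult_right integrable_real_indicator N)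
       (auto simp: indicator_def nn ge)
  finally show False using k e by (simp add: field_simps)
qed

lemma integrable_small_left:
  fixes N :: "real \<Rightarrow> real"
  assumes N: "integrable lebesgue N" and nn: "\<And>x. N x \<ge> 0" and e: "e > 0"
  shows "\<exists>x\<le>a. N x < e"
proof (rule ccontr)
  assume "\<not> (\<exists>x\<le>a. N x < e)"
  then have ge: "N x \<ge> e" if "x \<le> a" for x using that by (meson not_le)
  obtain k :: nat where k: "(\<integral>x. N x \<partial>lebesgue) / e < real k" using reals_Archimedean2 by blast
  have "e * real k = (\<integral>x. e * indicator {a - real k..a} x \<partial>lebesgue)" by simp
  also have "\<dots> \<le> (\<integral>x. N x \<partial>lebesgue)"
    by (intro integral_mono integrable_mult_right integrable_real_indicator N)
       (auto simp: indicator_def nn ge)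
  finally show False using k e by (simp add: field_simps)
qed

section \<open>The energy inequality\<close>

text \<open>
  The boundary term of the integration by parts in \<open>\<langle>(D - z) \<psi>, (D\<^sup>* + cnj z) \<psi>\<rangle>\<close>, where \<open>\<psi> = (u, v)\<close> and
  \<open>w\<close> is the weight of the second component.
\<close>

definition flux :: "real \<Rightarrow> real \<Rightarrow> complex \<Rightarrow> complex \<Rightarrow> complex \<Rightarrow> complex \<Rightarrow> complex \<Rightarrow> complex" where
  "flux h w z p q u v = \<i> * h * z * (u * cnj u) - \<i> * h * w * z * (v * cnj v)
     - h * w * (p * (u * cnj v)) - h * (q * (v * cnj u))"

text \<open>The product rule applied to the flux, as an expression in the values of all derivatives.\<close>

definition flux_deriv :: "real \<Rightarrow> real \<Rightarrow> complex \<Rightarrow> complex \<Rightarrow> complex \<Rightarrow> complex \<Rightarrow> complex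
    \<Rightarrow> complex \<Rightarrow> complex \<Rightarrow> complex \<Rightarrow> complex \<Rightarrow> complex" where
  "flux_deriv h w z p q u v p' q' u' v' =
     \<i> * h * z * (u' * cnj u + u * cnj u') - \<i> * h * w * z * (v' * cnj v + v * cnj v')
     - h * w * (p' * (u * cnj v) + p * (u' * cnj v + u * cnj v'))
     - h * (q' * (v * cnj u) + q * (v' * cnj u + v * cnj u'))"

lemma flux_AC:
  "AC_loc p \<Longrightarrow> AC_loc q \<Longrightarrow> AC_loc u \<Longrightarrow> AC_loc v \<Longrightarrow> AC_loc (\<lambda>x. flux h w z (p x) (q x) (u x) (v x))"
  unfolding flux_def diff_conv_add_uminus minus_mult_left
  by (intro AC_loc_add AC_loc_mult AC_loc_cnj AC_loc_const)

lemma flux_has_vector_derivative: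
  assumes "(p has_vector_derivative p') (at x)" "(q has_vector_derivative q') (at x)"
    "(u has_vector_derivative u') (at x)" "(v has_vector_derivative v') (at x)"
  shows "((\<lambda>x. flux h w z (p x) (q x) (u x) (v x)) has_vector_derivative
     flux_deriv h w z (p x) (q x) (u x) (v x) p' q' u' v') (at x)"
  unfolding flux_def flux_deriv_def
  by (rule derivative_eq_intros assms has_vector_derivative_cnj refl)+ (simp add: algebra_simps)

lemma flux_bound:
  assumes "\<bar>w\<bar> \<le> W" "norm p \<le> K" "norm q \<le> K" "h > 0" "K \<ge> 0" "W \<ge> 0"
  shows "norm (flux h w z p q u v) \<le> h * (1 + W) * (norm z + K) * ((norm u)\<^sup>2 + (norm v)\<^sup>2)"
proof -
  let ?u = "norm u" and ?v = "norm v"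
  have uv: "?u * ?v \<le> ?u\<^sup>2 + ?v\<^sup>2" 
  proof -
    have "0 \<le> ?u * ?v" by simp
    then show ?thesis using sum_squares_bound[of ?u ?v] by linarith
  qed
  have "norm (flux h w z p q u v) \<le> norm (\<i> * h * z * (u * cnj u)) + norm (\<i> * h * w * z * (v * cnj v))
     + norm (complex_of_real h * w * (p * (u * cnj v))) + norm (h * (q * (v * cnj u)))"
    unfolding flux_def by (intro norm_triangle_le_diff add_mono order_refl)
  also have "\<dots> = h * (norm z * ?u\<^sup>2 + \<bar>w\<bar> * norm z * ?v\<^sup>2 + \<bar>w\<bar> * norm p * (?u * ?v) + norm q * (?u * ?v))"
    using assms(4) by (simp add: norm_mult power2_eq_square algebra_simps)
  also have "\<dots> \<le> h * (norm z * ?u\<^sup>2 + W * norm z * ?v\<^sup>2 + W * K * (?u\<^sup>2 + ?v\<^sup>2) + K * (?u\<^sup>2 + ?v\<^sup>2))"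
    using assms uv by (intro mult_left_mono add_mono mult_mono order_refl mult_right_mono) auto
  also have "\<dots> \<le> h * ((1 + W) * (norm z + K) * (?u\<^sup>2 + ?v\<^sup>2))"
    using assms by (intro mult_left_mono) (simp_all add: algebra_simps)
  finally show ?thesis by (simp add: mult.assoc)
qed

text \<open>
  The left-hand side is the integrand of the weighted form \<open>\<langle>(D - z) \<psi>, (D\<^sup>* + cnj z) \<psi>\<rangle>\<close>, the adjoint being
  that for the weighted inner product. On the right, only the term with \<open>z\<^sup>2\<close>, the flux derivative and the term
  with \<open>p'\<close> and \<open>q'\<close> can have an imaginary part once \<open>p q\<close> is real.
\<close>

lemma flux_identity:
  fixes h w :: real and z p q u v p' q' u' v' f1 f2 :: complex
  assumes f1: "f1 = \<i> * h * u' - \<i> * q * v - z * u" and f2: "f2 = - \<i> * h * v' + \<i> * p * u - z * v"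
  shows "f1 * (- \<i> * h * cnj u' + \<i> * w * p * cnj v + z * cnj u)
       + f2 * (\<i> * h * w * cnj v' - \<i> * q * cnj u + w * z * cnj v)
     = complex_of_real (h\<^sup>2 * ((norm u')\<^sup>2 + w * (norm v')\<^sup>2)) + (p * q - z\<^sup>2) * complex_of_real ((norm u)\<^sup>2 + w * (norm v)\<^sup>2)
       + flux_deriv h w z p q u v p' q' u' v' + complex_of_real h * (w * p' * (u * cnj v) + q' * (v * cnj u))"
proof -
  have sq: "complex_of_real ((norm c)\<^sup>2) = c * cnj c" for c by (rule complex_norm_square)
  have ii: "\<i> * (\<i> * c) = - c" for c by (simp add: mult.assoc[symmetric])
  show ?thesis unfolding f1 f2 flux_deriv_def of_real_add of_real_mult sq
    by (simp add: ii power2_eq_square algebra_simps)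
qed

text \<open>
  Take imaginary parts in \<open>flux_identity\<close>. The term with \<open>z\<^sup>2\<close> beats the term with \<open>p'\<close> and \<open>q'\<close> by the
  gap, and the left-hand side is at most a constant times \<open>F (F + U)\<close> with \<open>F\<close> the size of the right-hand sides and \<open>U\<close>
  that of the solution, so that a small multiple of \<open>U\<^sup>2\<close> can be absorbed. The constants depend
  on the potentials only through \<open>K\<close>, \<open>P\<close> and \<open>R\<close>.
\<close>

lemma energy_pointwise:
  fixes h r P R K :: real and z :: complex
  assumes h: "h > 0" and r: "r > 0" and K: "K \<ge> 0" and PR: "P \<ge> 0" "R \<ge> 0"
    and gap: "h * (r\<^sup>2 * P + R) / (2 * r) < \<bar>Im (z\<^sup>2)\<bar>"
  obtains \<kappa> C where "\<kappa> > 0" "C \<ge> 0"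
    "\<And>u v u' v' p q p' q' :: complex. norm p \<le> K \<Longrightarrow> norm q \<le> K \<Longrightarrow> norm p' \<le> P \<Longrightarrow> norm q' \<le> R \<Longrightarrow> Im (p * q) = 0 \<Longrightarrow>
      \<kappa> * ((norm u)\<^sup>2 + (norm v)\<^sup>2) \<le> C * ((norm (\<i> * h * u' - \<i> * q * v - z * u))\<^sup>2 + (norm (- \<i> * h * v' + \<i> * p * u - z * v))\<^sup>2)
        + sgn (Im (z\<^sup>2)) * Im (flux_deriv h (r\<^sup>2) z p q u v p' q' u' v')"
proof -
  define w where "w = r\<^sup>2"
  have w: "w > 0" using r by (simp add: w_def)
  define m where "m = \<bar>Im (z\<^sup>2)\<bar>"
  define s where "s = sgn (Im (z\<^sup>2))"
  have s: "\<bar>s\<bar> \<le> 1" "s * Im (z\<^sup>2) = m" by (auto simp: s_def m_def sgn_if)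
  define \<theta> where "\<theta> = h * (w * P + R) / (2 * r)"
  have \<theta>: "\<theta> < m" using gap by (simp add: \<theta>_def m_def w_def)
  define \<mu> where "\<mu> = min 1 w"
  have \<mu>: "\<mu> > 0" "\<mu> \<le> 1" "\<mu> \<le> w" using w by (auto simp: \<mu>_def)
  define M where "M = (1 + w) * (K + 2 * norm z + 1)"
  have M: "M > 0" using w K by (auto simp: M_def intro!: mult_pos_pos add_nonneg_pos)
  define \<epsilon> where "\<epsilon> = (m - \<theta>) * \<mu> / 4"
  have \<epsilon>: "\<epsilon> > 0" using \<theta> \<mu> by (simp add: \<epsilon>_def)
  define C where "C = 2 * (M + M\<^sup>2 / (4 * \<epsilon>))"
  have main: "2 * \<epsilon> * ((norm u)\<^sup>2 + (norm v)\<^sup>2) \<le> C * ((norm (\<i> * h * u' - \<i> * q * v - z * u))\<^sup>2 + (norm (- \<i> * h * v' + \<i> * p * u - z * v))\<^sup>2)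
        + s * Im (flux_deriv h w z p q u v p' q' u' v')"
    if pK: "norm p \<le> K" and qK: "norm q \<le> K" and p'P: "norm p' \<le> P" and q'R: "norm q' \<le> R" and pq: "Im (p * q) = 0"
    for u v u' v' p q p' q' :: complex
  proof -
    define f1 where "f1 = \<i> * h * u' - \<i> * q * v - z * u"
    define f2 where "f2 = - \<i> * h * v' + \<i> * p * u - z * v"
    define c1 where "c1 = - \<i> * h * cnj u' + \<i> * w * p * cnj v + z * cnj u"
    define c2 where "c2 = \<i> * h * w * cnj v' - \<i> * q * cnj u + w * z * cnj v"
    define N where "N = (norm u)\<^sup>2 + (norm v)\<^sup>2"
    define Nw where "Nw = (norm u)\<^sup>2 + w * (norm v)\<^sup>2"
    define D where "D = flux_deriv h w z p q u v p' q' u' v'"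
    define X where "X = h * Im (w * p' * (u * cnj v) + q' * (v * cnj u))"
    define U where "U = norm u + norm v"
    define F where "F = norm f1 + norm f2"
    have "Im (f1 * c1 + f2 * c2) = Im ((p * q - z\<^sup>2) * complex_of_real Nw) + Im D + X"
      unfolding c1_def c2_def D_def X_def Nw_def
        flux_identity[OF f1_def f2_def, of w p' q'] by simp
    also have "Im ((p * q - z\<^sup>2) * complex_of_real Nw) = - Im (z\<^sup>2) * Nw"
    proof -
      have "Im ((p * q - z\<^sup>2) * complex_of_real Nw) = (Im (p * q) - Im (z\<^sup>2)) * Nw"
        by (simp add: algebra_simps)
      then show ?thesis unfolding pq by simp
    qed
    finally have "Im (z\<^sup>2) * Nw = Im D + X - Im (f1 * c1 + f2 * c2)" by simp
    then have "s * (Im (z\<^sup>2) * Nw) = s * (Im D + X - Im (f1 * c1 + f2 * c2))" by simp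
    then have 1: "m * Nw = s * Im D + s * X - s * Im (f1 * c1 + f2 * c2)"
      using s(2) by (simp add: algebra_simps)
    have sle: "s * x \<le> \<bar>x\<bar>" "- (s * x) \<le> \<bar>x\<bar>" for x
      using mult_right_mono[OF s(1), of "\<bar>x\<bar>"] abs_ge_self[of "s * x"] abs_ge_minus_self[of "s * x"]
      by (auto simp: abs_mult)
    have X: "\<bar>X\<bar> \<le> \<theta> * Nw"
    proof -
      have "\<bar>X\<bar> = h * \<bar>Im (w * p' * (u * cnj v) + q' * (v * cnj u))\<bar>" using h by (simp add: X_def abs_mult)
      also have "\<dots> \<le> h * (norm (w * p' * (u * cnj v)) + norm (q' * (v * cnj u)))"
        using h by (intro mult_left_mono order_trans[OF abs_Im_le_cmod norm_triangle_ineq]) auto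
      also have "\<dots> = h * ((w * norm p' + norm q') * (norm u * norm v))"
        using w by (simp add: norm_mult algebra_simps)
      also have "\<dots> \<le> h * ((w * P + R) * (norm u * norm v))"
        using h w p'P q'R by (intro mult_left_mono mult_right_mono add_mono) auto
      also have "\<dots> \<le> h * ((w * P + R) * (Nw / (2 * r)))"
      proof -
        have "0 \<le> (norm u - r * norm v)\<^sup>2" by simp
        then have "norm u * norm v \<le> Nw / (2 * r)"
          using r by (simp add: Nw_def w_def power2_eq_square field_simps)
        then show ?thesis using h w PR by (intro mult_left_mono) auto
      qed
      finally show ?thesis by (simp add: \<theta>_def)
    qed
    have c1: "norm c1 \<le> M * (norm f1 + U)"
    proof -
      \<comment> \<open>the derivatives enter \<open>c1\<close> exactly as they enter \<open>cnj f1\<close>\<close>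
      have "c1 = cnj f1 + (\<i> * w * p - \<i> * cnj q) * cnj v + (z + cnj z) * cnj u"
        by (simp add: c1_def f1_def algebra_simps)
      also have "norm \<dots> \<le> norm f1 + (w * norm p + norm q) * norm v + (norm z + norm z) * norm u"
      proof (intro norm_triangle_mono)
        show "norm ((\<i> * w * p - \<i> * cnj q) * cnj v) \<le> (w * norm p + norm q) * norm v"
          unfolding norm_mult complex_mod_cnj
          using norm_triangle_ineq4[of "\<i> * w * p" "\<i> * cnj q"] w by (intro mult_right_mono) (auto simp: norm_mult)
        show "norm ((z + cnj z) * cnj u) \<le> (norm z + norm z) * norm u"
          unfolding norm_mult complex_mod_cnj
          using norm_triangle_ineq[of z "cnj z"] by (intro mult_right_mono) auto
      qed simp
      also have "\<dots> \<le> M * norm f1 + M * norm v + M * norm u"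
      proof (intro add_mono mult_right_mono)
        have "w * norm p + norm q \<le> w * K + K" using pK qK w by (intro add_mono mult_left_mono) auto
        also have "\<dots> \<le> M" using w K by (simp add: M_def algebra_simps)
        finally show "w * norm p + norm q \<le> M" .
        show "norm z + norm z \<le> M" using w K by (simp add: M_def algebra_simps)
        have "1 \<le> M" using w K by (simp add: M_def algebra_simps)
        then show "norm f1 \<le> M * norm f1" using mult_right_mono[of 1 M "norm f1"] by simp
      qed auto
      finally show ?thesis by (simp add: U_def algebra_simps)
    qed
    have c2: "norm c2 \<le> M * (norm f2 + U)"
    proof -
      have "c2 = w * cnj f2 + (\<i> * w * cnj p - \<i> * q) * cnj u + (w * (z + cnj z)) * cnj v"
        by (simp add: c2_def f2_def algebra_simps)
      also have "norm \<dots> \<le> w * norm f2 + (w * norm p + norm q) * norm u + (w * (norm z + norm z)) * norm v"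
      proof (intro norm_triangle_mono)
        show "norm ((\<i> * w * cnj p - \<i> * q) * cnj u) \<le> (w * norm p + norm q) * norm u"
          unfolding norm_mult complex_mod_cnj
          using norm_triangle_ineq4[of "\<i> * w * cnj p" "\<i> * q"] w by (intro mult_right_mono) (auto simp: norm_mult)
        show "norm (w * (z + cnj z) * cnj v) \<le> (w * (norm z + norm z)) * norm v"
          unfolding norm_mult complex_mod_cnj
          using norm_triangle_ineq[of z "cnj z"] w by (intro mult_right_mono) auto
      qed (use w in \<open>simp add: norm_mult\<close>)
      also have "\<dots> \<le> M * norm f2 + M * norm u + M * norm v"
      proof (intro add_mono mult_right_mono)
        have "w * norm p + norm q \<le> w * K + K" using pK qK w by (intro add_mono mult_left_mono) auto
        also have "\<dots> \<le> M" using w K by (simp add: M_def algebra_simps)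
        finally show "w * norm p + norm q \<le> M" .
        show "w * (norm z + norm z) \<le> M" using w K by (simp add: M_def algebra_simps)
        show "w \<le> M" using w K by (simp add: M_def algebra_simps)
      qed auto
      finally show ?thesis by (simp add: U_def algebra_simps)
    qed
    have S: "\<bar>Im (f1 * c1 + f2 * c2)\<bar> \<le> M * F\<^sup>2 + M\<^sup>2 / (4 * \<epsilon>) * F\<^sup>2 + \<epsilon> * U\<^sup>2"
    proof -
      have "\<bar>Im (f1 * c1 + f2 * c2)\<bar> \<le> norm f1 * norm c1 + norm f2 * norm c2"
        using abs_Im_le_cmod[of "f1 * c1 + f2 * c2"] norm_triangle_ineq[of "f1 * c1" "f2 * c2"]
        by (simp add: norm_mult)
      also have "\<dots> \<le> norm f1 * (M * (F + U)) + norm f2 * (M * (F + U))"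
        using c1 c2 M by (intro add_mono mult_left_mono) (auto simp: F_def intro: order_trans[OF _ mult_left_mono])
      also have "\<dots> = M * F\<^sup>2 + M * F * U" by (simp add: F_def power2_eq_square algebra_simps)
      also have "M * F * U \<le> M\<^sup>2 / (4 * \<epsilon>) * F\<^sup>2 + \<epsilon> * U\<^sup>2"
      proof -
        have "0 \<le> (M * F - 2 * \<epsilon> * U)\<^sup>2 / (4 * \<epsilon>)" using \<epsilon> by simp
        also have "\<dots> = M\<^sup>2 / (4 * \<epsilon>) * F\<^sup>2 + \<epsilon> * U\<^sup>2 - M * F * U"
          using \<epsilon> by (simp add: power2_eq_square field_simps)
        finally show ?thesis by simp
      qed
      finally show ?thesis by simp
    qed
    have F2: "F\<^sup>2 \<le> 2 * ((norm f1)\<^sup>2 + (norm f2)\<^sup>2)" and U2: "U\<^sup>2 \<le> 2 * N"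
      using sum_squares_bound[of "norm f1" "norm f2"] sum_squares_bound[of "norm u" "norm v"]
      by (auto simp: F_def U_def N_def power2_sum)
    have "M * F\<^sup>2 + M\<^sup>2 / (4 * \<epsilon>) * F\<^sup>2 = (M + M\<^sup>2 / (4 * \<epsilon>)) * F\<^sup>2" by (simp add: distrib_right)
    also have "\<dots> \<le> (M + M\<^sup>2 / (4 * \<epsilon>)) * (2 * ((norm f1)\<^sup>2 + (norm f2)\<^sup>2))"
      using F2 M \<epsilon> by (intro mult_left_mono) auto
    also have "\<dots> = C * ((norm f1)\<^sup>2 + (norm f2)\<^sup>2)" by (simp only: C_def mult.assoc mult.left_commute)
    finally have FC: "M * F\<^sup>2 + M\<^sup>2 / (4 * \<epsilon>) * F\<^sup>2 \<le> C * ((norm f1)\<^sup>2 + (norm f2)\<^sup>2)" .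
    have NN: "(m - \<theta>) * (\<mu> * N) \<le> (m - \<theta>) * Nw"
    proof (intro mult_left_mono)
      show "\<mu> * N \<le> Nw" unfolding N_def Nw_def distrib_left
        using mult_right_mono[OF \<mu>(2), of "(norm u)\<^sup>2"] mult_right_mono[OF \<mu>(3), of "(norm v)\<^sup>2"] by simp
    qed (use \<theta> in simp)
    have "(m - \<theta>) * Nw \<le> s * Im D + \<bar>Im (f1 * c1 + f2 * c2)\<bar>"
      using 1 X sle(1)[of X] sle(2)[of "Im (f1 * c1 + f2 * c2)"] by (simp add: algebra_simps)
    moreover have "4 * \<epsilon> * N = (m - \<theta>) * (\<mu> * N)" by (simp add: \<epsilon>_def)
    moreover have "\<epsilon> * U\<^sup>2 \<le> \<epsilon> * (2 * N)" using U2 \<epsilon> by (intro mult_left_mono) auto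
    ultimately have "2 * \<epsilon> * N \<le> C * ((norm f1)\<^sup>2 + (norm f2)\<^sup>2) + s * Im D"
      using NN S FC by linarith
    then show ?thesis by (simp only: N_def f1_def f2_def D_def)
  qed
  show ?thesis
  proof (rule that[of "2 * \<epsilon>" C])
    show "C \<ge> 0" using M \<epsilon> by (simp add: C_def)
  qed (use \<epsilon> main in \<open>auto simp: w_def s_def\<close>)
qed

lemma AC_loc_measurable: "AC_loc f \<Longrightarrow> f \<in> borel_measurable lebesgue"
  by (intro measurable_completion) (simp add: borel_measurable_continuous_onI AC_loc_continuous)

lemma primitive_diff:
  assumes "primitive f f'" "primitive g g'"
  shows "primitive (\<lambda>x. f x - g x) (\<lambda>x. f' x - g' x)"
  unfolding primitive_def
proof (intro allI impI conjI)
  fix a b :: real assume ab: "a \<le> b"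
  show "(\<lambda>x. f' x - g' x) absolutely_integrable_on {a..b}"
    using assms ab by (intro set_integral_diff) (auto simp: primitive_def)
  have "((\<lambda>x. f' x - g' x) has_integral ((f b - f a) - (g b - g a))) {a..b}"
    using assms ab by (intro has_integral_diff) (auto simp: primitive_def)
  then show "((\<lambda>x. f' x - g' x) has_integral (f b - g b - (f a - g a))) {a..b}"
    by (simp add: algebra_simps)
qed

lemma primitive_lebesgue:
  assumes "primitive F g" "a \<le> b"
  shows "integrable lebesgue (\<lambda>x. indicator {a..b} x *\<^sub>R g x)"
    and "(\<integral>x. indicator {a..b} x *\<^sub>R g x \<partial>lebesgue) = F b - F a"
proof -
  have g: "g absolutely_integrable_on {a..b}" "(g has_integral (F b - F a)) {a..b}"
    using assms by (auto simp: primitive_def)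
  show "integrable lebesgue (\<lambda>x. indicator {a..b} x *\<^sub>R g x)"
    using g(1) by (simp add: set_integrable_def)
  show "(\<integral>x. indicator {a..b} x *\<^sub>R g x \<partial>lebesgue) = F b - F a"
    using set_lebesgue_integral_eq_integral(2)[OF g(1)] g(2)
    by (simp add: set_lebesgue_integral_def integral_unique)
qed

lemma primitive_norm_squared:
  assumes ug: "primitive u g"
  shows "primitive (\<lambda>x. u x * cnj (u x)) (\<lambda>x. g x * cnj (u x) + u x * cnj (g x))"
proof (rule primitive_of_AE_derivative)
  show "AC_loc (\<lambda>x. u x * cnj (u x))"
    by (intro AC_loc_mult AC_loc_cnj primitive_imp_AC_loc[OF ug])
  show "AE x in lebesgue. ((\<lambda>x. u x * cnj (u x)) has_vector_derivative g x * cnj (u x) + u x * cnj (g x)) (at x)"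
    using primitive_AE_has_vector_derivative[OF ug]
  proof eventually_elim
    case (elim x)
    show ?case
      by (rule derivative_eq_intros elim has_vector_derivative_cnj refl)+ (simp add: algebra_simps)
  qed
qed

text \<open>
  The derivative of \<open>(norm (u x))\<^sup>2\<close> is dominated by the integrable function \<open>(norm (u x))\<^sup>2 + (norm (g x))\<^sup>2\<close>; integrate
  it from a point far to the left where \<open>u\<close> is small.
\<close>

lemma primitive_sup_bound:
  assumes ug: "primitive u g" and u: "sqint u" and g: "sqint g"
  shows "(norm (u x))\<^sup>2 \<le> (\<integral>x. (norm (u x))\<^sup>2 \<partial>lebesgue) + (\<integral>x. (norm (g x))\<^sup>2 \<partial>lebesgue)"
proof -
  let ?I = "(\<integral>x. (norm (u x))\<^sup>2 \<partial>lebesgue) + (\<integral>x. (norm (g x))\<^sup>2 \<partial>lebesgue)"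
  note ui = sqintD(2)[OF u] and gi = sqintD(2)[OF g]
  define H where "H x = u x * cnj (u x)" for x
  define H' where "H' x = g x * cnj (u x) + u x * cnj (g x)" for x
  have H: "primitive H H'"
    unfolding H_def[abs_def] H'_def[abs_def] by (rule primitive_norm_squared[OF ug])
  have "(norm (u x))\<^sup>2 \<le> ?I + e" if e: "e > 0" for e
  proof -
    obtain a where a: "a \<le> x" "(norm (u a))\<^sup>2 < e"
      using integrable_small_left[OF ui _ e, of x] by auto
    note P = primitive_lebesgue[OF H a(1)]
    have "norm (H x - H a) = norm (\<integral>y. indicator {a..x} y *\<^sub>R H' y \<partial>lebesgue)" using P(2) by simp
    also have "\<dots> \<le> (\<integral>y. (norm (u y))\<^sup>2 + (norm (g y))\<^sup>2 \<partial>lebesgue)"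
    proof (rule Bochner_Integration.integral_norm_bound_integral[OF P(1)])
      show "integrable lebesgue (\<lambda>y. (norm (u y))\<^sup>2 + (norm (g y))\<^sup>2)" using ui gi by simp
      fix y
      have "norm (H' y) \<le> norm (g y) * norm (u y) + norm (u y) * norm (g y)"
        unfolding H'_def by (rule order_trans[OF norm_triangle_ineq]) (simp add: norm_mult)
      also have "\<dots> \<le> (norm (u y))\<^sup>2 + (norm (g y))\<^sup>2"
        using sum_squares_bound[of "norm (u y)" "norm (g y)"] by (simp add: algebra_simps)
      finally show "norm (indicator {a..x} y *\<^sub>R H' y) \<le> (norm (u y))\<^sup>2 + (norm (g y))\<^sup>2"
        by (auto simp: indicator_def)
    qed
    also have "\<dots> = ?I" using ui gi by simp
    finally have "norm (H x - H a) \<le> ?I" .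
    moreover have "norm (H y) = (norm (u y))\<^sup>2" for y by (simp add: H_def norm_mult power2_eq_square)
    ultimately show ?thesis using a(2) norm_triangle_ineq2[of "H x" "H a"] by simp
  qed
  then show ?thesis by (rule field_le_epsilon)
qed

text \<open>
  The equation \<open>(D - z) (u, v) = (f1, f2)\<close> solved for the derivatives. In this form it is stable under pointwise limits.
\<close>

definition dirac_solution ::
  "real \<Rightarrow> (real \<Rightarrow> complex) \<Rightarrow> (real \<Rightarrow> complex) \<Rightarrow> complex \<Rightarrow> (real \<Rightarrow> complex) \<Rightarrow> (real \<Rightarrow> complex)
    \<Rightarrow> (real \<Rightarrow> complex) \<Rightarrow> (real \<Rightarrow> complex) \<Rightarrow> bool" where
  "dirac_solution h p q z f1 f2 u v \<longleftrightarrow> sqint u \<and> sqint v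
    \<and> primitive u (\<lambda>x. (f1 x + \<i> * q x * v x + z * u x) / (\<i> * h))
    \<and> primitive v (\<lambda>x. (\<i> * p x * u x - z * v x - f2 x) / (\<i> * h))"

abbreviation energy :: "(real \<Rightarrow> complex) \<Rightarrow> (real \<Rightarrow> complex) \<Rightarrow> real" where
  "energy u v \<equiv> (\<integral>x. (norm (u x))\<^sup>2 + (norm (v x))\<^sup>2 \<partial>lebesgue)"

text \<open>The hypotheses on the potentials that are shared by all members of the path from \<open>0\<close> to \<open>(p, q)\<close>.\<close>

definition admissible :: "real \<Rightarrow> real \<Rightarrow> real \<Rightarrow> (real \<Rightarrow> complex) \<Rightarrow> (real \<Rightarrow> complex) \<Rightarrow> bool" where
  "admissible K P R p q \<longleftrightarrow> AC_loc p \<and> AC_loc q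
    \<and> (\<forall>x. norm (p x) \<le> K \<and> norm (q x) \<le> K \<and> Im (p x * q x) = 0)
    \<and> (AE x in lebesgue. norm (ae_deriv p x) \<le> P) \<and> (AE x in lebesgue. norm (ae_deriv q x) \<le> R)"

text \<open>
  The pointwise inequality is integrated over segments whose end points recede to infinity along
  points where the solution is small, so that the flux disappears. The constant \<open>A\<close> is
  uniform in the potentials, as the continuity argument needs.
\<close>

lemma energy_estimate:
  fixes h r P R K :: real and z :: complex
  assumes h: "h > 0" and r: "r > 0" and K: "K \<ge> 0" and PR: "P \<ge> 0" "R \<ge> 0"
    and gap: "h * (r\<^sup>2 * P + R) / (2 * r) < \<bar>Im (z\<^sup>2)\<bar>"
  obtains A where "A > 0"
    "\<And>p q f1 f2 u v. admissible K P R p q \<Longrightarrow> sqint f1 \<Longrightarrow> sqint f2 \<Longrightarrow>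
       dirac_solution h p q z f1 f2 u v \<Longrightarrow> energy u v \<le> A * energy f1 f2"
proof -
  obtain \<kappa> C where \<kappa>: "\<kappa> > 0" and C: "C \<ge> 0" and pw:
    "\<And>u v u' v' p q p' q' :: complex. norm p \<le> K \<Longrightarrow> norm q \<le> K \<Longrightarrow> norm p' \<le> P \<Longrightarrow> norm q' \<le> R \<Longrightarrow> Im (p * q) = 0 \<Longrightarrow>
      \<kappa> * ((norm u)\<^sup>2 + (norm v)\<^sup>2) \<le> C * ((norm (\<i> * h * u' - \<i> * q * v - z * u))\<^sup>2 + (norm (- \<i> * h * v' + \<i> * p * u - z * v))\<^sup>2)
        + sgn (Im (z\<^sup>2)) * Im (flux_deriv h (r\<^sup>2) z p q u v p' q' u' v')"
    using energy_pointwise[OF h r K PR gap] by blast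
  define W where "W = h * (1 + r\<^sup>2) * (norm z + K)"
  have W: "W \<ge> 0" using h K by (simp add: W_def)
  have est: "\<kappa> * energy u v \<le> C * energy f1 f2"
    if adm: "admissible K P R p q" and f1: "sqint f1" and f2: "sqint f2" and sol: "dirac_solution h p q z f1 f2 u v"
    for p q f1 f2 u v
  proof -
    have p: "AC_loc p" and q: "AC_loc q" and pK: "\<And>x. norm (p x) \<le> K" and qK: "\<And>x. norm (q x) \<le> K"
      and p': "AE x in lebesgue. norm (ae_deriv p x) \<le> P" and q': "AE x in lebesgue. norm (ae_deriv q x) \<le> R"
      and pq: "\<And>x. Im (p x * q x) = 0"
      using adm by (auto simp: admissible_def)
    define u' where "u' x = (f1 x + \<i> * q x * v x + z * u x) / (\<i> * h)" for x
    define v' where "v' x = (\<i> * p x * u x - z * v x - f2 x) / (\<i> * h)" for x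
    have u: "sqint u" "primitive u u'" and v: "sqint v" "primitive v v'"
      using sol by (auto simp: dirac_solution_def u'_def[abs_def] v'_def[abs_def])
    define N where "N x = (norm (u x))\<^sup>2 + (norm (v x))\<^sup>2" for x
    define F where "F x = (norm (f1 x))\<^sup>2 + (norm (f2 x))\<^sup>2" for x
    have Ni: "integrable lebesgue N" and Fi: "integrable lebesgue F"
      using sqintD(2)[OF u(1)] sqintD(2)[OF v(1)] sqintD(2)[OF f1] sqintD(2)[OF f2] unfolding N_def F_def by auto
    have N0: "N x \<ge> 0" and F0: "F x \<ge> 0" for x by (auto simp: N_def F_def)
    define B where "B x = flux h (r\<^sup>2) z (p x) (q x) (u x) (v x)" for x
    define B' where "B' x = flux_deriv h (r\<^sup>2) z (p x) (q x) (u x) (v x) (ae_deriv p x) (ae_deriv q x) (u' x) (v' x)" for x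
    have BB': "primitive B B'"
    proof (rule primitive_of_AE_derivative)
      show "AC_loc B" unfolding B_def
        by (intro flux_AC p q primitive_imp_AC_loc[OF u(2)] primitive_imp_AC_loc[OF v(2)])
      show "AE x in lebesgue. (B has_vector_derivative B' x) (at x)"
        using AC_loc_primitive_vector_derivative(1)[OF p] AC_loc_primitive_vector_derivative(1)[OF q]
          primitive_AE_has_vector_derivative[OF u(2)] primitive_AE_has_vector_derivative[OF v(2)]
        by eventually_elim (unfold B_def[abs_def] B'_def, rule flux_has_vector_derivative)
    qed
    have Bb: "norm (B x) \<le> W * N x" for x
      unfolding B_def W_def N_def using pK qK h K by (intro flux_bound) auto
    let ?s = "sgn (Im (z\<^sup>2))"
    have eq: "f1 x = \<i> * h * u' x - \<i> * q x * v x - z * u x" "f2 x = - \<i> * h * v' x + \<i> * p x * u x - z * v x" for x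
      using h by (auto simp: u'_def v'_def)
    have point: "AE x in lebesgue. \<kappa> * N x \<le> C * F x + ?s * Im (B' x)"
      using p' q'
    proof eventually_elim
      case (elim x)
      then show ?case unfolding N_def F_def B'_def eq by (intro pw pK qK pq)
    qed
    have seg: "\<kappa> * (\<integral>x. indicator {a..b} x * N x \<partial>lebesgue) \<le> C * (\<integral>x. F x \<partial>lebesgue) + W * (N a + N b)"
      if ab: "a \<le> b" for a b
    proof -
      note P = primitive_lebesgue[OF BB' ab]
      have iN: "integrable lebesgue (\<lambda>x. indicator {a..b} x * N x)"
        using integrable_mult_indicator[OF _ Ni, of "{a..b}"] by simp
      have iF: "integrable lebesgue (\<lambda>x. indicator {a..b} x * F x)"
        using integrable_mult_indicator[OF _ Fi, of "{a..b}"] by simp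
      have iB: "integrable lebesgue (\<lambda>x. Im (indicator {a..b} x *\<^sub>R B' x))" by (rule integrable_Im[OF P(1)])
      have "\<kappa> * (\<integral>x. indicator {a..b} x * N x \<partial>lebesgue) = (\<integral>x. \<kappa> * (indicator {a..b} x * N x) \<partial>lebesgue)" by simp
      also have "\<dots> \<le> (\<integral>x. C * (indicator {a..b} x * F x) + ?s * Im (indicator {a..b} x *\<^sub>R B' x) \<partial>lebesgue)"
      proof (rule integral_mono_AE)
        show "AE x in lebesgue. \<kappa> * (indicator {a..b} x * N x) \<le> C * (indicator {a..b} x * F x) + ?s * Im (indicator {a..b} x *\<^sub>R B' x)"
          using point by eventually_elim (auto simp: indicator_def)
      qed (use iN iF iB in \<open>auto intro!: Bochner_Integration.integrable_add integrable_mult_right\<close>)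
      also have "\<dots> = C * (\<integral>x. indicator {a..b} x * F x \<partial>lebesgue) + ?s * (\<integral>x. Im (indicator {a..b} x *\<^sub>R B' x) \<partial>lebesgue)"
        using iF iB by (subst Bochner_Integration.integral_add) (auto intro!: integrable_mult_right)
      also have "(\<integral>x. Im (indicator {a..b} x *\<^sub>R B' x) \<partial>lebesgue) = Im (B b - B a)"
        unfolding P(2)[symmetric] by (rule integral_Im[OF P(1)])
      also have "(\<integral>x. indicator {a..b} x * F x \<partial>lebesgue) \<le> (\<integral>x. F x \<partial>lebesgue)"
        using iF Fi F0 by (intro integral_mono) (auto simp: indicator_def)
      also have "?s * Im (B b - B a) \<le> W * (N a + N b)"
      proof -
        have "?s * Im (B b - B a) \<le> \<bar>Im (B b - B a)\<bar>" by (auto simp: sgn_if)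
        also have "\<dots> \<le> norm (B b) + norm (B a)"
          using abs_Im_le_cmod[of "B b - B a"] norm_triangle_ineq4[of "B b" "B a"] by linarith
        also have "\<dots> \<le> W * (N a + N b)" using Bb[of a] Bb[of b] by (simp add: distrib_left)
        finally show ?thesis .
      qed
      finally show ?thesis using C by (simp add: mult_left_mono)
    qed
    have "\<exists>a b. a \<le> - real n \<and> real n \<le> b \<and> N a < 1 / (real n + 1) \<and> N b < 1 / (real n + 1)" for n
      using integrable_small_left[OF Ni N0, of "1 / (real n + 1)" "- real n"]
        integrable_small_right[OF Ni N0, of "1 / (real n + 1)" "real n"] by (simp, blast)
    then obtain a b where ab: "\<And>n. a n \<le> - real n" "\<And>n. real n \<le> b n"
      "\<And>n. N (a n) < 1 / (real n + 1)" "\<And>n. N (b n) < 1 / (real n + 1)" by metis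
    have lim: "(\<lambda>n. \<integral>x. indicator {a n..b n} x * N x \<partial>lebesgue) \<longlonglongrightarrow> (\<integral>x. N x \<partial>lebesgue)"
    proof (rule integral_dominated_convergence[where w=N])
      show "AE x in lebesgue. (\<lambda>n. indicator {a n..b n} x * N x) \<longlonglongrightarrow> N x"
      proof (intro AE_I2)
        fix x
        obtain n0 :: nat where n0: "\<bar>x\<bar> < real n0" using reals_Archimedean2 by blast
        have "indicator {a n..b n} x * N x = N x" if "n \<ge> n0" for n
        proof -
          have "a n \<le> x" "x \<le> b n" using ab(1,2)[of n] n0 that by linarith+
          then show ?thesis by simp
        qed
        then show "(\<lambda>n. indicator {a n..b n} x * N x) \<longlonglongrightarrow> N x"
          by (intro tendsto_eventually eventually_mono[OF eventually_ge_at_top[of n0]])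
      qed
      show "AE x in lebesgue. norm (indicator {a n..b n} x * N x) \<le> N x" for n
        using N0 by (intro AE_I2) (auto simp: indicator_def)
      show "(\<lambda>x. indicator {a n..b n} x * N x) \<in> borel_measurable lebesgue" for n
        using integrable_mult_indicator[OF _ Ni, of "{a n..b n}"] by (auto dest!: borel_measurable_integrable)
    qed (use Ni in auto)
    have "\<kappa> * (\<integral>x. N x \<partial>lebesgue) \<le> C * (\<integral>x. F x \<partial>lebesgue) + W * 0"
    proof (rule LIMSEQ_le)
      show "(\<lambda>n. \<kappa> * (\<integral>x. indicator {a n..b n} x * N x \<partial>lebesgue)) \<longlonglongrightarrow> \<kappa> * (\<integral>x. N x \<partial>lebesgue)"
        by (intro tendsto_intros lim)
      have "(\<lambda>n. 2 / (real n + 1)) \<longlonglongrightarrow> 0" by real_asymp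
      then show "(\<lambda>n. C * (\<integral>x. F x \<partial>lebesgue) + W * (2 / (real n + 1))) \<longlonglongrightarrow> C * (\<integral>x. F x \<partial>lebesgue) + W * 0"
        by (intro tendsto_intros)
      have "\<kappa> * (\<integral>x. indicator {a n..b n} x * N x \<partial>lebesgue) \<le> C * (\<integral>x. F x \<partial>lebesgue) + W * (2 / (real n + 1))" for n
      proof -
        have "a n \<le> b n" using ab(1,2)[of n] by linarith
        from seg[OF this] have "\<kappa> * (\<integral>x. indicator {a n..b n} x * N x \<partial>lebesgue) \<le> C * (\<integral>x. F x \<partial>lebesgue) + W * (N (a n) + N (b n))" .
        also have "W * (N (a n) + N (b n)) \<le> W * (2 / (real n + 1))"
          using ab(3,4)[of n] W by (intro mult_left_mono) auto
        finally show ?thesis by simp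
      qed
      then show "\<exists>N'. \<forall>n\<ge>N'. \<kappa> * (\<integral>x. indicator {a n..b n} x * N x \<partial>lebesgue) \<le> C * (\<integral>x. F x \<partial>lebesgue) + W * (2 / (real n + 1))"
        by blast
    qed
    then show ?thesis by (simp add: N_def F_def)
  qed
  show ?thesis
  proof (rule that[of "(C + 1) / \<kappa>"])
    show "(C + 1) / \<kappa> > 0" using C \<kappa> by simp
    fix p q f1 f2 u v
    assume *: "admissible K P R p q" "sqint f1" "sqint f2" "dirac_solution h p q z f1 f2 u v"
    have "energy f1 f2 \<ge> 0" by (intro Bochner_Integration.integral_nonneg) simp
    then have "C * energy f1 f2 \<le> (C + 1) * energy f1 f2" by (intro mult_right_mono) simp_all
    then have "\<kappa> * energy u v \<le> (C + 1) * energy f1 f2" using est[OF *] by linarith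
    then show "energy u v \<le> (C + 1) / \<kappa> * energy f1 f2"
      using \<kappa> by (simp only: times_divide_eq_left pos_le_divide_eq mult.commute)
  qed
qed

lemma dirac_solution_sup_bound:
  assumes h: "h > 0" and p: "AC_loc p" "\<And>x. norm (p x) \<le> K" and q: "AC_loc q" "\<And>x. norm (q x) \<le> K"
    and f: "sqint f1" "sqint f2" and sol: "dirac_solution h p q z f1 f2 u v"
  shows "(norm (u x))\<^sup>2 + (norm (v x))\<^sup>2
     \<le> (1 + 3 * (1 + K\<^sup>2 + (norm z)\<^sup>2) / h\<^sup>2) * (energy u v + energy f1 f2)"
proof -
  define u' where "u' x = (f1 x + \<i> * q x * v x + z * u x) / (\<i> * h)" for x
  define v' where "v' x = (\<i> * p x * u x - z * v x - f2 x) / (\<i> * h)" for x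
  have u: "sqint u" "primitive u u'" and v: "sqint v" "primitive v v'"
    using sol by (auto simp: dirac_solution_def u'_def[abs_def] v'_def[abs_def])
  have sq3: "(norm (a + b + c))\<^sup>2 \<le> 3 * ((norm a)\<^sup>2 + (norm b)\<^sup>2 + (norm c)\<^sup>2)" for a b c :: complex
  proof -
    have "(norm (a + b + c))\<^sup>2 \<le> (norm a + norm b + norm c)\<^sup>2"
      by (intro power_mono norm_triangle_mono order_refl) auto
    also have "\<dots> \<le> 3 * ((norm a)\<^sup>2 + (norm b)\<^sup>2 + (norm c)\<^sup>2)"
      using sum_squares_bound[of "norm a" "norm b"] sum_squares_bound[of "norm a" "norm c"] sum_squares_bound[of "norm b" "norm c"]
      by (simp add: power2_eq_square algebra_simps)
    finally show ?thesis .
  qed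
  have K: "(norm (p x))\<^sup>2 \<le> K\<^sup>2" "(norm (q x))\<^sup>2 \<le> K\<^sup>2" for x using p(2) q(2) by (auto intro: power_mono)
  have iq: "sqint (\<lambda>x. \<i> * q x * v x)" "sqint (\<lambda>x. \<i> * p x * u x)"
    using p q AC_loc_measurable[OF p(1)] AC_loc_measurable[OF q(1)]
    by (auto intro!: sqint_mult_bounded[where K=K] u(1) v(1) simp: norm_mult)
  have u'2: "sqint u'"
  proof -
    have "sqint (\<lambda>x. (1 / (\<i> * h)) * (f1 x + \<i> * q x * v x + z * u x))"
      by (intro sqint_cmult sqint_add f iq u(1))
    then show ?thesis by (simp add: u'_def[abs_def])
  qed
  have v'2: "sqint v'"
  proof -
    have "sqint (\<lambda>x. (1 / (\<i> * h)) * (\<i> * p x * u x - z * v x - f2 x))"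
      by (intro sqint_cmult sqint_diff f iq v(1))
    then show ?thesis by (simp add: v'_def[abs_def])
  qed
  have deriv: "(norm (u' x))\<^sup>2 + (norm (v' x))\<^sup>2 \<le>
     3 / h\<^sup>2 * ((K\<^sup>2 + (norm z)\<^sup>2) * ((norm (u x))\<^sup>2 + (norm (v x))\<^sup>2) + ((norm (f1 x))\<^sup>2 + (norm (f2 x))\<^sup>2))" for x
  proof -
    have "(norm (u' x))\<^sup>2 = (norm (f1 x + \<i> * q x * v x + z * u x))\<^sup>2 / h\<^sup>2"
      using h by (simp add: u'_def norm_divide norm_mult power_divide)
    also have "\<dots> \<le> 3 * ((norm (f1 x))\<^sup>2 + (norm (q x))\<^sup>2 * (norm (v x))\<^sup>2 + (norm z)\<^sup>2 * (norm (u x))\<^sup>2) / h\<^sup>2"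
      using sq3[of "f1 x" "\<i> * q x * v x" "z * u x"] by (intro divide_right_mono) (auto simp: norm_mult power_mult_distrib)
    also have "\<dots> \<le> 3 * ((norm (f1 x))\<^sup>2 + K\<^sup>2 * (norm (v x))\<^sup>2 + (norm z)\<^sup>2 * (norm (u x))\<^sup>2) / h\<^sup>2"
      using K by (intro divide_right_mono mult_left_mono add_mono mult_right_mono) auto
    finally have 1: "(norm (u' x))\<^sup>2 \<le> 3 / h\<^sup>2 * ((norm (f1 x))\<^sup>2 + K\<^sup>2 * (norm (v x))\<^sup>2 + (norm z)\<^sup>2 * (norm (u x))\<^sup>2)" by simp
    have "(norm (v' x))\<^sup>2 = (norm (\<i> * p x * u x + (- z) * v x + (- f2 x)))\<^sup>2 / h\<^sup>2"
      using h by (simp add: v'_def norm_divide norm_mult power_divide)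
    also have "\<dots> \<le> 3 * ((norm (p x))\<^sup>2 * (norm (u x))\<^sup>2 + (norm z)\<^sup>2 * (norm (v x))\<^sup>2 + (norm (f2 x))\<^sup>2) / h\<^sup>2"
      using sq3[of "\<i> * p x * u x" "(- z) * v x" "- f2 x"] by (intro divide_right_mono) (auto simp: norm_mult power_mult_distrib)
    also have "\<dots> \<le> 3 * (K\<^sup>2 * (norm (u x))\<^sup>2 + (norm z)\<^sup>2 * (norm (v x))\<^sup>2 + (norm (f2 x))\<^sup>2) / h\<^sup>2"
      using K by (intro divide_right_mono mult_left_mono add_mono mult_right_mono) auto
    finally have 2: "(norm (v' x))\<^sup>2 \<le> 3 / h\<^sup>2 * (K\<^sup>2 * (norm (u x))\<^sup>2 + (norm z)\<^sup>2 * (norm (v x))\<^sup>2 + (norm (f2 x))\<^sup>2)" by simp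
    show ?thesis using add_mono[OF 1 2] by (simp add: algebra_simps)
  qed
  note int = sqintD(2)[OF u(1)] sqintD(2)[OF v(1)] sqintD(2)[OF u'2] sqintD(2)[OF v'2] sqintD(2)[OF f(1)] sqintD(2)[OF f(2)]
  have E0: "energy u v \<ge> 0" "energy f1 f2 \<ge> 0" by (auto intro!: Bochner_Integration.integral_nonneg)
  have "(norm (u x))\<^sup>2 + (norm (v x))\<^sup>2 \<le> energy u v + energy u' v'"
    using primitive_sup_bound[OF u(2,1) u'2, of x] primitive_sup_bound[OF v(2,1) v'2, of x] int by simp
  also have "energy u' v' \<le> (\<integral>x. 3 / h\<^sup>2 * ((K\<^sup>2 + (norm z)\<^sup>2) * ((norm (u x))\<^sup>2 + (norm (v x))\<^sup>2) + ((norm (f1 x))\<^sup>2 + (norm (f2 x))\<^sup>2)) \<partial>lebesgue)"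
    using int deriv by (intro integral_mono) auto
  also have "\<dots> = 3 / h\<^sup>2 * ((K\<^sup>2 + (norm z)\<^sup>2) * energy u v + energy f1 f2)"
    using int by simp
  also have "energy u v + \<dots> \<le> (1 + 3 * (1 + K\<^sup>2 + (norm z)\<^sup>2) / h\<^sup>2) * (energy u v + energy f1 f2)"
    using E0 h by (simp add: field_simps)
  finally show ?thesis by simp
qed

section \<open>Perturbation of solvable Dirac equations\<close>

lemma primitiveI_lebesgue:
  assumes "\<And>a b. a \<le> b \<Longrightarrow> integrable lebesgue (\<lambda>x. indicator {a..b} x *\<^sub>R g x)"
    and "\<And>a b. a \<le> b \<Longrightarrow> (\<integral>x. indicator {a..b} x *\<^sub>R g x \<partial>lebesgue) = F b - F a"
  shows "primitive F g"
  unfolding primitive_def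
proof (intro allI impI conjI)
  fix a b :: real assume ab: "a \<le> b"
  show *: "g absolutely_integrable_on {a..b}" using assms(1)[OF ab] by (simp add: set_integrable_def)
  show "(g has_integral (F b - F a)) {a..b}"
    using has_integral_set_lebesgue[OF *] assms(2)[OF ab] by (simp add: set_lebesgue_integral_def)
qed

lemma primitive_limit:
  assumes prim: "\<And>k. primitive (f k) (g k)"
    and f: "\<And>x. (\<lambda>k. f k x) \<longlonglongrightarrow> F x" and g: "\<And>x. (\<lambda>k. g k x) \<longlonglongrightarrow> G x"
    and dom: "\<And>k x. norm (g k x) \<le> w x" and w: "\<And>a b. integrable lebesgue (\<lambda>x. indicator {a..b} x * w x)"
  shows "primitive F G"
proof (rule primitiveI_lebesgue)
  fix a b :: real assume ab: "a \<le> b"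
  note P = primitive_lebesgue[OF prim ab]
  have lim: "AE x in lebesgue. (\<lambda>k. indicator {a..b} x *\<^sub>R g k x) \<longlonglongrightarrow> indicator {a..b} x *\<^sub>R G x"
    by (intro AE_I2 tendsto_intros g)
  have m: "(\<lambda>x. indicator {a..b} x *\<^sub>R g k x) \<in> borel_measurable lebesgue" for k
    using P(1) by (rule borel_measurable_integrable)
  have M: "(\<lambda>x. indicator {a..b} x *\<^sub>R G x) \<in> borel_measurable lebesgue"
    by (rule borel_measurable_LIMSEQ_metric[where f = "\<lambda>k x. indicator {a..b} x *\<^sub>R g k x", OF m]) (intro tendsto_intros g)
  have bd: "AE x in lebesgue. norm (indicator {a..b} x *\<^sub>R g k x) \<le> indicator {a..b} x * w x" for k
    using dom by (intro AE_I2) (auto simp: indicator_def)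
  show "integrable lebesgue (\<lambda>x. indicator {a..b} x *\<^sub>R G x)"
    by (rule integrable_dominated_convergence[OF M m w lim bd])
  have "(\<lambda>k. \<integral>x. indicator {a..b} x *\<^sub>R g k x \<partial>lebesgue) \<longlonglongrightarrow> (\<integral>x. indicator {a..b} x *\<^sub>R G x \<partial>lebesgue)"
    by (rule integral_dominated_convergence[OF M m w lim bd])
  moreover have "(\<lambda>k. f k b - f k a) \<longlonglongrightarrow> F b - F a" by (intro tendsto_intros f)
  ultimately show "(\<integral>x. indicator {a..b} x *\<^sub>R G x \<partial>lebesgue) = F b - F a"
    unfolding P(2) by (rule LIMSEQ_unique)
qed

lemma sqint_limit:
  assumes f: "\<And>k. sqint (f k)" and M: "\<And>k. (\<integral>x. (norm (f k x))\<^sup>2 \<partial>lebesgue) \<le> M"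
    and lim: "\<And>x. (\<lambda>k. f k x) \<longlonglongrightarrow> F x"
  shows "sqint F"
  unfolding sqint_def
proof
  note [measurable] = sqintD(1)[OF f]
  show F[measurable]: "F \<in> borel_measurable lebesgue"
    by (rule borel_measurable_LIMSEQ_metric[OF sqintD(1)[OF f] lim])
  have "(\<integral>\<^sup>+x. ennreal ((norm (F x))\<^sup>2) \<partial>lebesgue) = (\<integral>\<^sup>+x. liminf (\<lambda>k. ennreal ((norm (f k x))\<^sup>2)) \<partial>lebesgue)"
  proof (intro nn_integral_cong)
    fix x
    have "(\<lambda>k. ennreal ((norm (f k x))\<^sup>2)) \<longlonglongrightarrow> ennreal ((norm (F x))\<^sup>2)"
      by (intro tendsto_ennrealI tendsto_intros lim)
    then show "ennreal ((norm (F x))\<^sup>2) = liminf (\<lambda>k. ennreal ((norm (f k x))\<^sup>2))"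
      using lim_imp_Liminf[OF sequentially_bot] by metis
  qed
  also have "\<dots> \<le> liminf (\<lambda>k. \<integral>\<^sup>+x. ennreal ((norm (f k x))\<^sup>2) \<partial>lebesgue)"
    by (rule nn_integral_liminf) measurable
  also have "\<dots> \<le> liminf (\<lambda>k::nat. ennreal M)"
  proof (intro Liminf_mono always_eventually allI)
    fix k
    show "(\<integral>\<^sup>+x. ennreal ((norm (f k x))\<^sup>2) \<partial>lebesgue) \<le> ennreal M"
      using M[of k] by (subst nn_integral_eq_integral[OF sqintD(2)[OF f]]) (auto intro: ennreal_leI)
  qed
  also have "\<dots> < \<infinity>" by (simp add: Liminf_const)
  finally have "(\<integral>\<^sup>+x. ennreal (norm ((norm (F x))\<^sup>2)) \<partial>lebesgue) < \<infinity>" by simp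
  then show "integrable lebesgue (\<lambda>x. (norm (F x))\<^sup>2)"
    by (intro integrableI_bounded) measurable
qed

lemma dirac_solution_diff:
  assumes "dirac_solution h p q z f1 f2 u v" "dirac_solution h p q z g1 g2 u2 v2"
  shows "dirac_solution h p q z (\<lambda>x. f1 x - g1 x) (\<lambda>x. f2 x - g2 x) (\<lambda>x. u x - u2 x) (\<lambda>x. v x - v2 x)"
proof -
  have *: "primitive (\<lambda>x. u x - u2 x) (\<lambda>x. (f1 x + \<i> * q x * v x + z * u x) / (\<i> * h) - (g1 x + \<i> * q x * v2 x + z * u2 x) / (\<i> * h))"
    "primitive (\<lambda>x. v x - v2 x) (\<lambda>x. (\<i> * p x * u x - z * v x - f2 x) / (\<i> * h) - (\<i> * p x * u2 x - z * v2 x - g2 x) / (\<i> * h))"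
    using assms by (auto simp: dirac_solution_def intro: primitive_diff)
  then show ?thesis
    using assms unfolding dirac_solution_def diff_divide_distrib[symmetric]
    by (auto simp: sqint_diff algebra_simps)
qed

lemma energy_mult_bounded:
  assumes u: "sqint u" and v: "sqint v" and b: "b \<in> borel_measurable lebesgue" "c \<in> borel_measurable lebesgue"
    and \<eta>: "\<And>x. norm (b x) \<le> \<eta>" "\<And>x. norm (c x) \<le> \<eta>"
  shows "energy (\<lambda>x. b x * v x) (\<lambda>x. c x * u x) \<le> \<eta>\<^sup>2 * energy u v"
proof -
  have i: "integrable lebesgue (\<lambda>x. (norm (b x * v x))\<^sup>2)" "integrable lebesgue (\<lambda>x. (norm (c x * u x))\<^sup>2)"
    using sqint_mult_bounded[OF v b(1) \<eta>(1)] sqint_mult_bounded[OF u b(2) \<eta>(2)] by (auto dest: sqintD(2))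
  note iu = sqintD(2)[OF u] sqintD(2)[OF v]
  have "energy (\<lambda>x. b x * v x) (\<lambda>x. c x * u x) \<le> (\<integral>x. \<eta>\<^sup>2 * ((norm (u x))\<^sup>2 + (norm (v x))\<^sup>2) \<partial>lebesgue)"
  proof (rule integral_mono)
    fix x
    have "(norm (b x))\<^sup>2 * (norm (v x))\<^sup>2 \<le> \<eta>\<^sup>2 * (norm (v x))\<^sup>2" "(norm (c x))\<^sup>2 * (norm (u x))\<^sup>2 \<le> \<eta>\<^sup>2 * (norm (u x))\<^sup>2"
      using \<eta> by (auto intro!: mult_right_mono power_mono)
    then show "(norm (b x * v x))\<^sup>2 + (norm (c x * u x))\<^sup>2 \<le> \<eta>\<^sup>2 * ((norm (u x))\<^sup>2 + (norm (v x))\<^sup>2)"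
      by (simp add: norm_mult power_mult_distrib distrib_left)
  qed (use i iu in auto)
  also have "\<dots> = \<eta>\<^sup>2 * energy u v" by simp
  finally show ?thesis .
qed

lemma energy_nonneg: "energy u v \<ge> 0"
  by (intro Bochner_Integration.integral_nonneg) simp

lemma energy_add_le:
  assumes "sqint u" "sqint v" "sqint u2" "sqint v2"
  shows "energy (\<lambda>x. u x + u2 x) (\<lambda>x. v x + v2 x) \<le> 2 * energy u v + 2 * energy u2 v2"
proof -
  note i = assms[THEN sqintD(2)] sqintD(2)[OF sqint_add[OF assms(1,3)]] sqintD(2)[OF sqint_add[OF assms(2,4)]]
  have "energy (\<lambda>x. u x + u2 x) (\<lambda>x. v x + v2 x)
     \<le> (\<integral>x. 2 * ((norm (u x))\<^sup>2 + (norm (v x))\<^sup>2) + 2 * ((norm (u2 x))\<^sup>2 + (norm (v2 x))\<^sup>2) \<partial>lebesgue)"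
  proof (rule integral_mono)
    show "(norm (u x + u2 x))\<^sup>2 + (norm (v x + v2 x))\<^sup>2
       \<le> 2 * ((norm (u x))\<^sup>2 + (norm (v x))\<^sup>2) + 2 * ((norm (u2 x))\<^sup>2 + (norm (v2 x))\<^sup>2)" for x
      using norm_add_sq_le[of "u x" "u2 x"] norm_add_sq_le[of "v x" "v2 x"] by simp
  qed (use i in auto)
  also have "\<dots> = 2 * energy u v + 2 * energy u2 v2" using i by simp
  finally show ?thesis .
qed

text \<open>
  Iterate: solve the equation for the old potential with the change of the potential, applied to the previous iterate, moved to the
  right-hand side. The energy estimate makes the energies of the differences decrease by the factor \<open>1 / 4\<close>,
  and \<open>dirac_solution_sup_bound\<close> turns this into uniform convergence. The limit can thus be taken pointwise in
  the integrated equation, and completeness of the space of square integrable functions is replaced by the lemma of Fatou.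
\<close>

lemma perturbation_solvable:
  assumes h: "h > 0"
    and p0: "AC_loc p0" "\<And>x. norm (p0 x) \<le> K" and q0: "AC_loc q0" "\<And>x. norm (q0 x) \<le> K"
    and p1: "AC_loc p1" "\<And>x. norm (p1 x - p0 x) \<le> \<eta>" and q1: "AC_loc q1" "\<And>x. norm (q1 x - q0 x) \<le> \<eta>"
    and bound: "\<And>f1 f2 u v. sqint f1 \<Longrightarrow> sqint f2 \<Longrightarrow> dirac_solution h p0 q0 z f1 f2 u v \<Longrightarrow> energy u v \<le> A * energy f1 f2"
    and solv: "\<And>f1 f2. sqint f1 \<Longrightarrow> sqint f2 \<Longrightarrow> \<exists>u v. dirac_solution h p0 q0 z f1 f2 u v"
    and A: "A > 0" and small: "A * \<eta>\<^sup>2 \<le> 1 / 4" and f: "sqint f1" "sqint f2"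
  shows "\<exists>u v. dirac_solution h p1 q1 z f1 f2 u v"
proof -
  obtain G1 G2 where G: "\<And>f1 f2. sqint f1 \<Longrightarrow> sqint f2 \<Longrightarrow> dirac_solution h p0 q0 z f1 f2 (G1 f1 f2) (G2 f1 f2)"
    using solv by metis
  define b where "b x = \<i> * (q1 x - q0 x)" for x
  define c where "c x = - \<i> * (p1 x - p0 x)" for x
  have bm: "b \<in> borel_measurable lebesgue" "c \<in> borel_measurable lebesgue"
    unfolding b_def[abs_def] c_def[abs_def]
    using AC_loc_measurable[OF p0(1)] AC_loc_measurable[OF q0(1)] AC_loc_measurable[OF p1(1)] AC_loc_measurable[OF q1(1)] by auto
  have b\<eta>: "norm (b x) \<le> \<eta>" "norm (c x) \<le> \<eta>" for x using p1(2) q1(2) by (auto simp: b_def c_def norm_mult)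
  have \<eta>: "\<eta> \<ge> 0" using order_trans[OF norm_ge_zero b\<eta>(1)] .
  define X where "X = rec_nat ((\<lambda>_. 0, \<lambda>_. 0) :: (real \<Rightarrow> complex) \<times> (real \<Rightarrow> complex))
     (\<lambda>k y. (G1 (\<lambda>x. f1 x + b x * snd y x) (\<lambda>x. f2 x + c x * fst y x), G2 (\<lambda>x. f1 x + b x * snd y x) (\<lambda>x. f2 x + c x * fst y x)))"
  define U where "U k = fst (X k)" for k
  define V where "V k = snd (X k)" for k
  have U0: "U 0 = (\<lambda>_. 0)" "V 0 = (\<lambda>_. 0)" by (simp_all add: U_def V_def X_def)
  have US: "U (Suc k) = G1 (\<lambda>x. f1 x + b x * V k x) (\<lambda>x. f2 x + c x * U k x)"
    "V (Suc k) = G2 (\<lambda>x. f1 x + b x * V k x) (\<lambda>x. f2 x + c x * U k x)" for k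
    by (simp_all add: U_def V_def X_def)
  have UV: "sqint (U k) \<and> sqint (V k)" for k
  proof (induction k)
    case 0 show ?case by (simp add: U0 sqint_def)
  next
    case (Suc k)
    then have "dirac_solution h p0 q0 z (\<lambda>x. f1 x + b x * V k x) (\<lambda>x. f2 x + c x * U k x) (U (Suc k)) (V (Suc k))"
      unfolding US by (intro G sqint_add f sqint_mult_bounded[OF _ bm(1) b\<eta>(1)] sqint_mult_bounded[OF _ bm(2) b\<eta>(2)]) auto
    then show ?case by (simp add: dirac_solution_def)
  qed
  then have sU: "sqint (U k)" and sV: "sqint (V k)" for k by auto
  have rhs: "sqint (\<lambda>x. b x * V k x)" "sqint (\<lambda>x. c x * U k x)" for k
    by (intro sqint_mult_bounded[OF _ bm(1) b\<eta>(1)] sqint_mult_bounded[OF _ bm(2) b\<eta>(2)] sU sV)+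
  have sol: "dirac_solution h p0 q0 z (\<lambda>x. f1 x + b x * V k x) (\<lambda>x. f2 x + c x * U k x) (U (Suc k)) (V (Suc k))" for k
    unfolding US by (intro G sqint_add f rhs)
  define dU where "dU k x = U (Suc k) x - U k x" for k x
  define dV where "dV k x = V (Suc k) x - V k x" for k x
  have sd: "sqint (dU k)" "sqint (dV k)" for k
    unfolding dU_def[abs_def] dV_def[abs_def] by (intro sqint_diff sU sV)+
  have srd: "sqint (\<lambda>x. b x * dV k x)" "sqint (\<lambda>x. c x * dU k x)" for k
    by (intro sqint_mult_bounded[OF _ bm(1) b\<eta>(1)] sqint_mult_bounded[OF _ bm(2) b\<eta>(2)] sd)+
  have sold: "dirac_solution h p0 q0 z (\<lambda>x. b x * dV k x) (\<lambda>x. c x * dU k x) (dU (Suc k)) (dV (Suc k))" for k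
    using dirac_solution_diff[OF sol[of "Suc k"] sol[of k]]
    by (simp add: dU_def[abs_def] dV_def[abs_def] algebra_simps)
  have Ed: "energy (\<lambda>x. b x * dV k x) (\<lambda>x. c x * dU k x) \<le> \<eta>\<^sup>2 * energy (dU k) (dV k)" for k
    by (rule energy_mult_bounded[OF sd bm b\<eta>])
  have quarter: "A * (\<eta>\<^sup>2 * e) \<le> 1 / 4 * e" if "e \<ge> 0" for e
    using mult_right_mono[OF small that] by (simp add: mult.assoc)
  define E where "E = energy (dU 0) (dV 0)"
  have dec: "energy (dU k) (dV k) \<le> E * (1 / 4) ^ k" for k
  proof (induction k)
    case 0 show ?case by (simp add: E_def)
  next
    case (Suc k)
    have "energy (dU (Suc k)) (dV (Suc k)) \<le> A * energy (\<lambda>x. b x * dV k x) (\<lambda>x. c x * dU k x)"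
      by (rule bound[OF srd sold])
    also have "\<dots> \<le> A * (\<eta>\<^sup>2 * energy (dU k) (dV k))" using Ed A by (intro mult_left_mono) auto
    also have "\<dots> \<le> 1 / 4 * energy (dU k) (dV k)" by (rule quarter[OF energy_nonneg])
    also have "\<dots> \<le> 1 / 4 * (E * (1 / 4) ^ k)" using Suc by simp
    finally show ?case by simp
  qed
  define S where "S = 1 + 3 * (1 + K\<^sup>2 + (norm z)\<^sup>2) / h\<^sup>2"
  have S: "S \<ge> 0" using h by (simp add: S_def)
  have sup: "(norm (u x))\<^sup>2 + (norm (v x))\<^sup>2 \<le> S * (energy u v + energy g1 g2)"
    if "sqint g1" "sqint g2" "dirac_solution h p0 q0 z g1 g2 u v" for g1 g2 u v x
    unfolding S_def by (rule dirac_solution_sup_bound[OF h p0 q0 that])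
  \<comment> \<open>the square root of \<open>1 / 4\<close> makes the differences decrease like powers of \<open>1 / 2\<close> in the supremum norm\<close>
  define T where "T = sqrt (S * (1 + \<eta>\<^sup>2) * E)"
  have E0: "E \<ge> 0" unfolding E_def by (rule energy_nonneg)
  have T: "T \<ge> 0" "T\<^sup>2 = S * (1 + \<eta>\<^sup>2) * E" using S E0 by (auto simp: T_def)
  have dsup: "norm (dU (Suc k) x) \<le> T * (1 / 2) ^ k" "norm (dV (Suc k) x) \<le> T * (1 / 2) ^ k" for k x
  proof -
    have "(norm (dU (Suc k) x))\<^sup>2 + (norm (dV (Suc k) x))\<^sup>2
       \<le> S * (energy (dU (Suc k)) (dV (Suc k)) + energy (\<lambda>x. b x * dV k x) (\<lambda>x. c x * dU k x))"
      by (rule sup[OF srd sold])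
    also have "\<dots> \<le> S * (E * (1 / 4) ^ k + \<eta>\<^sup>2 * (E * (1 / 4) ^ k))"
    proof (intro mult_left_mono add_mono S)
      have "energy (dU (Suc k)) (dV (Suc k)) \<le> E * (1 / 4) ^ Suc k" by (rule dec)
      also have "\<dots> \<le> E * (1 / 4) ^ k" using E0 by (intro mult_left_mono power_decreasing) auto
      finally show "energy (dU (Suc k)) (dV (Suc k)) \<le> E * (1 / 4) ^ k" .
      show "energy (\<lambda>x. b x * dV k x) (\<lambda>x. c x * dU k x) \<le> \<eta>\<^sup>2 * (E * (1 / 4) ^ k)"
        using Ed[of k] dec[of k] by (meson mult_left_mono order_trans zero_le_power2)
    qed
    also have "\<dots> = (T * (1 / 2) ^ k)\<^sup>2"
    proof -
      have "((1 / 2) ^ k)\<^sup>2 = (1 / 4 :: real) ^ k" by (simp add: power_mult[symmetric] power_divide mult.commute[of k]) (simp add: power_mult)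
      then show ?thesis unfolding power_mult_distrib T(2) by (simp add: algebra_simps)
    qed
    finally have *: "(norm (dU (Suc k) x))\<^sup>2 + (norm (dV (Suc k) x))\<^sup>2 \<le> (T * (1 / 2) ^ k)\<^sup>2" .
    show "norm (dU (Suc k) x) \<le> T * (1 / 2) ^ k" "norm (dV (Suc k) x) \<le> T * (1 / 2) ^ k"
      using * T(1) by (auto intro!: power2_le_imp_le[of "norm _" "T * (1 / 2) ^ k"] intro: order_trans[rotated])
  qed
  have geo: "convergent (\<lambda>k. Y k) \<and> (\<forall>k. norm (Y (Suc k)) \<le> norm (Y 1) + 2 * T)"
    if Y: "\<And>k. norm (Y (Suc (Suc k)) - Y (Suc k)) \<le> T * (1 / 2) ^ k" for Y :: "nat \<Rightarrow> complex"
  proof -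
    have s: "summable (\<lambda>k. T * (1 / 2) ^ k)" by (intro summable_mult summable_geometric) simp
    have "(\<Sum>k. T * (1 / 2) ^ k) = T * 2" by (subst suminf_mult) (auto simp: suminf_geometric)
    then have part: "(\<Sum>k<n. T * (1 / 2) ^ k) \<le> 2 * T" for n
      using sum_le_suminf[OF s, of "{..<n}"] T(1) by simp
    have tel: "(\<Sum>k<n. Y (Suc (Suc k)) - Y (Suc k)) = Y (Suc n) - Y 1" for n
      using sum_lessThan_telescope[of "\<lambda>k. Y (Suc k)" n] by simp
    have "summable (\<lambda>k. Y (Suc (Suc k)) - Y (Suc k))"
      by (rule summable_comparison_test'[OF s]) (use Y in auto)
    then have "convergent (\<lambda>n. Y (Suc n) - Y 1)"
      unfolding summable_iff_convergent tel .
    then have "convergent (\<lambda>n. (Y (Suc n) - Y 1) + Y 1)" by (intro convergent_add convergent_const)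
    then have "convergent Y" by (simp add: convergent_Suc_iff)
    moreover have "norm (Y (Suc n)) \<le> norm (Y 1) + 2 * T" for n
    proof -
      have "norm (Y (Suc n) - Y 1) \<le> (\<Sum>k<n. T * (1 / 2) ^ k)"
        unfolding tel[symmetric] by (rule order_trans[OF norm_sum sum_mono[OF Y]])
      then show ?thesis using part[of n] norm_triangle_ineq2[of "Y (Suc n)" "Y 1"] by linarith
    qed
    ultimately show ?thesis by blast
  qed
  define u where "u x = lim (\<lambda>k. U k x)" for x
  define v where "v x = lim (\<lambda>k. V k x)" for x
  have conv: "convergent (\<lambda>k. U k x)" "convergent (\<lambda>k. V k x)"
    and bd1: "norm (U (Suc k) x) \<le> norm (U 1 x) + 2 * T" "norm (V (Suc k) x) \<le> norm (V 1 x) + 2 * T" for x k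
    using geo[of "\<lambda>k. U k x"] geo[of "\<lambda>k. V k x"] dsup[of _ x] by (auto simp: dU_def dV_def)
  have limU: "(\<lambda>k. U k x) \<longlonglongrightarrow> u x" and limV: "(\<lambda>k. V k x) \<longlonglongrightarrow> v x" for x
    unfolding u_def v_def using conv by (auto simp: convergent_LIMSEQ_iff)
  obtain Q where Q: "Q \<ge> 0" "\<And>k x. norm (U k x) \<le> Q" "\<And>k x. norm (V k x) \<le> Q"
  proof -
    define L where "L = sqrt (S * (energy (U 1) (V 1) + energy f1 f2))"
    have L: "norm (U 1 x) \<le> L" "norm (V 1 x) \<le> L" for x
    proof -
      have "dirac_solution h p0 q0 z f1 f2 (U 1) (V 1)" using sol[of 0] by (simp add: U0)
      from sup[OF f this, of x] show "norm (U 1 x) \<le> L" "norm (V 1 x) \<le> L"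
        unfolding L_def by (auto intro!: real_le_rsqrt intro: order_trans[rotated])
    qed
    have L0: "L \<ge> 0" using L(1)[of 0] norm_ge_zero order_trans by blast
    show ?thesis
    proof (rule that[of "L + 2 * T"])
      show "L + 2 * T \<ge> 0" using L0 T by simp
      show "norm (U k x) \<le> L + 2 * T" "norm (V k x) \<le> L + 2 * T" for k x
      proof -
        show "norm (U k x) \<le> L + 2 * T"
        proof (cases k)
          case 0 then show ?thesis using L0 T(1) by (simp add: U0)
        next
          case (Suc j) then show ?thesis using bd1(1)[of j x] L(1)[of x] by simp
        qed
        show "norm (V k x) \<le> L + 2 * T"
        proof (cases k)
          case 0 then show ?thesis using L0 T(1) by (simp add: U0)
        next
          case (Suc j) then show ?thesis using bd1(2)[of j x] L(2)[of x] by simp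
        qed
      qed
    qed
  qed
  define M where "M = 4 * A * energy f1 f2"
  have EM: "energy (U k) (V k) \<le> M" for k
  proof (induction k)
    case 0 show ?case using A energy_nonneg[of f1 f2] by (simp add: U0 M_def)
  next
    case (Suc k)
    have "energy (U (Suc k)) (V (Suc k)) \<le> A * energy (\<lambda>x. f1 x + b x * V k x) (\<lambda>x. f2 x + c x * U k x)"
      by (rule bound[OF _ _ sol]) (intro sqint_add f rhs)+
    also have "\<dots> \<le> A * (2 * energy f1 f2 + 2 * (\<eta>\<^sup>2 * energy (U k) (V k)))"
      using A energy_add_le[OF f rhs[of k]] energy_mult_bounded[OF sU[of k] sV[of k] bm b\<eta>]
      by (intro mult_left_mono) auto
    also have "\<dots> = 2 * A * energy f1 f2 + 2 * (A * (\<eta>\<^sup>2 * energy (U k) (V k)))" by (simp add: algebra_simps)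
    also have "\<dots> \<le> 2 * A * energy f1 f2 + 2 * (1 / 4 * energy (U k) (V k))"
      using quarter[OF energy_nonneg, of "U k" "V k"] by simp
    also have "\<dots> \<le> M" using Suc A energy_nonneg[of f1 f2] by (simp add: M_def)
    finally show ?case .
  qed
  have "(\<integral>x. (norm (U k x))\<^sup>2 \<partial>lebesgue) \<le> M" "(\<integral>x. (norm (V k x))\<^sup>2 \<partial>lebesgue) \<le> M" for k
  proof -
    have "(\<integral>x. (norm (U k x))\<^sup>2 \<partial>lebesgue) \<le> energy (U k) (V k)" "(\<integral>x. (norm (V k x))\<^sup>2 \<partial>lebesgue) \<le> energy (U k) (V k)"
      using sqintD(2)[OF sU] sqintD(2)[OF sV] by (auto intro!: integral_mono)
    then show "(\<integral>x. (norm (U k x))\<^sup>2 \<partial>lebesgue) \<le> M" "(\<integral>x. (norm (V k x))\<^sup>2 \<partial>lebesgue) \<le> M"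
      using EM[of k] by linarith+
  qed
  then have uv: "sqint u" "sqint v"
    by (auto intro: sqint_limit[OF sU _ limU] sqint_limit[OF sV _ limV])
  have localint: "integrable lebesgue (\<lambda>x. indicator {a..d} x * ((norm (g x) + B) / h))" if g: "sqint g" for g a d B
  proof -
    have ind: "integrable lebesgue (indicat_real {a..d})"
      by (intro integrable_real_indicator) (auto simp: emeasure_lborel_Icc_eq)
    have "integrable lebesgue (\<lambda>x. indicator {a..d} x * norm (g x))"
    proof (rule Bochner_Integration.integrable_bound)
      show "integrable lebesgue (\<lambda>x. indicator {a..d} x + (norm (g x))\<^sup>2)"
        using sqintD(2)[OF g] ind by (rule Bochner_Integration.integrable_add[rotated])
      show "(\<lambda>x. indicator {a..d} x * norm (g x)) \<in> borel_measurable lebesgue"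
        using borel_measurable_integrable[OF ind] sqintD(1)[OF g]
        by (intro borel_measurable_times) auto
      have "t \<le> 1 + t\<^sup>2" if "t \<ge> 0" for t :: real using sum_squares_bound[of t 1] that by simp
      then show "AE x in lebesgue. norm (indicator {a..d} x * norm (g x)) \<le> norm (indicator {a..d} x + (norm (g x))\<^sup>2)"
        by (intro AE_I2) (auto simp: indicator_def)
    qed
    moreover have "integrable lebesgue (\<lambda>x. indicator {a..d} x * B)" using ind by simp
    ultimately have "integrable lebesgue (\<lambda>x. (indicator {a..d} x * norm (g x) + indicator {a..d} x * B) / h)" by simp
    then show ?thesis by (simp add: algebra_simps)
  qed
  have "primitive u (\<lambda>x. (f1 x + \<i> * q1 x * v x + z * u x) / (\<i> * h))"
  proof (rule primitive_limit)
    show "primitive (U (Suc k)) (\<lambda>x. (f1 x + b x * V k x + \<i> * q0 x * V (Suc k) x + z * U (Suc k) x) / (\<i> * h))" for k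
      using sol[of k] by (simp add: dirac_solution_def)
    show "(\<lambda>k. U (Suc k) x) \<longlonglongrightarrow> u x" for x using limU by (rule LIMSEQ_Suc)
    have eq: "f1 x + b x * v x + \<i> * q0 x * v x + z * u x = f1 x + \<i> * q1 x * v x + z * u x" for x
      by (simp add: b_def algebra_simps)
    show "(\<lambda>k. (f1 x + b x * V k x + \<i> * q0 x * V (Suc k) x + z * U (Suc k) x) / (\<i> * h))
       \<longlonglongrightarrow> (f1 x + \<i> * q1 x * v x + z * u x) / (\<i> * h)" for x
      unfolding eq[symmetric] using h by (intro tendsto_intros limV LIMSEQ_Suc[OF limV] LIMSEQ_Suc[OF limU]) auto
    show "norm ((f1 x + b x * V k x + \<i> * q0 x * V (Suc k) x + z * U (Suc k) x) / (\<i> * h)) \<le> (norm (f1 x) + (\<eta> * Q + K * Q + norm z * Q)) / h" for k x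
    proof -
      have "norm (f1 x + b x * V k x + \<i> * q0 x * V (Suc k) x + z * U (Suc k) x) \<le> norm (f1 x) + \<eta> * Q + K * Q + norm z * Q"
        using Q b\<eta> q0(2) \<eta> order_trans[OF norm_ge_zero q0(2)]
        by (intro norm_triangle_mono) (auto simp: norm_mult intro!: mult_mono)
      then show ?thesis using h by (simp add: norm_divide norm_mult divide_right_mono add.assoc)
    qed
    show "integrable lebesgue (\<lambda>x. indicator {a..d} x * ((norm (f1 x) + (\<eta> * Q + K * Q + norm z * Q)) / h))" for a d
      by (rule localint[OF f(1)])
  qed
  moreover have "primitive v (\<lambda>x. (\<i> * p1 x * u x - z * v x - f2 x) / (\<i> * h))"
  proof (rule primitive_limit)
    show "primitive (V (Suc k)) (\<lambda>x. (\<i> * p0 x * U (Suc k) x - z * V (Suc k) x - (f2 x + c x * U k x)) / (\<i> * h))" for k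
      using sol[of k] by (simp add: dirac_solution_def)
    show "(\<lambda>k. V (Suc k) x) \<longlonglongrightarrow> v x" for x using limV by (rule LIMSEQ_Suc)
    have eq: "\<i> * p0 x * u x - z * v x - (f2 x + c x * u x) = \<i> * p1 x * u x - z * v x - f2 x" for x
      by (simp add: c_def algebra_simps)
    show "(\<lambda>k. (\<i> * p0 x * U (Suc k) x - z * V (Suc k) x - (f2 x + c x * U k x)) / (\<i> * h))
       \<longlonglongrightarrow> (\<i> * p1 x * u x - z * v x - f2 x) / (\<i> * h)" for x
      unfolding eq[symmetric] using h by (intro tendsto_intros limU LIMSEQ_Suc[OF limV] LIMSEQ_Suc[OF limU]) auto
    show "norm ((\<i> * p0 x * U (Suc k) x - z * V (Suc k) x - (f2 x + c x * U k x)) / (\<i> * h)) \<le> (norm (f2 x) + (\<eta> * Q + K * Q + norm z * Q)) / h" for k x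
    proof -
      have "norm (\<i> * p0 x * U (Suc k) x - z * V (Suc k) x - (f2 x + c x * U k x)) \<le> K * Q + norm z * Q + (norm (f2 x) + \<eta> * Q)"
        using Q b\<eta> p0(2) \<eta> order_trans[OF norm_ge_zero p0(2)]
        by (intro norm_triangle_le_diff norm_triangle_mono add_mono order_trans[OF norm_triangle_ineq4] norm_triangle_le) (auto simp: norm_mult intro!: mult_mono add_mono)
      then show ?thesis using h by (simp add: norm_divide norm_mult divide_right_mono add.assoc algebra_simps)
    qed
    show "integrable lebesgue (\<lambda>x. indicator {a..d} x * ((norm (f2 x) + (\<eta> * Q + K * Q + norm z * Q)) / h))" for a d
      by (rule localint[OF f(2)])
  qed
  ultimately show ?thesis using uv unfolding dirac_solution_def by blast
qed

section \<open>The free equation\<close>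

lemma exponential_tail_right:
  fixes a x :: real
  assumes a: "a > 0"
  shows "integrable lebesgue (\<lambda>y. indicator {x..} y * exp (a * (x - y)))" (is "integrable _ ?f")
    and "(\<integral>y. indicator {x..} y * exp (a * (x - y)) \<partial>lebesgue) = 1 / a"
proof -
  have "((\<lambda>y. exp (a * x) * exp (- a * y)) has_integral (exp (a * x) * (exp (- a * x) / a))) {x..}"
    using has_integral_exp_minus_to_infinity[OF a, of x] by (intro has_integral_mult_right) auto
  then have I: "((\<lambda>y. exp (a * (x - y))) has_integral (1 / a)) {x..}"
    by (simp add: exp_add[symmetric] exp_minus right_diff_distrib)
      (simp add: exp_diff exp_minus field_simps)
  then have S: "(\<lambda>y. exp (a * (x - y))) absolutely_integrable_on {x..}"
    by (intro nonnegative_absolutely_integrable_1) (auto simp: integrable_on_def)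
  show "integrable lebesgue ?f" using S by (simp add: set_integrable_def)
  show "(\<integral>y. indicator {x..} y * exp (a * (x - y)) \<partial>lebesgue) = 1 / a"
    using set_lebesgue_integral_eq_integral(2)[OF S] I
    by (simp add: set_lebesgue_integral_def integral_unique)
qed

lemma exponential_tail_left:
  fixes a x :: real
  assumes a: "a > 0"
  shows "integrable lebesgue (\<lambda>y. indicator {..x} y * exp (a * (y - x)))"
    and "(\<integral>y. indicator {..x} y * exp (a * (y - x)) \<partial>lebesgue) = 1 / a"
proof -
  let ?f = "\<lambda>y. indicator {x..} y * exp (a * (x - y)) :: real"
  have reflect: "?f (2 * x + (- 1) * y) = indicator {..x} y * exp (a * (y - x))" for y
    by (auto simp: indicator_def algebra_simps)
  have bm: "?f \<in> borel_measurable lborel" "(\<lambda>y. indicator {..x} y * exp (a * (y - x))) \<in> borel_measurable lborel" by measurable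
  have "integrable lborel ?f" using exponential_tail_right(1)[OF a, of x] bm by (simp add: integrable_completion)
  then have "integrable lborel (\<lambda>y. ?f (2 * x + (- 1) * y))" by (subst lborel_integrable_real_affine_iff) auto
  then show "integrable lebesgue (\<lambda>y. indicator {..x} y * exp (a * (y - x)))"
    unfolding reflect using bm by (simp add: integrable_completion)
  have "(\<integral>y. ?f y \<partial>lborel) = \<bar>- 1\<bar> *\<^sub>R (\<integral>y. ?f (2 * x + (- 1) * y) \<partial>lborel)"
    by (rule lborel_integral_real_affine) simp
  then have "(\<integral>y. indicator {..x} y * exp (a * (y - x)) \<partial>lborel) = (\<integral>y. ?f y \<partial>lborel)" unfolding reflect by simp
  also have "\<dots> = 1 / a" using exponential_tail_right(2)[OF a, of x] bm by (simp add: integral_completion)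
  finally show "(\<integral>y. indicator {..x} y * exp (a * (y - x)) \<partial>lebesgue) = 1 / a"
    using bm by (simp add: integral_completion)
qed

lemma has_vector_derivative_exp_linear:
  "((\<lambda>x. exp (l * complex_of_real x)) has_vector_derivative l * exp (l * complex_of_real x)) (at x)"
proof -
  have "((\<lambda>y. exp (l * y)) has_field_derivative l * exp (l * of_real x)) (at (of_real x))"
    by (auto intro!: derivative_eq_intros)
  then show ?thesis by (rule has_vector_derivative_real_field)
qed

lemma AC_loc_exp: "AC_loc (\<lambda>x. exp (l * complex_of_real x))"
proof (rule primitive_imp_AC_loc[where g = "\<lambda>x. l * exp (l * complex_of_real x)"], unfold primitive_def, intro allI impI conjI)
  fix a b :: real assume ab: "a \<le> b"
  show "(\<lambda>x. l * exp (l * complex_of_real x)) absolutely_integrable_on {a..b}"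
    by (intro absolutely_integrable_continuous_real continuous_intros)
  show "((\<lambda>x. l * exp (l * complex_of_real x)) has_integral (exp (l * of_real b) - exp (l * of_real a))) {a..b}"
  proof (rule fundamental_theorem_of_calculus[OF ab])
    fix x :: real
    show "((\<lambda>x. exp (l * complex_of_real x)) has_vector_derivative l * exp (l * of_real x)) (at x within {a..b})"
      by (rule has_vector_derivative_at_within[OF has_vector_derivative_exp_linear])
  qed
qed

text \<open>
  Square integrability from an energy argument instead of the convolution inequality: the real part of the derivative of
  \<open>(norm (u x))\<^sup>2\<close>, with the sign of \<open>Re l\<close>, dominates \<open>\<bar>Re l\<bar> (norm (u x))\<^sup>2\<close> up to
  \<open>(norm (g x))\<^sup>2 / \<bar>Re l\<bar>\<close>, and the boundary terms are bounded.
\<close>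

lemma bounded_solution_sqint:
  assumes a: "Re l \<noteq> 0" and g: "sqint g" and prim: "primitive u (\<lambda>x. l * u x + g x)" and B: "\<And>x. norm (u x) \<le> B"
  shows "sqint u"
proof -
  define c where "c = \<bar>Re l\<bar>"
  define s where "s = sgn (Re l)"
  have c: "c > 0" using a by (simp add: c_def)
  have s: "s * Re l = c" "\<bar>s\<bar> = 1" using a by (auto simp: s_def c_def sgn_if)
  have AC: "AC_loc u" by (rule primitive_imp_AC_loc[OF prim])
  define H where "H x = u x * cnj (u x)" for x
  define H' where "H' x = (l * u x + g x) * cnj (u x) + u x * cnj (l * u x + g x)" for x
  have H: "primitive H H'"
    unfolding H_def[abs_def] H'_def[abs_def] by (rule primitive_norm_squared[OF prim])
  have HB: "\<bar>Re (H x)\<bar> \<le> B\<^sup>2" for x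
  proof -
    have "\<bar>Re (H x)\<bar> \<le> (norm (u x))\<^sup>2"
      using abs_Re_le_cmod[of "H x"] by (simp add: H_def norm_mult power2_eq_square)
    also have "\<dots> \<le> B\<^sup>2" using B by (intro power_mono) auto
    finally show ?thesis .
  qed
  have pw: "c * (norm (u x))\<^sup>2 \<le> s * Re (H' x) + (norm (g x))\<^sup>2 / c" for x
  proof -
    have "Re (H' x) = 2 * Re l * (norm (u x))\<^sup>2 + 2 * Re (g x * cnj (u x))"
      by (simp add: H'_def cmod_power2) (simp add: power2_eq_square algebra_simps)
    then have 1: "s * Re (H' x) = 2 * c * (norm (u x))\<^sup>2 + 2 * (s * Re (g x * cnj (u x)))"
      using s(1) by (simp add: algebra_simps)
    have "\<bar>s * Re (g x * cnj (u x))\<bar> \<le> norm (g x) * norm (u x)"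
      using abs_Re_le_cmod[of "g x * cnj (u x)"] s(2) by (simp add: abs_mult norm_mult)
    then have "- (s * Re (g x * cnj (u x))) \<le> norm (g x) * norm (u x)" by linarith
    moreover have "2 * (norm (g x) * norm (u x)) \<le> c * (norm (u x))\<^sup>2 + (norm (g x))\<^sup>2 / c"
    proof -
      have "0 \<le> (c * norm (u x) - norm (g x))\<^sup>2 / c" using c by simp
      also have "\<dots> = c * (norm (u x))\<^sup>2 + (norm (g x))\<^sup>2 / c - 2 * (norm (g x) * norm (u x))"
        using c by (simp add: power2_eq_square field_simps)
      finally show ?thesis by simp
    qed
    ultimately show ?thesis using 1 by linarith
  qed
  \<comment> \<open>the truncations have uniformly bounded norms, so Fatou applies\<close>
  define T where "T n x = indicator {- real n..real n} x *\<^sub>R u x" for n x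
  define M where "M = (2 * B\<^sup>2 + (\<integral>x. (norm (g x))\<^sup>2 \<partial>lebesgue) / c) / c"
  have um: "u \<in> borel_measurable lebesgue" by (rule AC_loc_measurable[OF AC])
  note gi = sqintD(2)[OF g]
  have T: "sqint (T n)" "(\<integral>x. (norm (T n x))\<^sup>2 \<partial>lebesgue) \<le> M" for n
  proof -
    have Tm: "T n \<in> borel_measurable lebesgue" unfolding T_def[abs_def] using um by (intro borel_measurable_scaleR) (auto intro!: borel_measurable_indicator)
    have ind: "integrable lebesgue (indicat_real {- real n..real n})"
      by (intro integrable_real_indicator) (auto simp: emeasure_lborel_Icc_eq)
    show Tn: "sqint (T n)" unfolding sqint_def
    proof
      show "T n \<in> borel_measurable lebesgue" by (rule Tm)
      show "integrable lebesgue (\<lambda>x. (norm (T n x))\<^sup>2)"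
      proof (rule Bochner_Integration.integrable_bound)
        show "integrable lebesgue (\<lambda>x. B\<^sup>2 * indicat_real {- real n..real n} x)" using ind by (rule integrable_mult_right)
        show "(\<lambda>x. (norm (T n x))\<^sup>2) \<in> borel_measurable lebesgue" using Tm by auto
        show "AE x in lebesgue. norm ((norm (T n x))\<^sup>2) \<le> norm (B\<^sup>2 * indicat_real {- real n..real n} x)"
          using B by (intro AE_I2) (auto simp: T_def indicator_def intro: power_mono)
      qed
    qed
    have le: "- real n \<le> real n" by simp
    note P = primitive_lebesgue[OF H le]
    have iR: "integrable lebesgue (\<lambda>x. Re (indicator {- real n..real n} x *\<^sub>R H' x))" by (rule integrable_Re[OF P(1)])
    have "c * (\<integral>x. (norm (T n x))\<^sup>2 \<partial>lebesgue) = (\<integral>x. c * (norm (T n x))\<^sup>2 \<partial>lebesgue)" by simp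
    also have "\<dots> \<le> (\<integral>x. s * Re (indicator {- real n..real n} x *\<^sub>R H' x) + (norm (g x))\<^sup>2 / c \<partial>lebesgue)"
    proof (rule integral_mono)
      show "integrable lebesgue (\<lambda>x. s * Re (indicator {- real n..real n} x *\<^sub>R H' x) + (norm (g x))\<^sup>2 / c)"
        using iR gi by (intro Bochner_Integration.integrable_add integrable_mult_right) auto
      show "c * (norm (T n x))\<^sup>2 \<le> s * Re (indicator {- real n..real n} x *\<^sub>R H' x) + (norm (g x))\<^sup>2 / c" for x
        using pw[of x] c by (auto simp: T_def indicator_def)
    qed (use sqintD(2)[OF Tn] in auto)
    also have "\<dots> = s * (\<integral>x. Re (indicator {- real n..real n} x *\<^sub>R H' x) \<partial>lebesgue) + (\<integral>x. (norm (g x))\<^sup>2 \<partial>lebesgue) / c"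
      using iR gi by (subst Bochner_Integration.integral_add) (auto intro!: integrable_mult_right)
    also have "(\<integral>x. Re (indicator {- real n..real n} x *\<^sub>R H' x) \<partial>lebesgue) = Re (H (real n) - H (- real n))"
      unfolding P(2)[symmetric] by (rule integral_Re[OF P(1)])
    also have "s * Re (H (real n) - H (- real n)) \<le> 2 * B\<^sup>2"
    proof -
      have "s * Re (H (real n) - H (- real n)) \<le> \<bar>s\<bar> * \<bar>Re (H (real n) - H (- real n))\<bar>"
        by (metis abs_ge_self abs_mult)
      then show ?thesis using s(2) HB[of "real n"] HB[of "- real n"] by simp
    qed
    finally show "(\<integral>x. (norm (T n x))\<^sup>2 \<partial>lebesgue) \<le> M" using c by (simp add: M_def field_simps)
  qed
  show ?thesis
  proof (rule sqint_limit[OF T])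
    fix x
    obtain n0 :: nat where n0: "\<bar>x\<bar> < real n0" using reals_Archimedean2 by blast
    have "T n x = u x" if "n \<ge> n0" for n
    proof -
      have "- real n \<le> x" "x \<le> real n" using n0 that by linarith+
      then show ?thesis by (simp add: T_def)
    qed
    then show "(\<lambda>n. T n x) \<longlonglongrightarrow> u x"
      by (intro tendsto_eventually eventually_mono[OF eventually_ge_at_top[of n0]])
  qed
qed

text \<open>
  Variation of constants, integrating over the half-line \<open>S x\<close> on which \<open>exp (l (x - y))\<close> decays: to the right
  of \<open>x\<close> if \<open>Re l > 0\<close>, to its left if \<open>Re l < 0\<close>. The sign \<open>s\<close> turns the
  integral over \<open>S x\<close> into a primitive of its integrand.
\<close>

lemma tail_integral_solution:
  assumes a: "Re l \<noteq> 0" and g: "sqint g" and sets: "\<And>x. S x \<in> sets lebesgue"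
    and tail: "\<And>x. integrable lebesgue (\<lambda>y. indicator (S x) y * exp (2 * Re l * (x - y)))"
      "\<And>x. (\<integral>y. indicator (S x) y * exp (2 * Re l * (x - y)) \<partial>lebesgue) = B"
    and split: "\<And>x x'. x \<le> x' \<Longrightarrow> AE y in lebesgue. indicator {x..x'} y = s * (indicator (S x') y - indicator (S x) y :: real)"
    and s: "\<bar>s\<bar> = 1"
  shows "\<exists>u. sqint u \<and> primitive u (\<lambda>x. l * u x + g x)"
proof -
  define G where "G y = exp (- l * complex_of_real y) * g y" for y
  have ex: "exp (l * complex_of_real x) * exp (- l * complex_of_real y) = exp (l * complex_of_real (x - y))" for x y
    by (simp add: exp_add[symmetric] algebra_simps)
  have nex: "norm (exp (l * complex_of_real t)) = exp (Re l * t)" for t by simp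
  have Gm: "G \<in> borel_measurable lebesgue"
    unfolding G_def[abs_def] using AC_loc_measurable[OF AC_loc_exp, of "- l"] sqintD(1)[OF g] by (intro borel_measurable_times) auto
  have dom: "norm (exp (l * complex_of_real x) * (indicator (S x) y *\<^sub>R G y))
      \<le> (indicator (S x) y * exp (2 * Re l * (x - y)) + (norm (g y))\<^sup>2) / 2" for x y
  proof -
    have "norm (exp (l * complex_of_real x) * G y) = exp (Re l * (x - y)) * norm (g y)"
      unfolding G_def mult.assoc[symmetric] ex norm_mult nex ..
    also have "\<dots> \<le> ((exp (Re l * (x - y)))\<^sup>2 + (norm (g y))\<^sup>2) / 2"
      using sum_squares_bound[of "exp (Re l * (x - y))" "norm (g y)"] by simp
    also have "(exp (Re l * (x - y)))\<^sup>2 = exp (2 * Re l * (x - y))"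
      by (simp add: power2_eq_square exp_add[symmetric])
    finally show ?thesis by (auto simp: indicator_def)
  qed
  note gi = sqintD(2)[OF g]
  have int: "integrable lebesgue (\<lambda>y. exp (l * complex_of_real x) * (indicator (S x) y *\<^sub>R G y))" for x
  proof (rule Bochner_Integration.integrable_bound)
    show "integrable lebesgue (\<lambda>y. (indicator (S x) y * exp (2 * Re l * (x - y)) + (norm (g y))\<^sup>2) / 2)"
      using tail(1) gi by simp
    show "(\<lambda>y. exp (l * complex_of_real x) * (indicator (S x) y *\<^sub>R G y)) \<in> borel_measurable lebesgue"
      using Gm sets by (intro borel_measurable_times borel_measurable_scaleR) auto
    show "AE y in lebesgue. norm (exp (l * complex_of_real x) * (indicator (S x) y *\<^sub>R G y))
       \<le> norm ((indicator (S x) y * exp (2 * Re l * (x - y)) + (norm (g y))\<^sup>2) / 2)"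
      using dom by (intro AE_I2) (auto intro: order_trans)
  qed
  have intG: "integrable lebesgue (\<lambda>y. indicator (S x) y *\<^sub>R G y)" for x
    using integrable_mult_right[OF int[of x], of "exp (- l * complex_of_real x)"]
    by (simp add: mult.assoc[symmetric] exp_minus)
  define F where "F x = s *\<^sub>R (\<integral>y. indicator (S x) y *\<^sub>R G y \<partial>lebesgue)" for x
  have F: "primitive F G"
  proof (rule primitiveI_lebesgue)
    fix b c :: real assume bc: "b \<le> c"
    have ae: "AE y in lebesgue. s *\<^sub>R (indicator (S c) y *\<^sub>R G y - indicator (S b) y *\<^sub>R G y) = indicator {b..c} y *\<^sub>R G y"
      using split[OF bc] by eventually_elim (simp add: scaleR_diff_left scaleR_diff_right right_diff_distrib)
    have i: "integrable lebesgue (\<lambda>y. s *\<^sub>R (indicator (S c) y *\<^sub>R G y - indicator (S b) y *\<^sub>R G y))"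
      using intG by (intro integrable_scaleR_right Bochner_Integration.integrable_diff)
    have m: "(\<lambda>y. indicator {b..c} y *\<^sub>R G y) \<in> borel_measurable lebesgue" using Gm by (intro borel_measurable_scaleR) (auto intro!: borel_measurable_indicator)
    show "integrable lebesgue (\<lambda>y. indicator {b..c} y *\<^sub>R G y)"
      using integrable_cong_AE[OF borel_measurable_integrable[OF i] m ae] i by simp
    have "(\<integral>y. s *\<^sub>R (indicator (S c) y *\<^sub>R G y - indicator (S b) y *\<^sub>R G y) \<partial>lebesgue) = F c - F b"
      by (simp only: integral_scaleR_right Bochner_Integration.integral_diff[OF intG intG] F_def)
        (simp only: scaleR_diff_right)
    then show "(\<integral>y. indicator {b..c} y *\<^sub>R G y \<partial>lebesgue) = F c - F b"
      using integral_cong_AE[OF borel_measurable_integrable[OF i] m ae] by simp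
  qed
  define u where "u x = exp (l * complex_of_real x) * F x" for x
  have prim: "primitive u (\<lambda>x. l * u x + g x)"
  proof (rule primitive_of_AE_derivative)
    show "AC_loc u" unfolding u_def by (intro AC_loc_mult AC_loc_exp primitive_imp_AC_loc[OF F])
    show "AE x in lebesgue. (u has_vector_derivative l * u x + g x) (at x)"
      using primitive_AE_has_vector_derivative[OF F]
    proof eventually_elim
      case (elim x)
      from has_vector_derivative_mult[OF has_vector_derivative_exp_linear elim]
      have "(u has_vector_derivative exp (l * of_real x) * G x + l * exp (l * of_real x) * F x) (at x)"
        unfolding u_def[abs_def] .
      moreover have "exp (l * of_real x) * G x = g x"
        unfolding G_def mult.assoc[symmetric] ex by simp
      ultimately show ?case by (simp add: u_def algebra_simps)
    qed
  qed
  have "norm (u x) \<le> (B + (\<integral>y. (norm (g y))\<^sup>2 \<partial>lebesgue)) / 2" for x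
  proof -
    have "u x = s *\<^sub>R (\<integral>y. exp (l * complex_of_real x) * (indicator (S x) y *\<^sub>R G y) \<partial>lebesgue)"
      by (simp only: u_def F_def integral_mult_right_zero) (simp only: mult_scaleR_right)
    then have "norm (u x) = norm (\<integral>y. exp (l * complex_of_real x) * (indicator (S x) y *\<^sub>R G y) \<partial>lebesgue)"
      using s by simp
    also have "\<dots> \<le> (\<integral>y. (indicator (S x) y * exp (2 * Re l * (x - y)) + (norm (g y))\<^sup>2) / 2 \<partial>lebesgue)"
      using int tail(1) gi dom by (intro Bochner_Integration.integral_norm_bound_integral) auto
    also have "\<dots> = (B + (\<integral>y. (norm (g y))\<^sup>2 \<partial>lebesgue)) / 2"
      using tail gi by simp
    finally show ?thesis .
  qed
  from bounded_solution_sqint[OF a g prim this] prim show ?thesis by blast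
qed

lemma scalar_equation_solvable:
  assumes a: "Re l \<noteq> 0" and g: "sqint g"
  shows "\<exists>u. sqint u \<and> primitive u (\<lambda>x. l * u x + g x)"
proof (cases "Re l > 0")
  case True
  show ?thesis
  proof (rule tail_integral_solution[OF a g, where S = "\<lambda>x. {x..}" and s = "- 1" and B = "1 / (2 * Re l)"])
    show "integrable lebesgue (\<lambda>y. indicator {x..} y * exp (2 * Re l * (x - y)))"
      "(\<integral>y. indicator {x..} y * exp (2 * Re l * (x - y)) \<partial>lebesgue) = 1 / (2 * Re l)" for x
      using exponential_tail_right[of "2 * Re l" x] True by auto
    fix x x' :: real assume "x \<le> x'"
    then show "AE y in lebesgue. indicator {x..x'} y = - 1 * (indicator {x'..} y - indicator {x..} y :: real)"
      by (intro AE_I'[of "{x'}"]) (auto simp: indicator_def)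
  qed auto
next
  case False
  then have neg: "- Re l > 0" using a by simp
  have eq: "2 * - Re l * (y - x) = 2 * Re l * (x - y)" for x y by (simp add: algebra_simps)
  show ?thesis
  proof (rule tail_integral_solution[OF a g, where S = "\<lambda>x. {..x}" and s = 1 and B = "1 / (2 * - Re l)"])
    show "integrable lebesgue (\<lambda>y. indicator {..x} y * exp (2 * Re l * (x - y)))"
      "(\<integral>y. indicator {..x} y * exp (2 * Re l * (x - y)) \<partial>lebesgue) = 1 / (2 * - Re l)" for x
      using exponential_tail_left[of "2 * - Re l" x] neg unfolding eq by auto
    fix x x' :: real assume "x \<le> x'"
    then show "AE y in lebesgue. indicator {x..x'} y = 1 * (indicator {..x'} y - indicator {..x} y :: real)"
      by (intro AE_I'[of "{x}"]) (auto simp: indicator_def)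
  qed auto
qed

text \<open>
  Without potential the two components satisfy scalar equations with coefficients \<open>\<plusminus> z / (\<i> h)\<close>, whose real parts
  \<open>\<plusminus> Im z / h\<close> do not vanish.
\<close>

lemma free_dirac_solvable:
  assumes h: "h > 0" and z: "Im z \<noteq> 0" and f: "sqint f1" "sqint f2"
  shows "\<exists>u v. dirac_solution h (\<lambda>_. 0) (\<lambda>_. 0) z f1 f2 u v"
proof -
  have "Re (z / (\<i> * h)) \<noteq> 0" "Re (- z / (\<i> * h)) \<noteq> 0"
    using h z by (auto simp: Re_divide power2_eq_square)
  moreover have "sqint (\<lambda>x. (1 / (\<i> * h)) * f1 x)" "sqint (\<lambda>x. (- 1 / (\<i> * h)) * f2 x)"
    by (intro sqint_cmult f)+
  ultimately obtain u v where "sqint u" "primitive u (\<lambda>x. z / (\<i> * h) * u x + (1 / (\<i> * h)) * f1 x)"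
    "sqint v" "primitive v (\<lambda>x. - z / (\<i> * h) * v x + (- 1 / (\<i> * h)) * f2 x)"
    using scalar_equation_solvable by meson
  moreover have "(\<lambda>x. z / (\<i> * h) * u x + (1 / (\<i> * h)) * f1 x) = (\<lambda>x. (f1 x + \<i> * 0 * v x + z * u x) / (\<i> * h))"
    "(\<lambda>x. - z / (\<i> * h) * v x + (- 1 / (\<i> * h)) * f2 x) = (\<lambda>x. (\<i> * 0 * u x - z * v x - f2 x) / (\<i> * h))"
    using h by (auto simp: fun_eq_iff field_simps)
  ultimately have "dirac_solution h (\<lambda>_. 0) (\<lambda>_. 0) z f1 f2 u v"
    unfolding dirac_solution_def by simp
  then show ?thesis by blast
qed

section \<open>The resolvent set\<close>

lemma sqint_AE_cong:
  assumes f: "sqint f" and ae: "AE x in lebesgue. f x = g x"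
  shows "sqint g"
proof -
  have m: "g \<in> borel_measurable lebesgue"
  proof (rule measurableI)
    fix S :: "complex set" assume S: "S \<in> sets borel"
    show "g -` S \<inter> space lebesgue \<in> sets lebesgue"
    proof (rule completion.in_sets_AE)
      show "f -` S \<inter> space lebesgue \<in> sets lebesgue" using sqintD(1)[OF f] S by (rule measurable_sets)
      show "AE x in lebesgue. x \<in> f -` S \<inter> space lebesgue \<longleftrightarrow> x \<in> g -` S \<inter> space lebesgue"
        using ae by eventually_elim auto
    qed auto
  qed auto
  have "integrable lebesgue (\<lambda>x. (norm (g x))\<^sup>2)"
  proof (rule integrable_cong_AE_imp[OF sqintD(2)[OF f]])
    show "(\<lambda>x. (norm (g x))\<^sup>2) \<in> borel_measurable lebesgue" using m by auto
    show "AE x in lebesgue. (norm (f x))\<^sup>2 = (norm (g x))\<^sup>2" using ae by eventually_elim simp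
  qed
  with m show ?thesis by (simp add: sqint_def)
qed

text \<open>
  The path \<open>t p\<close>, \<open>t q\<close> keeps the bounds on the potentials and their derivatives and the reality of the
  product, so one step size works along the whole path.
\<close>

lemma dirac_solvable:
  fixes h r P R K :: real and z :: complex
  assumes h: "h > 0" and r: "r > 0" and PR: "P \<ge> 0" "R \<ge> 0"
    and gap: "h * (r\<^sup>2 * P + R) / (2 * r) < \<bar>Im (z\<^sup>2)\<bar>"
    and adm: "admissible K P R p q" and f: "sqint f1" "sqint f2"
  shows "\<exists>u v. dirac_solution h p q z f1 f2 u v"
proof -
  have p: "AC_loc p" "\<And>x. norm (p x) \<le> K" "AE x in lebesgue. norm (ae_deriv p x) \<le> P"
    and q: "AC_loc q" "\<And>x. norm (q x) \<le> K" "AE x in lebesgue. norm (ae_deriv q x) \<le> R"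
    and pq: "\<And>x. Im (p x * q x) = 0"
    using adm by (auto simp: admissible_def)
  have K: "K \<ge> 0" using order_trans[OF norm_ge_zero p(2)] .
  obtain A where A: "A > 0" and est:
    "\<And>p q f1 f2 u v. admissible K P R p q \<Longrightarrow> sqint f1 \<Longrightarrow> sqint f2 \<Longrightarrow>
       dirac_solution h p q z f1 f2 u v \<Longrightarrow> energy u v \<le> A * energy f1 f2"
    using energy_estimate[OF h r K PR gap] by blast
  obtain n :: nat where n: "1 + 4 * A * K\<^sup>2 < real n" using reals_Archimedean2 by blast
  have "4 * A * K\<^sup>2 \<ge> 0" using A by simp
  then have n1: "real n > 1" using n by linarith
  define t where "t k = real k / real n" for k :: nat
  have tstep: "A * (K / n)\<^sup>2 \<le> 1 / 4"
  proof -
    have "4 * A * K\<^sup>2 \<le> real n * real n" using n n1 mult_left_mono[of 1 "real n" "real n"] by linarith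
    then show ?thesis using n1 by (simp add: power_divide power2_eq_square field_simps)
  qed
  have scaled: "AC_loc (\<lambda>x. complex_of_real c * w x)" "norm (complex_of_real c * w x) \<le> K"
      "AE x in lebesgue. norm (ae_deriv (\<lambda>x. complex_of_real c * w x) x) \<le> Q"
    if w: "AC_loc w" "\<And>x. norm (w x) \<le> K" "AE x in lebesgue. norm (ae_deriv w x) \<le> Q" and c: "0 \<le> c" "c \<le> 1"
    for w :: "real \<Rightarrow> complex" and c Q x
  proof -
    show "AC_loc (\<lambda>x. complex_of_real c * w x)" by (intro AC_loc_mult AC_loc_const w)
    show "norm (complex_of_real c * w x) \<le> K"
      using c w(2)[of x] mult_mono[of c 1 "norm (w x)" K] by (simp add: norm_mult)
    show "AE x in lebesgue. norm (ae_deriv (\<lambda>x. complex_of_real c * w x) x) \<le> Q"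
      using AC_loc_primitive_vector_derivative(1)[OF w(1)] w(3)
    proof eventually_elim
      case (elim x)
      have "((\<lambda>x. complex_of_real c * w x) has_vector_derivative complex_of_real c * ae_deriv w x) (at x)"
        using elim(1) by (rule has_vector_derivative_mult_right)
      then have "ae_deriv (\<lambda>x. complex_of_real c * w x) x = complex_of_real c * ae_deriv w x" by (rule vector_derivative_at)
      then show ?case using c elim(2) mult_right_mono[of c 1 "norm (ae_deriv w x)"] by (simp add: norm_mult)
    qed
  qed
  have Imz: "Im z \<noteq> 0"
  proof
    assume "Im z = 0"
    then have "Im (z\<^sup>2) = 0" by (simp add: power2_eq_square)
    moreover have "h * (r\<^sup>2 * P + R) / (2 * r) \<ge> 0" using h r PR by simp
    ultimately show False using gap by simp
  qed
  have "\<forall>f1 f2. sqint f1 \<longrightarrow> sqint f2 \<longrightarrow> (\<exists>u v. dirac_solution h (\<lambda>x. t k * p x) (\<lambda>x. t k * q x) z f1 f2 u v)"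
    if "k \<le> n" for k
    using that
  proof (induction k)
    case 0
    then show ?case using free_dirac_solvable[OF h Imz] by (simp add: t_def)
  next
    case (Suc k)
    have tk: "0 \<le> t k" "t k \<le> 1" "0 \<le> t (Suc k)" "t (Suc k) \<le> 1" using Suc.prems n1 by (auto simp: t_def)
    have diff: "complex_of_real (t (Suc k)) * w - complex_of_real (t k) * w = complex_of_real (1 / n) * w" for w
      unfolding left_diff_distrib[symmetric] of_real_diff[symmetric] t_def diff_divide_distrib[symmetric] by simp
    have near: "norm (complex_of_real (t (Suc k)) * w - complex_of_real (t k) * w) \<le> K / n" if "norm w \<le> K" for w
      unfolding diff norm_mult using that n1 by (simp add: norm_divide divide_right_mono)
    have near_p: "norm (complex_of_real (t (Suc k)) * p x - complex_of_real (t k) * p x) \<le> K / n"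
      and near_q: "norm (complex_of_real (t (Suc k)) * q x - complex_of_real (t k) * q x) \<le> K / n" for x
      using near p(2) q(2) by blast+
    note P = scaled[OF p tk(1,2)] and Q = scaled[OF q tk(1,2)]
    note P' = scaled[OF p tk(3,4)] and Q' = scaled[OF q tk(3,4)]
    show ?case
    proof (intro allI impI)
      fix f1 f2 assume f: "sqint f1" "sqint f2"
      show "\<exists>u v. dirac_solution h (\<lambda>x. t (Suc k) * p x) (\<lambda>x. t (Suc k) * q x) z f1 f2 u v"
      proof (rule perturbation_solvable[OF h P(1,2) Q(1,2) P'(1) near_p Q'(1) near_q _ _ A tstep f])
        fix f1 f2 assume f: "sqint f1" "sqint f2"
        show "\<exists>u v. dirac_solution h (\<lambda>x. t k * p x) (\<lambda>x. t k * q x) z f1 f2 u v"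
          using Suc.IH Suc.prems f by simp
        have real: "Im (complex_of_real (t k) * p x * (complex_of_real (t k) * q x)) = 0" for x
        proof -
          have "complex_of_real (t k) * p x * (complex_of_real (t k) * q x) = complex_of_real (t k * t k) * (p x * q x)"
            by (simp add: mult_ac)
          moreover have "Im (complex_of_real c * w) = c * Im w" for c w by simp
          ultimately show ?thesis by (simp only: pq mult_zero_right)
        qed
        have "admissible K P R (\<lambda>x. t k * p x) (\<lambda>x. t k * q x)"
          using P Q real by (simp add: admissible_def)
        then show "energy u v \<le> A * energy f1 f2"
          if "dirac_solution h (\<lambda>x. t k * p x) (\<lambda>x. t k * q x) z f1 f2 u v" for u v
          using f that by (rule est)
      qed
    qed
  qed
  from this[of n] show ?thesis using f n1 by (simp add: t_def)
qed


lemma norm_complex_2_sq: "(norm (a :: complex^2))\<^sup>2 = (norm (a $ 1))\<^sup>2 + (norm (a $ 2))\<^sup>2"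
  by (simp add: norm_vec_def L2_set_def sum_2)

lemma bounded_linear_axis: "bounded_linear (axis j :: complex \<Rightarrow> complex^2)"
  unfolding linear_conv_bounded_linear[symmetric]
  by (rule linearI) (auto simp: vec_eq_iff axis_def)

lemma L2_iff_sqint: "f \<in> L2 \<longleftrightarrow> sqint (\<lambda>x. f x $ 1) \<and> sqint (\<lambda>x. f x $ 2)"
proof
  assume f: "f \<in> L2"
  have comp: "sqint (\<lambda>x. f x $ j)" for j
    unfolding sqint_def
  proof
    have "(\<lambda>a::complex^2. a $ j) \<in> borel_measurable borel" by (intro borel_measurable_continuous_onI continuous_intros)
    then show m: "(\<lambda>x. f x $ j) \<in> borel_measurable lebesgue"
      using f by (auto simp: L2_def intro: measurable_compose)
    show "integrable lebesgue (\<lambda>x. (norm (f x $ j))\<^sup>2)"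
    proof (rule Bochner_Integration.integrable_bound)
      show "integrable lebesgue (\<lambda>x. (norm (f x))\<^sup>2)" using f by (simp add: L2_def)
      show "(\<lambda>x. (norm (f x $ j))\<^sup>2) \<in> borel_measurable lebesgue" using m by auto
      show "AE x in lebesgue. norm ((norm (f x $ j))\<^sup>2) \<le> norm ((norm (f x))\<^sup>2)"
        by (intro AE_I2) (simp add: Finite_Cartesian_Product.norm_nth_le power_mono)
    qed
  qed
  then show "sqint (\<lambda>x. f x $ 1) \<and> sqint (\<lambda>x. f x $ 2)" by simp
next
  assume s: "sqint (\<lambda>x. f x $ 1) \<and> sqint (\<lambda>x. f x $ 2)"
  have ax: "(axis j :: complex \<Rightarrow> complex^2) \<in> borel_measurable borel" for j
    by (intro borel_measurable_continuous_onI linear_continuous_on bounded_linear_axis)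
  have "(\<lambda>x. axis 1 (f x $ 1) + axis 2 (f x $ 2) :: complex^2) \<in> borel_measurable lebesgue"
    using s by (intro borel_measurable_add measurable_compose[OF _ ax]) (auto simp: sqint_def)
  moreover have "(\<lambda>x. axis 1 (f x $ 1) + axis 2 (f x $ 2) :: complex^2) = f"
    by (auto simp: fun_eq_iff vec_eq_iff forall_2 axis_def)
  ultimately show "f \<in> L2" using s by (simp add: L2_def norm_complex_2_sq sqint_def)
qed

lemma L2_norm_energy: "L2_norm f = sqrt (energy (\<lambda>x. f x $ 1) (\<lambda>x. f x $ 2))"
  by (simp add: L2_norm_def norm_complex_2_sq)

lemma dirac_components:
  "dirac h p q \<psi> x $ 1 = \<i> * h * (ae_deriv \<psi> x $ 1) - \<i> * q x * (\<psi> x $ 2)"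
  "dirac h p q \<psi> x $ 2 = - \<i> * h * (ae_deriv \<psi> x $ 2) + \<i> * p x * (\<psi> x $ 1)"
  by (simp_all add: dirac_def sigma3_def potential_def matrix_vector_mult_def sum_2)

text \<open>At the exceptional points the derivative of the pair is an arbitrary value, unrelated to the derivatives of the components.\<close>

lemma AE_vector_derivative_components:
  fixes \<psi> :: "real \<Rightarrow> complex^2"
  assumes "AC_loc (\<lambda>x. \<psi> x $ 1)" "AC_loc (\<lambda>x. \<psi> x $ 2)"
  shows "AE x in lebesgue. ae_deriv \<psi> x $ 1 = ae_deriv (\<lambda>x. \<psi> x $ 1) x \<and> ae_deriv \<psi> x $ 2 = ae_deriv (\<lambda>x. \<psi> x $ 2) x"
  using AC_loc_primitive_vector_derivative(1)[OF assms(1)] AC_loc_primitive_vector_derivative(1)[OF assms(2)]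
proof eventually_elim
  case (elim x)
  have eq: "(\<lambda>x. axis 1 (\<psi> x $ 1) + axis 2 (\<psi> x $ 2)) = \<psi>"
    by (auto simp: fun_eq_iff vec_eq_iff forall_2 axis_def)
  have "((\<lambda>x. axis 1 (\<psi> x $ 1) + axis 2 (\<psi> x $ 2) :: complex^2) has_vector_derivative
      (axis 1 (ae_deriv (\<lambda>x. \<psi> x $ 1) x) + axis 2 (ae_deriv (\<lambda>x. \<psi> x $ 2) x))) (at x)"
    by (intro has_vector_derivative_add bounded_linear.has_vector_derivative[OF bounded_linear_axis] elim)
  then have "ae_deriv \<psi> x = axis 1 (ae_deriv (\<lambda>x. \<psi> x $ 1) x) + axis 2 (ae_deriv (\<lambda>x. \<psi> x $ 2) x)"
    unfolding eq by (rule vector_derivative_at)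
  then show ?case by (simp add: axis_def)
qed

lemma dirac_domain_imp_solution:
  assumes h: "h > 0" and \<psi>: "\<psi> \<in> dirac_domain h p q"
  shows "dirac_solution h p q z (\<lambda>x. (dirac h p q \<psi> x - z *s \<psi> x) $ 1) (\<lambda>x. (dirac h p q \<psi> x - z *s \<psi> x) $ 2)
     (\<lambda>x. \<psi> x $ 1) (\<lambda>x. \<psi> x $ 2)"
proof -
  have AC: "AC_loc (\<lambda>x. \<psi> x $ 1)" "AC_loc (\<lambda>x. \<psi> x $ 2)" and s: "sqint (\<lambda>x. \<psi> x $ 1)" "sqint (\<lambda>x. \<psi> x $ 2)"
    using \<psi> by (auto simp: dirac_domain_def L2_iff_sqint)
  note P = AC_loc_primitive_vector_derivative(2)[OF AC(1)] AC_loc_primitive_vector_derivative(2)[OF AC(2)]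
  have 1: "AE x in lebesgue. ae_deriv (\<lambda>x. \<psi> x $ 1) x
     = ((dirac h p q \<psi> x - z *s \<psi> x) $ 1 + \<i> * q x * (\<psi> x $ 2) + z * (\<psi> x $ 1)) / (\<i> * h)"
    using AE_vector_derivative_components[OF AC] by eventually_elim (use h in \<open>simp add: dirac_components\<close>)
  have 2: "AE x in lebesgue. ae_deriv (\<lambda>x. \<psi> x $ 2) x
     = (\<i> * p x * (\<psi> x $ 1) - z * (\<psi> x $ 2) - (dirac h p q \<psi> x - z *s \<psi> x) $ 2) / (\<i> * h)"
    using AE_vector_derivative_components[OF AC] by eventually_elim (use h in \<open>simp add: dirac_components\<close>)
  show ?thesis
    unfolding dirac_solution_def
    by (intro conjI s primitive_cong_AE[OF P(1) 1] primitive_cong_AE[OF P(2) 2])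
qed

lemma solution_imp_dirac_domain:
  assumes h: "h > 0" and f: "f \<in> L2" and sol: "dirac_solution h p q z (\<lambda>x. f x $ 1) (\<lambda>x. f x $ 2) u v"
  shows "\<exists>\<psi>\<in>dirac_domain h p q. AE x in lebesgue. dirac h p q \<psi> x - z *s \<psi> x = f x"
proof -
  define \<psi> :: "real \<Rightarrow> complex^2" where "\<psi> x = vector [u x, v x]" for x
  have \<psi>: "(\<lambda>x. \<psi> x $ 1) = u" "(\<lambda>x. \<psi> x $ 2) = v" "\<psi> x $ 1 = u x" "\<psi> x $ 2 = v x" for x
    by (simp_all add: \<psi>_def)
  have u: "sqint u" "primitive u (\<lambda>x. (f x $ 1 + \<i> * q x * v x + z * u x) / (\<i> * h))"
    and v: "sqint v" "primitive v (\<lambda>x. (\<i> * p x * u x - z * v x - f x $ 2) / (\<i> * h))"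
    using sol by (auto simp: dirac_solution_def)
  have AC: "AC_loc (\<lambda>x. \<psi> x $ 1)" "AC_loc (\<lambda>x. \<psi> x $ 2)"
    unfolding \<psi> by (rule primitive_imp_AC_loc[OF u(2)], rule primitive_imp_AC_loc[OF v(2)])
  have eq: "AE x in lebesgue. dirac h p q \<psi> x - z *s \<psi> x = f x"
    using AE_vector_derivative_components[OF AC] primitive_AE_has_vector_derivative[OF u(2)] primitive_AE_has_vector_derivative[OF v(2)]
  proof eventually_elim
    case (elim x)
    then have "ae_deriv \<psi> x $ 1 = (f x $ 1 + \<i> * q x * v x + z * u x) / (\<i> * h)"
      "ae_deriv \<psi> x $ 2 = (\<i> * p x * u x - z * v x - f x $ 2) / (\<i> * h)"
      by (auto simp: \<psi> dest!: vector_derivative_at)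
    then show ?case using h by (simp add: vec_eq_iff forall_2 dirac_components \<psi>)
  qed
  have "dirac h p q \<psi> \<in> L2"
    unfolding L2_iff_sqint
  proof
    have s: "sqint (\<lambda>x. f x $ 1 + z * u x)" "sqint (\<lambda>x. f x $ 2 + z * v x)"
      using f u v by (auto simp: L2_iff_sqint intro!: sqint_add sqint_cmult)
    have ae: "AE x in lebesgue. f x $ 1 + z * u x = dirac h p q \<psi> x $ 1" "AE x in lebesgue. f x $ 2 + z * v x = dirac h p q \<psi> x $ 2"
      using eq by (eventually_elim, auto simp: \<psi> dest!: sym[of _ "f _"])+
    show "sqint (\<lambda>x. dirac h p q \<psi> x $ 1)" by (rule sqint_AE_cong[OF s(1) ae(1)])
    show "sqint (\<lambda>x. dirac h p q \<psi> x $ 2)" by (rule sqint_AE_cong[OF s(2) ae(2)])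
  qed
  then have "\<psi> \<in> dirac_domain h p q"
    using AC u v by (auto simp: dirac_domain_def L2_iff_sqint \<psi> forall_2)
  with eq show ?thesis by blast
qed

lemma Linf_AE_bound:
  assumes "f \<in> Linf"
  shows "AE x in lebesgue. norm (f x) \<le> Linf_norm f"
proof -
  have fin: "Linf_seminorm f < top" using assms by (simp add: Linf_def)
  have "AE x in lebesgue. ennreal (norm (f x)) \<le> Linf_seminorm f"
    unfolding Linf_seminorm_def by (rule esssup_AE)
  then show ?thesis
  proof eventually_elim
    case (elim x)
    then have "enn2real (ennreal (norm (f x))) \<le> enn2real (Linf_seminorm f)"
      using fin by (intro enn2real_mono) auto
    then show ?case by (simp add: Linf_norm_def)
  qed
qed

lemma periodic_AC_loc_bounded:
  assumes f: "AC_loc f" and per: "\<And>x. f (x + 1) = f x"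
  obtains K where "\<And>x. norm (f x) \<le> K"
proof -
  interpret periodic_fun_simple' f by standard (rule per)
  have "bounded (f ` {0..1})"
    by (intro compact_imp_bounded compact_continuous_image AC_loc_continuous f) simp
  then obtain K where K: "\<And>x. x \<in> {0..1} \<Longrightarrow> norm (f x) \<le> K" unfolding bounded_iff by blast
  have "norm (f x) \<le> K" for x
  proof -
    have "f x = f (frac x)" using plus_of_int[of "frac x" "\<lfloor>x\<rfloor>"] by (simp add: frac_def)
    then show ?thesis using K[of "frac x"] frac_lt_1[of x] by simp
  qed
  then show ?thesis by (rule that)
qed

text \<open>
  If \<open>P\<close> and \<open>R\<close> are positive, the minimum over \<open>r\<close> is attained at \<open>r = sqrt (R / P)\<close> and equals
  \<open>h * sqrt (P * R)\<close>. If one of them vanishes, the infimum is zero and is approached as \<open>r\<close> tends to infinity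
  or to zero.
\<close>

lemma balancing_weight:
  fixes h P R m :: real
  assumes h: "h > 0" and P: "P \<ge> 0" and R: "R \<ge> 0" and m: "h * sqrt (P * R) < m"
  obtains r where "r > 0" "h * (r\<^sup>2 * P + R) / (2 * r) < m"
proof -
  have m0: "m > 0" using m h mult_nonneg_nonneg[OF P R] by (meson le_less_trans less_imp_le mult_nonneg_nonneg real_sqrt_ge_zero)
  consider "P = 0" | "R = 0" "P > 0" | "P > 0" "R > 0" using P R by linarith
  then show ?thesis
  proof cases
    case 1
    \<comment> \<open>large \<open>r\<close>: any \<open>r > h R / (2 m)\<close> would do\<close>
    define x where "x = h * R / m"
    have x: "x \<ge> 0" "h * R = x * m" using h R m0 by (simp_all add: x_def)
    have "m * (2 * (x + 1)) = 2 * (x * m) + 2 * m" by (simp add: algebra_simps)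
    then have "h * R < m * (2 * (x + 1))" using x mult_nonneg_nonneg[of x m] m0 by linarith
    then have "h * R / (2 * (x + 1)) < m" using x(1) by (subst pos_divide_less_eq) auto
    then show ?thesis using that[of "x + 1"] 1 x(1) by simp
  next
    case 2
    then show ?thesis using that[of "m / (h * P)"] h m0 by (simp add: power2_eq_square field_simps)
  next
    case 3
    define r where "r = sqrt R / sqrt P"
    have r: "r > 0" using 3 by (simp add: r_def)
    have "r\<^sup>2 * P + R = 2 * R" using 3 by (simp add: r_def power_divide)
    then have "h * (r\<^sup>2 * P + R) / (2 * r) = h * (R / sqrt R * sqrt P)" using r by (simp add: r_def field_simps)
    also have "\<dots> = h * sqrt (P * R)" using 3 by (simp add: real_div_sqrt real_sqrt_mult mult.commute)
    finally show ?thesis using that[OF r] m by simp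
  qed
qed

theorem lemma4p5:
  fixes h :: real and p q :: "real \<Rightarrow> complex" and z :: complex
  assumes h_pos: "h > 0"
    and p_periodic: "\<And>x. p (x + 1) = p x"
    and q_periodic: "\<And>x. q (x + 1) = q x"
    and p_AC: "AC_loc p"
    and q_AC: "AC_loc q"
    and p_deriv: "ae_deriv p \<in> Linf"
    and q_deriv: "ae_deriv q \<in> Linf"
    and pq_real: "\<And>x. cnj (p x) * cnj (q x) = p x * q x"
    and z_spec: "z \<in> dirac_spectrum h p q"
  shows "\<bar>Re z\<bar> * \<bar>Im z\<bar> \<le> h / 2 * sqrt (Linf_norm (ae_deriv p) * Linf_norm (ae_deriv q))"
proof (rule ccontr)
  define P where "P = Linf_norm (ae_deriv p)"
  define R where "R = Linf_norm (ae_deriv q)"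
  have PR: "P \<ge> 0" "R \<ge> 0" by (simp_all add: P_def R_def Linf_norm_def)
  assume "\<not> ?thesis"
  then have "h * sqrt (P * R) < \<bar>Im (z\<^sup>2)\<bar>"
    by (simp add: P_def R_def power2_eq_square abs_mult algebra_simps)
  then obtain r where r: "r > 0" and gap: "h * (r\<^sup>2 * P + R) / (2 * r) < \<bar>Im (z\<^sup>2)\<bar>"
    using balancing_weight[OF h_pos PR] by blast
  obtain K1 K2 where K12: "\<And>x. norm (p x) \<le> K1" "\<And>x. norm (q x) \<le> K2"
    using periodic_AC_loc_bounded[of p, OF p_AC p_periodic] periodic_AC_loc_bounded[of q, OF q_AC q_periodic] by meson
  define K where "K = max K1 K2"
  have K: "norm (p x) \<le> K" "norm (q x) \<le> K" for x using K12[of x] by (auto simp: K_def)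
  have K0: "K \<ge> 0" using order_trans[OF norm_ge_zero K(1)] .
  have p': "AE x in lebesgue. norm (ae_deriv p x) \<le> P" and q': "AE x in lebesgue. norm (ae_deriv q x) \<le> R"
    unfolding P_def R_def by (intro Linf_AE_bound p_deriv q_deriv)+
  have pq: "Im (p x * q x) = 0" for x
  proof -
    have "Im w = 0" if "cnj w = w" for w using arg_cong[OF that, of Im] by simp
    moreover have "cnj (p x * q x) = p x * q x" using pq_real[of x] by simp
    ultimately show ?thesis by blast
  qed
  obtain A where A: "A > 0" and est:
    "\<And>p q f1 f2 u v. admissible K P R p q \<Longrightarrow> sqint f1 \<Longrightarrow> sqint f2 \<Longrightarrow>
       dirac_solution h p q z f1 f2 u v \<Longrightarrow> energy u v \<le> A * energy f1 f2"
    using energy_estimate[OF h_pos r K0 PR gap] by blast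
  have adm: "admissible K P R p q" using p_AC q_AC K p' q' pq by (simp add: admissible_def)
  note estimate = est[OF adm]
  let ?D = "\<lambda>\<psi> x. dirac h p q \<psi> x - z *s \<psi> x"
  have D_sqint: "sqint (\<lambda>x. ?D \<psi> x $ 1)" "sqint (\<lambda>x. ?D \<psi> x $ 2)" if "\<psi> \<in> dirac_domain h p q" for \<psi>
    using that by (auto simp: dirac_domain_def L2_iff_sqint intro!: sqint_diff sqint_cmult)
  have "z \<in> resolvent_set (dirac_domain h p q) (dirac h p q)"
    unfolding resolvent_set_def mem_Collect_eq
  proof (intro conjI ballI impI)
    fix f assume f: "f \<in> L2"
    then obtain u v where "dirac_solution h p q z (\<lambda>x. f x $ 1) (\<lambda>x. f x $ 2) u v"
      using dirac_solvable[OF h_pos r PR gap adm] unfolding L2_iff_sqint by blast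
    then show "\<exists>\<psi>\<in>dirac_domain h p q. AE x in lebesgue. ?D \<psi> x = f x"
      by (rule solution_imp_dirac_domain[OF h_pos f])
  next
    fix \<psi> \<phi> assume dom: "\<psi> \<in> dirac_domain h p q" "\<phi> \<in> dirac_domain h p q" and eq: "AE x in lebesgue. ?D \<psi> x = ?D \<phi> x"
    let ?f1 = "\<lambda>x. ?D \<psi> x $ 1 - ?D \<phi> x $ 1" and ?f2 = "\<lambda>x. ?D \<psi> x $ 2 - ?D \<phi> x $ 2"
    let ?u = "\<lambda>x. \<psi> x $ 1 - \<phi> x $ 1" and ?v = "\<lambda>x. \<psi> x $ 2 - \<phi> x $ 2"
    have sol: "dirac_solution h p q z ?f1 ?f2 ?u ?v"
      by (intro dirac_solution_diff dirac_domain_imp_solution h_pos dom)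
    have "energy ?u ?v \<le> A * energy ?f1 ?f2"
      by (intro estimate sol sqint_diff D_sqint dom)
    also have "energy ?f1 ?f2 = 0"
    proof -
      have "AE x in lebesgue. (norm (?f1 x))\<^sup>2 + (norm (?f2 x))\<^sup>2 = 0" using eq by eventually_elim simp
      then show ?thesis by (rule integral_eq_zero_AE)
    qed
    finally have "energy ?u ?v = 0" using energy_nonneg[of ?u ?v] by simp
    moreover have uv: "sqint ?u" "sqint ?v" using sol by (auto simp: dirac_solution_def)
    ultimately have "AE x in lebesgue. (norm (?u x))\<^sup>2 + (norm (?v x))\<^sup>2 = 0"
      using sqintD(2)[OF uv(1)] sqintD(2)[OF uv(2)] by (subst (asm) integral_nonneg_eq_0_iff_AE) auto
    then show "AE x in lebesgue. \<psi> x = \<phi> x"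
      by eventually_elim (auto simp: vec_eq_iff forall_2 add_nonneg_eq_0_iff)
  next
    have "L2_norm \<psi> \<le> sqrt A * L2_norm (?D \<psi>)" if dom: "\<psi> \<in> dirac_domain h p q" for \<psi>
    proof -
      have "energy (\<lambda>x. \<psi> x $ 1) (\<lambda>x. \<psi> x $ 2) \<le> A * energy (\<lambda>x. ?D \<psi> x $ 1) (\<lambda>x. ?D \<psi> x $ 2)"
        by (intro estimate D_sqint dom dirac_domain_imp_solution h_pos)
      then show ?thesis unfolding L2_norm_energy real_sqrt_mult[symmetric] by (rule real_sqrt_le_mono)
    qed
    then show "\<exists>C. \<forall>\<psi>\<in>dirac_domain h p q. L2_norm \<psi> \<le> C * L2_norm (?D \<psi>)" by blast
  qed
  with z_spec show False by (simp add: dirac_spectrum_def spectrum_def)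
qed

end
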